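(* Let $\mathbf G\sim\mathcal H^{u}_2(m,n)$ be a random graph with $m=\Delta n$ and $\Delta=n^{\delta}$ for some constant $\delta>0$. For any $\eta\in[0,1]$ there is a polynomial-time algorithm which, given $\mathbf G$, outputs a number $N(\mathbf G)$ such that for every input graph $G$ and every $2\mathsf{XOR}$ instance on $G$ (with arbitrary signs), the number of $(1-\eta)$-satisfying assignments of that instance is at most $N(G)$, and with probability at least $1-\exp(-n^{\Omega(\delta)})$ over $\mathbf G$, \[N(\mathbf G)\le\begin{cases}2 & \text{if }\eta\le\frac{1}{3n},\\ 2e^{3\eta n\log n}&\text{if }\eta>\frac1{3n}.\end{cases}\]
   Context: $\mathcal H^u_k(m,n)$ denotes the distribution of unsigned $k$-uniform hypergraphs on $[n]$ obtained by including each ordered tuple $U\in[n]^k$ independently for each of the $2^k$ sign patterns with probability $\frac{m}{2^kn^k}$ and then discarding the signs (so it is a collection of tuples, possibly with repetitions; for $k=2$ it is a random (multi)graph). A $k\mathsf{XOR}$ instance on a hypergraph $H$ assigns to each hyperedge $U$ of $H$ a sign $b_U\in\{\pm1\}$; an assignment $x\in\{\pm1\}^n$ satisfies the constraint $(b_U,U)$ if $\prod_{i=1}^k x_{U_i}=b_U$, and $x$ is $(1-\eta)$-satisfying if it satisfies at least a $(1-\eta)$ fraction of the constraints. *)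

theory Defs
  imports
    "HOL-Probability.Product_PMF"
    "HOL-Computational_Algebra.Polynomial"
    "HOL-Library.Log_Nat"
    "HOL-Library.Multiset"
begin

section \<open>Unsigned hypergraphs and XOR instances\<close>

text \<open>
  A hyperedge on \<open>[n] = {1..n}\<close> is an ordered tuple, represented as a list of length \<open>k\<close>; entries
  of a tuple may coincide. A hypergraph is a multiset of tuples, so tuples may be repeated.
\<close>

definition tuples :: "nat \<Rightarrow> nat \<Rightarrow> nat list set" where
  "tuples k n = {U. length U = k \<and> set U \<subseteq> {1..n}}"

definition sign_patterns :: "nat \<Rightarrow> int list set" where
  "sign_patterns k = {\<sigma>. length \<sigma> = k \<and> set \<sigma> \<subseteq> {1, -1}}"

definition hypergraph :: "nat \<Rightarrow> nat \<Rightarrow> nat list multiset \<Rightarrow> bool" where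
  "hypergraph k n H \<longleftrightarrow> set_mset H \<subseteq> tuples k n"

text \<open>
  The distribution \<open>\<H>\<^sup>u\<^sub>k(m,n)\<close>. The parameter \<open>m\<close> is real; the distribution is the intended one
  only if the inclusion probability \<open>m / (2^k n^k)\<close> lies in \<open>[0,1]\<close>.
\<close>

definition random_hypergraph :: "nat \<Rightarrow> real \<Rightarrow> nat \<Rightarrow> nat list multiset pmf" where
  "random_hypergraph k m n =
     map_pmf (\<lambda>inc. image_mset fst (mset_set {e \<in> tuples k n \<times> sign_patterns k. inc e}))
       (Pi_pmf (tuples k n \<times> sign_patterns k) False
          (\<lambda>_. bernoulli_pmf (m / (2 ^ k * real n ^ k))))"

text \<open>
  A constraint is a pair \<open>(b, U)\<close>. Different copies of a repeated tuple may carry different signs.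
\<close>

definition xor_instance :: "(int \<times> nat list) multiset \<Rightarrow> nat list multiset \<Rightarrow> bool" where
  "xor_instance I H \<longleftrightarrow> image_mset snd I = H \<and> (\<forall>(b, U) \<in># I. b \<in> {1, -1})"

definition satisfies :: "(nat \<Rightarrow> int) \<Rightarrow> int \<times> nat list \<Rightarrow> bool" where
  "satisfies x C \<longleftrightarrow> prod_list (map x (snd C)) = fst C"

definition satisfying_assignments ::
    "nat \<Rightarrow> real \<Rightarrow> (int \<times> nat list) multiset \<Rightarrow> (nat \<Rightarrow> int) set" where
  "satisfying_assignments n \<eta> I =
     {x \<in> {1..n} \<rightarrow>\<^sub>E {1, -1}.
        real (size (filter_mset (satisfies x) I)) \<ge> (1 - \<eta>) * real (size I)}"


section \<open>Polynomial-time algorithms\<close>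

text \<open>
  The machine model is a random access machine over the natural numbers with logarithmic (bit)
  cost, with structured control flow. The memory consists of finitely many named arrays (those
  that occur in the program); a scalar variable is an array used only at index 0.
  Subtraction is truncated and division is Euclidean, with \<open>x div 0 = 0\<close>.
\<close>

type_synonym mem = "string \<Rightarrow> nat \<Rightarrow> nat"

datatype aexp =
    Num nat
  | Arr string aexp
  | Plus aexp aexp
  | Minus aexp aexp
  | Times aexp aexp
  | Quot aexp aexp

datatype com =
    Skip
  | Assign string aexp aexp
  | Seq com com
  | Cond aexp com com
  | While aexp com

fun aval :: "aexp \<Rightarrow> mem \<Rightarrow> nat" where
  "aval (Num k) s = k"
| "aval (Arr a e) s = s a (aval e s)"
| "aval (Plus e f) s = aval e s + aval f s"
| "aval (Minus e f) s = aval e s - aval f s"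
| "aval (Times e f) s = aval e s * aval f s"
| "aval (Quot e f) s = aval e s div aval f s"

text \<open>
  Each node of an expression is charged one plus the number of bits of its value, as
  \<open>floorlog 2\<close> is the binary length. Addresses are charged too, being subexpressions.
\<close>

fun acost :: "aexp \<Rightarrow> mem \<Rightarrow> nat" where
  "acost (Num k) s = 1 + floorlog 2 k"
| "acost (Arr a e) s = acost e s + 1 + floorlog 2 (aval (Arr a e) s)"
| "acost (Plus e f) s = acost e s + acost f s + 1 + floorlog 2 (aval (Plus e f) s)"
| "acost (Minus e f) s = acost e s + acost f s + 1 + floorlog 2 (aval (Minus e f) s)"
| "acost (Times e f) s = acost e s + acost f s + 1 + floorlog 2 (aval (Times e f) s)"
| "acost (Quot e f) s = acost e s + acost f s + 1 + floorlog 2 (aval (Quot e f) s)"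

text \<open>
  \<open>exec c s t s'\<close>: started in memory \<open>s\<close>, the program \<open>c\<close> halts after time \<open>t\<close> in memory \<open>s'\<close>.
  \<open>Assign a e f\<close> is \<open>a[e] := f\<close>; a guard counts as true iff its value is nonzero.
\<close>

inductive exec :: "com \<Rightarrow> mem \<Rightarrow> nat \<Rightarrow> mem \<Rightarrow> bool" where
  Skip: "exec Skip s 1 s"
| Assign: "exec (Assign a e f) s (acost e s + acost f s + 1)
             (s(a := (s a)(aval e s := aval f s)))"
| Seq: "exec c s t s' \<Longrightarrow> exec d s' t' s'' \<Longrightarrow> exec (Seq c d) s (t + t') s''"
| CondTrue: "aval e s \<noteq> 0 \<Longrightarrow> exec c s t s' \<Longrightarrow> exec (Cond e c d) s (acost e s + t + 1) s'"
| CondFalse: "aval e s = 0 \<Longrightarrow> exec d s t s' \<Longrightarrow> exec (Cond e c d) s (acost e s + t + 1) s'"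
| WhileFalse: "aval e s = 0 \<Longrightarrow> exec (While e c) s (acost e s + 1) s"
| WhileTrue: "aval e s \<noteq> 0 \<Longrightarrow> exec c s t s' \<Longrightarrow> exec (While e c) s' t' s'' \<Longrightarrow>
    exec (While e c) s (acost e s + t + t' + 1) s''"

text \<open>
  The input consists of \<open>n\<close>, the number of hyperedges, the hyperedges listed one after the other in
  some order, and the real parameter \<open>\<eta> \<in> [0,1]\<close>, of which the program can look up individual
  binary digits: entry 0 is the integer part and entry \<open>i > 0\<close> the \<open>i\<close>-th digit after the binary
  point. All other cells are 0 initially.
\<close>

definition input_mem :: "nat \<Rightarrow> nat list list \<Rightarrow> real \<Rightarrow> mem" where
  "input_mem n es \<eta> =
     (\<lambda>_ _. 0)
       (''n'' := (\<lambda>_. 0)(0 := n),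
        ''m'' := (\<lambda>_. 0)(0 := length es),
        ''edges'' := (\<lambda>j. if j < length (concat es) then concat es ! j else 0),
        ''eta'' := (\<lambda>i. nat (\<lfloor>\<eta> * 2 ^ i\<rfloor> mod 2)))"

text \<open>
  One program has to work for all inputs, with a running time polynomial in the number of vertices
  plus the number of hyperedges, uniformly in \<open>\<eta>\<close>. The result is a function of the hypergraph, so
  it does not depend on the order in which the hyperedges are listed.
\<close>

definition poly_time :: "nat \<Rightarrow> (nat \<Rightarrow> real \<Rightarrow> nat list multiset \<Rightarrow> nat) \<Rightarrow> bool" where
  "poly_time k N \<longleftrightarrow>
     (\<exists>(c :: com) (p :: nat poly). \<forall>n es. \<forall>\<eta> \<in> {0..1}. hypergraph k n (mset es) \<longrightarrow>
        (\<exists>t s. exec c (input_mem n es \<eta>) t s \<and> t \<le> poly p (n + length es) \<and>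
               s ''out'' 0 = N n \<eta> (mset es)))"

end

(*
  Two assignments that both violate at most an eta fraction of the m constraints differ on a vertex
  set whose cut has at most 2 eta m edges, so it suffices to count the sets with a small cut. By
  Karger's contraction argument a multigraph on n vertices with minimum cut c has at most
  2 n^(2L/c) sets S with at most L crossing edges: averaged over an edge chosen with probability
  proportional to its weight, a (1 - 2L/(jc)) fraction of these sets survives each contraction
  from j to j - 1 vertices. The minimum cut is computed exactly by the Stoer-Wagner algorithm. In
  the random graph the minimum cut is about 2m/n (Chernoff and a union bound over all cuts), so
  with L = 2 eta m the exponent 2L/c is about 2 eta n, safely below 3 eta n; and if eta <= 1/(3n)
  then L < c and only the two trivial sets are left.
*)

theory Submission
  imports Defs "HOL-Real_Asymp.Real_Asymp"
begin

text \<open>Soundness must hold for every graph, so the output is computed from the actual minimum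
  cut \<open>c\<close>; randomness enters only when its size is estimated. The machine knows only
  naturals: the output is Karger's product as one integer quotient, and the power of n appears only
  in the analysis. This product can exceed 2 even when only the trivial sets remain, so the range
  \<open>L < c\<close> is treated apart. The constants are asymmetric. With at most (17/16) \<Delta>
  n edges and all cuts at least (3/2)(1 - 1/n) \<Delta>, the exponent 4 \<eta> m / c is near (17/6)
  \<eta> n. So the lower tail may lose a quarter of its mean, but the upper tail must be tight; the
  gap to 3 pays for 1/n and for rounding \<eta>. There are exponentially many cuts while \<Delta>
  may be far below n. The union bound survives because a cut around S fails with probability at most
  exp(-|S| \<Delta> / 32) when |S| is at most n/2, and these terms sum to about n exp(-\<Delta> /
  32).\<close>

section \<open>Cuts of a weighted graph under contraction of two vertices\<close>

definition cut :: "('a \<Rightarrow> 'a \<Rightarrow> nat) \<Rightarrow> 'a set \<Rightarrow> 'a set \<Rightarrow> nat" where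
  "cut w V S = (\<Sum>u\<in>S. \<Sum>v\<in>V - S. w u v)"

definition merge :: "'a \<Rightarrow> 'a \<Rightarrow> ('a \<Rightarrow> 'a \<Rightarrow> nat) \<Rightarrow> 'a \<Rightarrow> 'a \<Rightarrow> nat" where
  "merge s t w u v =
     (if u = s then w s v + w t v else if v = s then w u s + w u t else w u v)"

definition symmetric_weights :: "('a \<Rightarrow> 'a \<Rightarrow> nat) \<Rightarrow> bool" where
  "symmetric_weights w \<longleftrightarrow> (\<forall>u v. w u v = w v u)"

lemma symmetric_weightsD: "symmetric_weights w \<Longrightarrow> w u v = w v u"
  by (simp add: symmetric_weights_def)

lemma symmetric_weights_merge:
  assumes "symmetric_weights w"
  shows "symmetric_weights (merge s t w)"
proof -
  have "merge s t w u v = merge s t w v u" for u v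
    using symmetric_weightsD[OF assms, of u v] symmetric_weightsD[OF assms, of s u] symmetric_weightsD[OF assms, of s v]
      symmetric_weightsD[OF assms, of t u] symmetric_weightsD[OF assms, of t v]
    unfolding merge_def by argo
  then show ?thesis by (simp add: symmetric_weights_def)
qed

lemma cut_merge:
  assumes fin: "finite V" and sym: "symmetric_weights w" and st: "s \<in> V" "t \<in> V" "s \<noteq> t"
    and S: "S \<subseteq> V" "s \<in> S \<longleftrightarrow> t \<in> S"
  shows "cut (merge s t w) (V - {t}) (S - {t}) = cut w V S"
proof (cases "s \<in> S")
  case True
  have finS: "finite S" using fin S finite_subset by blast
  have eq: "V - {t} - (S - {t}) = V - S" using True S by auto
  have "cut (merge s t w) (V - {t}) (S - {t})
      = (\<Sum>u\<in>insert s (S - {t} - {s}). \<Sum>v\<in>V - S. merge s t w u v)"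
    unfolding cut_def eq using True st by (intro sum.cong) auto
  also have "\<dots> = (\<Sum>v\<in>V - S. w s v + w t v) + (\<Sum>u\<in>S - {t} - {s}. \<Sum>v\<in>V - S. w u v)"
    using finS True by (subst sum.insert) (auto simp: merge_def intro!: sum.cong arg_cong2[where f="(+)"])
  also have "\<dots> = (\<Sum>u\<in>insert s (insert t (S - {t} - {s})). \<Sum>v\<in>V - S. w u v)"
    using finS st by (simp add: sum.distrib)
  also have "insert s (insert t (S - {t} - {s})) = S" using True S by auto
  finally show ?thesis by (simp add: cut_def)
next
  case False
  have eq: "V - {t} - (S - {t}) = insert s (V - S - {t} - {s})" using False S st by auto
  have St: "S - {t} = S" using False S by auto
  have "cut (merge s t w) (V - {t}) (S - {t})
      = (\<Sum>u\<in>S. \<Sum>v\<in>insert s (V - S - {t} - {s}). merge s t w u v)"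
    unfolding cut_def eq[unfolded St] St ..
  also have "\<dots> = (\<Sum>u\<in>S. \<Sum>v\<in>insert s (insert t (V - S - {t} - {s})). w u v)"
  proof (rule sum.cong)
    fix u assume "u \<in> S"
    with False have "u \<noteq> s" by auto
    have "(\<Sum>v\<in>insert s (V - S - {t} - {s}). merge s t w u v)
      = w u s + w u t + (\<Sum>v\<in>V - S - {t} - {s}. w u v)"
      using fin \<open>u \<noteq> s\<close> by (subst sum.insert) (auto simp: merge_def intro!: sum.cong)
    then show "(\<Sum>v\<in>insert s (V - S - {t} - {s}). merge s t w u v)
      = (\<Sum>v\<in>insert s (insert t (V - S - {t} - {s})). w u v)"
      using fin st by simp
  qed simp
  also have "insert s (insert t (V - S - {t} - {s})) = V - S" using False S st by auto
  finally show ?thesis by (simp add: cut_def)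
qed

definition proper :: "'a set \<Rightarrow> 'a set \<Rightarrow> bool" where
  "proper V S \<longleftrightarrow> S \<subseteq> V \<and> S \<noteq> {} \<and> S \<noteq> V"

text \<open>Putting \<open>t\<close> back on the side of \<open>s\<close> lifts a proper cut of the
  contraction to a proper cut of equal value, so contraction never lowers the minimum cut.\<close>

lemma cut_merge_lower:
  assumes fin: "finite V" and sym: "symmetric_weights w" and st: "s \<in> V" "t \<in> V" "s \<noteq> t"
    and c: "\<And>S. proper V S \<Longrightarrow> (s \<in> S \<longleftrightarrow> t \<in> S) \<Longrightarrow> c \<le> cut w V S"
    and S: "proper (V - {t}) S"
  shows "c \<le> cut (merge s t w) (V - {t}) S"
proof -
  define S' where "S' = (if s \<in> S then insert t S else S)"
  have S'_props: "S' \<subseteq> V" "s \<in> S' \<longleftrightarrow> t \<in> S'" "S' - {t} = S" "proper V S'"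
    using S st by (auto simp: S'_def proper_def)
  show ?thesis
    using c[OF S'_props(4,2)] cut_merge[OF fin sym st S'_props(1,2)] S'_props(3) by simp
qed

section \<open>Counting small cuts\<close>

definition small_cuts :: "('a \<Rightarrow> 'a \<Rightarrow> nat) \<Rightarrow> 'a set \<Rightarrow> nat \<Rightarrow> 'a set set" where
  "small_cuts w V L = {S. S \<subseteq> V \<and> cut w V S \<le> L}"

lemma finite_small_cuts: "finite V \<Longrightarrow> finite (small_cuts w V L)"
  by (rule finite_subset[of _ "Pow V"]) (auto simp: small_cuts_def)

text \<open>Factor \<open>i\<close> stands for the contraction from \<open>i + 1\<close> to
  \<open>i\<close> vertices and is the inverse of the surviving fraction. The trivial factor 2 is
  used while \<open>i * c \<le> 2 * L\<close>, not merely while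
  \<open>Suc i * c \<le> 2 * L\<close>: this keeps every denominator above \<open>c\<close>, whereas
  otherwise one factor could be arbitrarily large.\<close>

definition karger_bound :: "nat \<Rightarrow> nat \<Rightarrow> nat \<Rightarrow> real" where
  "karger_bound c L n =
     (\<Prod>i<n. if i * c \<le> 2 * L then 2 else real (Suc i * c) / (real (Suc i * c) - 2 * real L))"

text \<open>A set with \<open>s\<close> and \<open>t\<close> on the same side is determined by its
  trace off \<open>t\<close>. These are the sets that survive the contraction of \<open>s\<close>
  and \<open>t\<close>.\<close>

lemma card_small_cuts_same_side:
  assumes fin: "finite V" and sym: "symmetric_weights w" and st: "s \<in> V" "t \<in> V" "s \<noteq> t"
  shows "card {S \<in> small_cuts w V L. s \<in> S \<longleftrightarrow> t \<in> S}
      \<le> card (small_cuts (merge s t w) (V - {t}) L)"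
proof (rule card_inj_on_le[where f = "\<lambda>S. S - {t}"])
  show "inj_on (\<lambda>S. S - {t}) {S \<in> small_cuts w V L. s \<in> S \<longleftrightarrow> t \<in> S}"
    using st by (intro inj_onI) (auto simp: set_eq_iff)
  show "(\<lambda>S. S - {t}) ` {S \<in> small_cuts w V L. s \<in> S \<longleftrightarrow> t \<in> S}
      \<subseteq> small_cuts (merge s t w) (V - {t}) L"
  proof clarify
    fix S assume "S \<in> small_cuts w V L" "(s \<in> S) = (t \<in> S)"
    then show "S - {t} \<in> small_cuts (merge s t w) (V - {t}) L"
      by (auto simp: small_cuts_def cut_merge[OF fin sym st])
  qed
  show "finite (small_cuts (merge s t w) (V - {t}) L)"
    using fin by (intro finite_small_cuts) auto
qed

text \<open>The sums run over ordered pairs, so each crossing edge is counted twice. What remains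
  after subtracting twice the cut is the weight of the pairs whose contraction preserves
  \<open>S\<close>.\<close>

lemma sum_off_diagonal_split:
  assumes fin: "finite V" and sym: "symmetric_weights w" and S: "S \<subseteq> V"
  shows "(\<Sum>u\<in>V. \<Sum>v\<in>V - {u}. if u \<in> S \<longleftrightarrow> v \<in> S then w u v else 0) + 2 * cut w V S
      = (\<Sum>u\<in>V. \<Sum>v\<in>V - {u}. w u v)"
proof -
  have "(\<Sum>u\<in>V. \<Sum>v\<in>V - {u}. w u v)
     = (\<Sum>u\<in>V. \<Sum>v\<in>V - {u}. if u \<in> S \<longleftrightarrow> v \<in> S then w u v else 0)
     + (\<Sum>u\<in>V. \<Sum>v\<in>V - {u}. if u \<in> S \<longleftrightarrow> v \<in> S then 0 else w u v)"
    unfolding sum.distrib[symmetric] by (intro sum.cong refl) auto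
  also have "(\<Sum>u\<in>V. \<Sum>v\<in>V - {u}. if u \<in> S \<longleftrightarrow> v \<in> S then 0 else w u v)
     = (\<Sum>u\<in>S. \<Sum>v\<in>V - {u}. if u \<in> S \<longleftrightarrow> v \<in> S then 0 else w u v)
     + (\<Sum>u\<in>V - S. \<Sum>v\<in>V - {u}. if u \<in> S \<longleftrightarrow> v \<in> S then 0 else w u v)"
    using fin S by (subst add.commute, intro sum.subset_diff) auto
  also have "(\<Sum>u\<in>S. \<Sum>v\<in>V - {u}. if u \<in> S \<longleftrightarrow> v \<in> S then 0 else w u v) = cut w V S"
    unfolding cut_def
    by (intro sum.cong refl sum.mono_neutral_cong_right) (use fin S in auto)
  also have "(\<Sum>u\<in>V - S. \<Sum>v\<in>V - {u}. if u \<in> S \<longleftrightarrow> v \<in> S then 0 else w u v)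
      = (\<Sum>u\<in>V - S. \<Sum>v\<in>S. w v u)"
    by (intro sum.cong refl sum.mono_neutral_cong_right) (use fin S in \<open>auto intro: symmetric_weightsD[OF sym]\<close>)
  also have "\<dots> = cut w V S"
    unfolding cut_def by (rule sum.swap)
  finally show ?thesis by simp
qed

text \<open>Random contraction becomes double counting of \<open>w u v\<close> times the number of
  small cuts not separating \<open>u\<close> and \<open>v\<close>. Counted by pairs, the induction
  hypothesis bounds this by \<open>W * B\<close>; counted by sets, each set contributes at least
  \<open>W - 2 * L\<close>. Both \<open>V\<close> and \<open>w\<close> vary in the induction, since
  contraction changes both.\<close>

theorem card_small_cuts_le:
  assumes "finite V" "symmetric_weights w" "\<And>S. proper V S \<Longrightarrow> c \<le> cut w V S"
  shows "real (card (small_cuts w V L)) \<le> karger_bound c L (card V)"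
  using assms
proof (induction "card V" arbitrary: V w)
  case 0
  then have "V = {}" by simp
  then have "small_cuts w V L \<subseteq> {{}}" by (auto simp: small_cuts_def)
  then have "card (small_cuts w V L) \<le> 1"
    using card_mono[of "{{}}" "small_cuts w V L"] by simp
  with 0 show ?case by (simp add: karger_bound_def flip: \<open>0 = card V\<close>)
next
  case (Suc j)
  note fin = \<open>finite V\<close> and sym = \<open>symmetric_weights w\<close>
  show ?case
  proof (cases "j * c \<le> 2 * L")
    case True
    \<comment> \<open>Factor \<open>j\<close>, and with it every earlier factor, is 2 here, which
      allows for all subsets.\<close>
    have "card (small_cuts w V L) \<le> card (Pow V)"
      using fin by (intro card_mono) (auto simp: small_cuts_def)
    also have "\<dots> = 2 ^ Suc j" using fin Suc.hyps by (simp add: card_Pow)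
    finally have "card (small_cuts w V L) \<le> 2 ^ Suc j" .
    moreover have "karger_bound c L (Suc j) = (\<Prod>i<Suc j. 2)"
      unfolding karger_bound_def
    proof (rule prod.cong)
      fix i assume "i \<in> {..<Suc j}"
      then have "i * c \<le> j * c" by simp
      with True have "i * c \<le> 2 * L" by (rule order_trans[rotated])
      then show "(if i * c \<le> 2 * L then 2
        else real (Suc i * c) / (real (Suc i * c) - 2 * real L)) = 2" by simp
    qed simp
    ultimately show ?thesis
      unfolding Suc.hyps(2)[symmetric] by (simp flip: of_nat_le_iff[where 'a = real])
  next
    case False
    define X where "X = small_cuts w V L"
    define W where "W = (\<Sum>u\<in>V. \<Sum>v\<in>V - {u}. w u v)"
    define B where "B = karger_bound c L j"
    have finX: "finite X" using fin by (simp add: X_def finite_small_cuts)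
    have "j \<noteq> 0" using False by (cases j) auto
    \<comment> \<open>As \<open>j \<noteq> 0\<close>, every singleton is a proper cut, and the
      singleton cuts add up to \<open>W\<close>, twice the total edge weight.\<close>
    have "Suc j * c = (\<Sum>u\<in>V. c)" using Suc.hyps by simp
    also have "\<dots> \<le> (\<Sum>u\<in>V. cut w V {u})"
      using Suc.hyps(2) \<open>j \<noteq> 0\<close> by (intro sum_mono Suc.prems(3)) (auto simp: proper_def)
    also have "\<dots> = W" by (simp add: cut_def W_def)
    finally have Wge: "Suc j * c \<le> W" .
    have "card {S \<in> X. u \<in> S \<longleftrightarrow> v \<in> S} \<le> B" if uv: "u \<in> V" "v \<in> V - {u}" for u v
    proof -
      have uv': "u \<in> V" "v \<in> V" "u \<noteq> v" using uv by auto
      have "real (card {S \<in> X. u \<in> S \<longleftrightarrow> v \<in> S}) \<le> real (card (small_cuts (merge u v w) (V - {v}) L))"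
        unfolding X_def using card_small_cuts_same_side[OF fin sym uv'] by simp
      also have "\<dots> \<le> karger_bound c L (card (V - {v}))"
      proof (rule Suc.hyps(1))
        show "j = card (V - {v})" using Suc.hyps(2) fin uv by simp
        show "\<And>S. proper (V - {v}) S \<Longrightarrow> c \<le> cut (merge u v w) (V - {v}) S"
          using cut_merge_lower[OF fin sym uv'] Suc.prems(3) by blast
      qed (use fin sym symmetric_weights_merge in auto)
      also have "card (V - {v}) = j" using Suc.hyps(2)[symmetric] fin uv by simp
      finally show ?thesis unfolding B_def .
    qed
    then have "(\<Sum>u\<in>V. \<Sum>v\<in>V - {u}. real (w u v) * card {S \<in> X. u \<in> S \<longleftrightarrow> v \<in> S})
        \<le> (\<Sum>u\<in>V. \<Sum>v\<in>V - {u}. real (w u v) * B)"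
      by (intro sum_mono mult_left_mono) auto
    also have "\<dots> = real W * B"
      by (simp add: W_def sum_distrib_right)
    also have "(\<Sum>u\<in>V. \<Sum>v\<in>V - {u}. real (w u v) * card {S \<in> X. u \<in> S \<longleftrightarrow> v \<in> S})
      = (\<Sum>u\<in>V. \<Sum>v\<in>V - {u}. \<Sum>S\<in>X. real (if u \<in> S \<longleftrightarrow> v \<in> S then w u v else 0))"
    proof (intro sum.cong refl)
      fix u v
      have "(\<Sum>S\<in>X. real (if u \<in> S \<longleftrightarrow> v \<in> S then w u v else 0))
        = (\<Sum>S\<in>{S \<in> X. u \<in> S \<longleftrightarrow> v \<in> S}. real (w u v))"
        using finX by (intro sum.mono_neutral_cong_right) auto
      then show "real (w u v) * card {S \<in> X. u \<in> S \<longleftrightarrow> v \<in> S}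
        = (\<Sum>S\<in>X. real (if u \<in> S \<longleftrightarrow> v \<in> S then w u v else 0))" by simp
    qed
    also have "\<dots> = (\<Sum>u\<in>V. \<Sum>S\<in>X. \<Sum>v\<in>V - {u}. real (if u \<in> S \<longleftrightarrow> v \<in> S then w u v else 0))"
      by (intro sum.cong refl sum.swap)
    also have "\<dots> = (\<Sum>S\<in>X. \<Sum>u\<in>V. \<Sum>v\<in>V - {u}. real (if u \<in> S \<longleftrightarrow> v \<in> S then w u v else 0))"
      by (rule sum.swap)
    also have "\<dots> = (\<Sum>S\<in>X. real W - 2 * real (cut w V S))"
    proof (rule sum.cong)
      fix S assume "S \<in> X"
      then have "S \<subseteq> V" by (auto simp: X_def small_cuts_def)
      from sum_off_diagonal_split[OF fin sym this]
      have "real W = real ((\<Sum>u\<in>V. \<Sum>v\<in>V - {u}. if u \<in> S \<longleftrightarrow> v \<in> S then w u v else 0) + 2 * cut w V S)"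
        by (simp add: W_def)
      then show "(\<Sum>u\<in>V. \<Sum>v\<in>V - {u}. real (if u \<in> S \<longleftrightarrow> v \<in> S then w u v else 0))
        = real W - 2 * real (cut w V S)" by simp
    qed simp
    finally have 1: "(\<Sum>S\<in>X. real W - 2 * real (cut w V S)) \<le> real W * B" .
    have "real (card X) * (real W - 2 * real L) = (\<Sum>S\<in>X. real W - 2 * real L)" by simp
    also have "\<dots> \<le> (\<Sum>S\<in>X. real W - 2 * real (cut w V S))"
      by (intro sum_mono) (auto simp: X_def small_cuts_def)
    also note 1
    finally have 2: "real (card X) * (real W - 2 * real L) \<le> real W * B" .
    have "real (2 * L) < real (j * c)" using False by (simp only: of_nat_less_iff not_le)
    then have 3: "2 * real L < real (Suc j * c)" by (simp add: algebra_simps)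
    have 4: "real (Suc j * c) \<le> real W" using Wge by (simp only: of_nat_le_iff)
    have B0: "0 \<le> B" 
    proof -
      have "0 \<le> (if i * c \<le> 2 * L then 2 else real (Suc i * c) / (real (Suc i * c) - 2 * real L))" for i
      proof (cases "i * c \<le> 2 * L")
        case False
        then have "real (2 * L) \<le> real (i * c)" by (simp only: of_nat_le_iff)
        also have "\<dots> \<le> real (Suc i * c)" by simp
        finally show ?thesis by simp
      qed simp
      then show ?thesis unfolding B_def karger_bound_def by (intro prod_nonneg) blast
    qed
    have "real (card X) \<le> real W / (real W - 2 * real L) * B"
      using 2 3 4 by (simp add: field_simps)
    \<comment> \<open>x / (x - 2L) decreases for x > 2L, so \<open>W\<close> may be replaced by its
      lower bound.\<close>
    also have "\<dots> \<le> real (Suc j * c) / (real (Suc j * c) - 2 * real L) * B"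
    proof (rule mult_right_mono[OF _ B0])
      have "2 * real L * real (Suc j * c) \<le> 2 * real L * real W"
        using 4 by (intro mult_left_mono) auto
      then show "real W / (real W - 2 * real L) \<le> real (Suc j * c) / (real (Suc j * c) - 2 * real L)"
        using 3 4 by (subst pos_divide_le_eq; simp add: pos_le_divide_eq algebra_simps)
    qed
    also have "\<dots> = karger_bound c L (Suc j)"
      unfolding karger_bound_def B_def prod.lessThan_Suc using False by (simp del: of_nat_mult of_nat_Suc mult_Suc)
    finally show ?thesis unfolding X_def Suc.hyps(2) .
  qed
qed

section \<open>Estimating Karger's product by a power of n\<close>

text \<open>For integral 2L/c = k, Karger's factors with index at least k have exactly this form.
  The absorption identity for binomials supplies the induction step.\<close>

lemma prod_ratio_eq_binomial:
  assumes "k \<le> n"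
  shows "(\<Prod>i\<in>{k..<n}. real (Suc i) / real (Suc i - k)) = real (n choose k)"
  using assms
proof (induction n rule: dec_induct)
  case (step n)
  have "real (Suc n - k) * real (Suc n choose k) = real (Suc n) * real (n choose k)"
    using binomial_absorb_comp[of "Suc n" k] unfolding of_nat_mult[symmetric] diff_Suc_1 by presburger
  moreover have "real (Suc n - k) > 0" using step.hyps by simp
  ultimately have "real (Suc n choose k) = real (n choose k) * (real (Suc n) / real (Suc n - k))"
    by (metis mult.commute nonzero_eq_divide_eq order_less_irrefl times_divide_eq_right)
  moreover have "(\<Prod>i\<in>{k..<Suc n}. real (Suc i) / real (Suc i - k))
    = (\<Prod>i\<in>{k..<n}. real (Suc i) / real (Suc i - k)) * (real (Suc n) / real (Suc n - k))"
    using step.hyps by (intro prod.atLeastLessThan_Suc)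
  ultimately show ?case using step.IH by metis
qed simp

text \<open>Lets the factorial in the binomial estimate absorb the trivial factors 2, leaving only
  the constant 2.\<close>

lemma two_power_le_two_fact: "2 ^ k \<le> 2 * (fact k :: real)"
proof (induction k)
  case (Suc k)
  show ?case
  proof (cases "k = 0")
    case False
    have "2 ^ Suc k \<le> 2 * (2 * fact k :: real)" using Suc by simp
    also have "\<dots> \<le> (1 + real k) * (2 * fact k)"
      using False by (intro mult_right_mono) auto
    also have "\<dots> = 2 * fact (Suc k)" by (simp add: algebra_simps)
    finally show ?thesis .
  qed simp
qed simp

text \<open>A fractional \<beta> = 2L/c lies between \<open>k0\<close> and \<open>k = k0 + 1\<close>
  with weight \<theta>. By the weighted inequality of arithmetic and geometric means each factor is
  at most the geometric interpolation of the factors for \<open>k0\<close> and \<open>k\<close>, so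
  the product interpolates two binomial coefficients, and the exponents of n average to
  \<beta>.\<close>

lemma karger_bound_le:
  assumes n: "2 \<le> n" and c: "0 < c"
  shows "karger_bound c L n \<le> 2 * real n powr (2 * real L / real c)"
proof -
  define \<beta> where "\<beta> = 2 * real L / real c"
  define k0 where "k0 = nat \<lfloor>\<beta>\<rfloor>"
  define k where "k = Suc k0"
  define \<theta> where "\<theta> = \<beta> - real k0"
  have "0 \<le> \<beta>" by (simp add: \<beta>_def)
  then have k0: "real k0 \<le> \<beta>" "\<beta> < real k0 + 1"
    unfolding k0_def by linarith+
  have L: "2 * real L = \<beta> * real c" using c by (simp add: \<beta>_def)
  have le_iff: "i * c \<le> 2 * L \<longleftrightarrow> i < k" for i
  proof -
    have "i * c \<le> 2 * L \<longleftrightarrow> real i * real c \<le> \<beta> * real c"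
      unfolding L[symmetric] by (metis of_nat_le_iff of_nat_mult of_nat_numeral)
    also have "\<dots> \<longleftrightarrow> real i \<le> \<beta>" using c by simp
    also have "\<dots> \<longleftrightarrow> i < k" using k0 unfolding k_def by linarith
    finally show ?thesis .
  qed
  have eq: "karger_bound c L n = (\<Prod>i<n. if i < k then 2 else real (Suc i) / (real (Suc i) - \<beta>))"
    unfolding karger_bound_def le_iff
  proof (intro prod.cong refl if_cong)
    fix i assume "\<not> i < k"
    have "real (Suc i * c) - 2 * real L = (real (Suc i) - \<beta>) * real c"
      unfolding of_nat_mult L by (rule left_diff_distrib[symmetric])
    then show "real (Suc i * c) / (real (Suc i * c) - 2 * real L) = real (Suc i) / (real (Suc i) - \<beta>)"
      unfolding of_nat_mult using c by simp
  qed
  show ?thesis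
  proof (cases "n \<le> k")
    case True
    \<comment> \<open>All factors are trivial here, but then \<beta> is at least n - 1, so n^\<beta>
      is large enough.\<close>
    then have "karger_bound c L n = 2 ^ n"
      unfolding eq by (subst prod.cong[OF refl, where h = "\<lambda>_. 2"]) auto
    also have "\<dots> = 2 * 2 ^ (n - 1)" using n by (cases n) auto
    also have "\<dots> \<le> 2 * real n ^ (n - 1)" using n by (intro mult_left_mono power_mono) auto
    also have "\<dots> = 2 * real n powr real (n - 1)" using n by (subst powr_realpow) auto
    also have "\<dots> \<le> 2 * real n powr \<beta>"
      using n True k0 unfolding k_def by (intro mult_left_mono powr_mono) auto
    finally show ?thesis by (simp add: \<beta>_def)
  next
    case False
    define x where "x i = real (Suc i) / real (Suc i - k0)" for i
    define y where "y i = real (Suc i) / real (Suc i - k)" for i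
    have \<theta>: "0 \<le> \<theta>" "0 \<le> 1 - \<theta>" using k0 by (auto simp: \<theta>_def)
    have factor: "real (Suc i) / (real (Suc i) - \<beta>) \<le> x i powr (1 - \<theta>) * y i powr \<theta>"
      if "k \<le> i" for i
    proof -
      define a where "a = real (Suc i - k)"
      have a: "a > 0" "real (Suc i - k0) = a + 1"
        using that by (auto simp: a_def k_def)
      \<comment> \<open>The denominator is the arithmetic mean, with weights
        \<open>1 - \<theta>\<close> and \<open>\<theta>\<close>, of the denominators for
        \<open>k0\<close> and \<open>k\<close>.\<close>
      have "real (Suc i) - \<beta> = (1 - \<theta>) * (a + 1) + \<theta> * a"
        using that by (simp add: a_def k_def \<theta>_def of_nat_diff algebra_simps)
      also have "\<dots> \<ge> (a + 1) powr (1 - \<theta>) * a powr \<theta>"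
        using \<theta> a by (intro Youngs_inequality_0) auto
      finally have "(a + 1) powr (1 - \<theta>) * a powr \<theta> \<le> real (Suc i) - \<beta>" .
      moreover have "0 < real (Suc i) - \<beta>" using k0 that by (simp add: k_def)
      ultimately have "real (Suc i) / (real (Suc i) - \<beta>)
        \<le> real (Suc i) / ((a + 1) powr (1 - \<theta>) * a powr \<theta>)"
        using a by (intro divide_left_mono mult_pos_pos) auto
      also have "\<dots> = (real (Suc i) powr (1 - \<theta>) * real (Suc i) powr \<theta>) /
          ((a + 1) powr (1 - \<theta>) * a powr \<theta>)"
        unfolding powr_add[symmetric] by simp
      also have "\<dots> = x i powr (1 - \<theta>) * y i powr \<theta>"
        using a unfolding x_def y_def by (simp add: powr_divide flip: a_def)
      finally show ?thesis .
    qed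
    have n_pos: "0 < real n" using n by simp
    have choose_le: "real (n choose j) \<le> real n powr real j / fact j" for j
    proof -
      have "real ((n choose j) * fact j) \<le> real (n ^ j)"
        using binomial_fact_pow by (intro of_nat_mono)
      then show ?thesis using n_pos by (simp add: powr_realpow field_simps)
    qed
    \<comment> \<open>The binomial for \<open>k0\<close> has one more factor,
      \<open>x k0 = k\<close>. Dividing it out turns 1/k0! into 1/k!, so both interpolated bounds
      carry the same factorial.\<close>
    have "(\<Prod>i\<in>{k0..<n}. x i) = x k0 * (\<Prod>i\<in>{k..<n}. x i)"
      using False by (simp add: prod.atLeast_Suc_lessThan k_def)
    then have "(\<Prod>i\<in>{k..<n}. x i) = real (n choose k0) / real k"
      using prod_ratio_eq_binomial[of k0 n] False unfolding x_def k_def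
      by (simp add: field_simps)
    also have "\<dots> \<le> real n powr real k0 / fact k"
      using divide_right_mono[OF choose_le[of k0], of "real k"] by (simp add: k_def mult.commute)
    finally have X: "(\<Prod>i\<in>{k..<n}. x i) \<le> real n powr real k0 / fact k" .
    have "(\<Prod>i\<in>{k..<n}. y i) = real (n choose k)"
      using prod_ratio_eq_binomial[of k n] False by (simp add: y_def)
    then have Y: "(\<Prod>i\<in>{k..<n}. y i) \<le> real n powr real k / fact k"
      using choose_le[of k] by simp
    have nonneg: "0 \<le> (\<Prod>i\<in>{k..<n}. x i)" "0 \<le> (\<Prod>i\<in>{k..<n}. y i)"
      by (auto simp: x_def y_def intro!: prod_nonneg)
    have "{..<n} = {..<k} \<union> {k..<n}" using False by auto
    then have "karger_bound c L n = 2 ^ k * (\<Prod>i\<in>{k..<n}. real (Suc i) / (real (Suc i) - \<beta>))"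
      unfolding eq by (simp add: prod.union_disjoint ivl_disj_int cong: prod.cong_simp)
    also have "\<dots> \<le> 2 ^ k * (\<Prod>i\<in>{k..<n}. x i powr (1 - \<theta>) * y i powr \<theta>)"
    proof (intro mult_left_mono prod_mono conjI)
      fix i assume i: "i \<in> {k..<n}"
      then show "real (Suc i) / (real (Suc i) - \<beta>) \<le> x i powr (1 - \<theta>) * y i powr \<theta>"
        using factor by simp
      show "0 \<le> real (Suc i) / (real (Suc i) - \<beta>)"
        using i k0 by (auto simp: k_def)
    qed simp
    also have "(\<Prod>i\<in>{k..<n}. x i powr (1 - \<theta>) * y i powr \<theta>)
      = (\<Prod>i\<in>{k..<n}. x i) powr (1 - \<theta>) * (\<Prod>i\<in>{k..<n}. y i) powr \<theta>"
      by (simp add: prod.distrib prod_powr_distrib)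
    also have "2 ^ k * \<dots> \<le> 2 ^ k *
      ((real n powr real k0 / fact k) powr (1 - \<theta>) * (real n powr real k / fact k) powr \<theta>)"
      using X Y nonneg \<theta> by (intro mult_left_mono mult_mono powr_mono2) auto
    also have "(real n powr real k0 / fact k) powr (1 - \<theta>) * (real n powr real k / fact k) powr \<theta>
      = real n powr (real k0 * (1 - \<theta>) + real k * \<theta>) / (fact k powr ((1 - \<theta>) + \<theta>))"
      unfolding powr_add by (simp add: powr_divide powr_powr)
    also have "real k0 * (1 - \<theta>) + real k * \<theta> = \<beta>"
      by (simp add: k_def \<theta>_def algebra_simps)
    also have "fact k powr ((1 - \<theta>) + \<theta>) = (fact k :: real)" by simp
    also have "2 ^ k * (real n powr \<beta> / fact k) \<le> 2 * real n powr \<beta>"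
      using mult_right_mono[OF two_power_le_two_fact[of k], of "real n powr \<beta>"]
      by (simp add: field_simps)
    finally show ?thesis by (simp add: \<beta>_def)
  qed
qed

section \<open>Maximum adjacency orderings\<close>

text \<open>The invariant of a maximum adjacency ordering with set \<open>A\<close> of vertices ordered so far, the last
  of which is \<open>l\<close>. It is vacuous for \<open>A = {}\<close>, where \<open>l\<close> is arbitrary.\<close>
definition ma_prefix :: "('a \<Rightarrow> 'a \<Rightarrow> nat) \<Rightarrow> 'a set \<Rightarrow> 'a set \<Rightarrow> 'a \<Rightarrow> bool" where
  "ma_prefix w V A l \<longleftrightarrow> (\<forall>S. \<forall>x\<in>V - A. (x \<in> S) \<noteq> (l \<in> S) \<longrightarrow>
     (\<Sum>a\<in>A. w a x) \<le> cut w (insert x A) (S \<inter> insert x A))"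

lemma ma_prefix_empty: "ma_prefix w V {} l"
  by (simp add: ma_prefix_def)

lemma cut_insert:
  assumes "finite A" "symmetric_weights w" "x \<notin> A"
  shows "cut w (insert x A) (S \<inter> insert x A)
    = cut w A (S \<inter> A) + (\<Sum>a\<in>{a \<in> A. (a \<in> S) \<noteq> (x \<in> S)}. w a x)"
proof (cases "x \<in> S")
  case True
  have "S \<inter> insert x A = insert x (S \<inter> A)" using True by auto
  then have "cut w (insert x A) (S \<inter> insert x A)
    = (\<Sum>v\<in>insert x A - insert x (S \<inter> A). w x v)
      + (\<Sum>u\<in>S \<inter> A. \<Sum>v\<in>insert x A - insert x (S \<inter> A). w u v)"
    unfolding cut_def using assms by simp
  also have "insert x A - insert x (S \<inter> A) = A - S \<inter> A" using assms by auto
  also have "(\<Sum>v\<in>A - S \<inter> A. w x v) = (\<Sum>a\<in>{a \<in> A. (a \<in> S) \<noteq> (x \<in> S)}. w a x)"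
    using True by (intro sum.cong symmetric_weightsD[OF assms(2)]) auto
  finally show ?thesis by (simp add: cut_def)
next
  case False
  have "S \<inter> insert x A = S \<inter> A" "insert x A - S \<inter> A = insert x (A - S \<inter> A)"
    using False assms by auto
  then have "cut w (insert x A) (S \<inter> insert x A)
    = (\<Sum>u\<in>S \<inter> A. w u x + (\<Sum>v\<in>A - S \<inter> A. w u v))"
    unfolding cut_def using assms by simp
  also have "\<dots> = (\<Sum>u\<in>S \<inter> A. w u x) + cut w A (S \<inter> A)"
    by (simp add: cut_def sum.distrib)
  finally have "cut w (insert x A) (S \<inter> insert x A)
    = (\<Sum>u\<in>S \<inter> A. w u x) + cut w A (S \<inter> A)" .
  moreover have *: "{a \<in> A. (a \<in> S) \<noteq> (x \<in> S)} = S \<inter> A" using False by auto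
  ultimately show ?thesis by simp
qed

text \<open>The Stoer-Wagner exchange argument. If \<open>S\<close> does not separate
  \<open>l\<close> from \<open>v\<close>, then \<open>x\<close> is separated from \<open>l\<close>
  as well and the old invariant applies to \<open>x\<close>. Otherwise the old invariant applies to
  \<open>v\<close>, whose key is at least that of \<open>x\<close>. In both cases the edge between
  \<open>v\<close> and \<open>x\<close> is new on either side of the inequality.\<close>

lemma ma_prefix_insert:
  assumes fin: "finite A" and sym: "symmetric_weights w" and v: "v \<in> V - A"
    and max: "\<And>x. x \<in> V - A \<Longrightarrow> (\<Sum>a\<in>A. w a x) \<le> (\<Sum>a\<in>A. w a v)"
    and ma_prefix: "ma_prefix w V A l"
  shows "ma_prefix w V (insert v A) v"
  unfolding ma_prefix_def
proof (intro allI ballI impI)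
  fix S x assume x: "x \<in> V - insert v A" and side: "(x \<in> S) \<noteq> (v \<in> S)"
  define cross where "cross = (\<Sum>a\<in>{a \<in> A. (a \<in> S) \<noteq> (x \<in> S)}. w a x)"
  have cut_v: "cut w (insert v A) (S \<inter> insert v A)
    = cut w A (S \<inter> A) + (\<Sum>a\<in>{a \<in> A. (a \<in> S) \<noteq> (v \<in> S)}. w a v)"
    using cut_insert[OF fin sym] v by auto
  have "cut w (insert x (insert v A)) (S \<inter> insert x (insert v A))
    = cut w (insert v A) (S \<inter> insert v A)
      + (\<Sum>a\<in>{a \<in> insert v A. (a \<in> S) \<noteq> (x \<in> S)}. w a x)"
    using x fin by (intro cut_insert sym) auto
  also have "{a \<in> insert v A. (a \<in> S) \<noteq> (x \<in> S)} = insert v {a \<in> A. (a \<in> S) \<noteq> (x \<in> S)}"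
    using side by auto
  also have "(\<Sum>a\<in>insert v {a \<in> A. (a \<in> S) \<noteq> (x \<in> S)}. w a x) = w v x + cross"
    using fin v by (simp add: cross_def)
  finally have cut_x: "cut w (insert x (insert v A)) (S \<inter> insert x (insert v A))
    = cut w (insert v A) (S \<inter> insert v A) + (w v x + cross)" .
  have "(\<Sum>a\<in>A. w a x) \<le> cut w (insert v A) (S \<inter> insert v A) + cross"
  proof (cases "(l \<in> S) = (v \<in> S)")
    case True
    then have "(\<Sum>a\<in>A. w a x) \<le> cut w (insert x A) (S \<inter> insert x A)"
      using ma_prefix x side unfolding ma_prefix_def by blast
    also have "\<dots> = cut w A (S \<inter> A) + cross"
      using x unfolding cross_def by (intro cut_insert fin sym) auto
    finally show ?thesis using cut_v by simp
  next
    case False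
    have "(\<Sum>a\<in>A. w a x) \<le> (\<Sum>a\<in>A. w a v)" using max x by blast
    also have "\<dots> \<le> cut w (insert v A) (S \<inter> insert v A)"
      using ma_prefix v False unfolding ma_prefix_def by blast
    finally show ?thesis by simp
  qed
  then show "(\<Sum>a\<in>insert v A. w a x) \<le> cut w (insert x (insert v A)) (S \<inter> insert x (insert v A))"
    using cut_x fin v by simp
qed

section \<open>Minimum cuts with a cap, and their behaviour under contraction\<close>

text \<open>The cap \<open>b\<close> plays two roles: it accumulates the cuts recorded by the
  algorithm so far, and it is the value when no proper subset exists.\<close>

definition mincut :: "('a \<Rightarrow> 'a \<Rightarrow> nat) \<Rightarrow> 'a set \<Rightarrow> nat \<Rightarrow> nat" where
  "mincut w V b = Min (insert b (cut w V ` {S. proper V S}))"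

lemma finite_proper: "finite V \<Longrightarrow> finite {S. proper V S}"
  by (rule finite_subset[of _ "Pow V"]) (auto simp: proper_def)

lemma le_mincut_iff:
  assumes "finite V"
  shows "z \<le> mincut w V b \<longleftrightarrow> z \<le> b \<and> (\<forall>S. proper V S \<longrightarrow> z \<le> cut w V S)"
proof -
  have "finite (insert b (cut w V ` {S. proper V S}))" using finite_proper[OF assms] by simp
  then show ?thesis unfolding mincut_def by (subst Min_ge_iff) blast+
qed

lemma mincut_le_cut: "finite V \<Longrightarrow> proper V S \<Longrightarrow> mincut w V b \<le> cut w V S"
  using le_mincut_iff by blast

lemma mincut_le: "finite V \<Longrightarrow> mincut w V b \<le> b"
  using le_mincut_iff by blast

text \<open>The end of the contraction process: no proper cut is left, so the accumulated cap is the
  answer.\<close>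

lemma mincut_card_le_1:
  assumes "finite V" "card V \<le> 1"
  shows "mincut w V b = b"
proof -
  have "V = {} \<or> (\<exists>x. V = {x})"
    using assms by (metis card_0_eq card_1_singletonE le_SucE le_zero_eq One_nat_def)
  then have "{S. proper V S} = {}" by (auto simp: proper_def)
  then show ?thesis by (simp add: mincut_def)
qed

lemma cut_Diff: 
  assumes "finite V" "symmetric_weights w" "S \<subseteq> V"
  shows "cut w V (V - S) = cut w V S"
proof -
  have "cut w V (V - S) = (\<Sum>u\<in>V - S. \<Sum>v\<in>S. w v u)"
    unfolding cut_def using assms
    by (intro sum.cong symmetric_weightsD[OF assms(2)]) auto
  also have "\<dots> = cut w V S" unfolding cut_def by (rule sum.swap)
  finally show ?thesis .
qed

text \<open>The vertex reached last by a maximum adjacency ordering is a minimum cut between it and its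
  predecessor, so the two may be merged once that cut has been recorded.\<close>
lemma mincut_merge:
  assumes fin: "finite V" and sym: "symmetric_weights w" and st: "s \<in> V" "t \<in> V" "s \<noteq> t"
    and ma_prefix: "ma_prefix w V (V - {t}) s"
  shows "mincut w V b = mincut (merge s t w) (V - {t}) (min b (\<Sum>a\<in>V - {t}. w a t))"
proof (rule order_antisym)
  let ?d = "\<Sum>a\<in>V - {t}. w a t"
  have Vt: "insert t (V - {t}) = V" using st by auto
  have t: "cut w V (V - {t}) = ?d"
    using st by (simp add: cut_def double_diff)
  have "proper V (V - {t})" using st by (auto simp: proper_def)
  then have "mincut w V b \<le> ?d" using t mincut_le_cut[OF fin] by metis
  moreover have "mincut w V b \<le> cut (merge s t w) (V - {t}) S" if "proper (V - {t}) S" for S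
    using cut_merge_lower[OF fin sym st _ that] mincut_le_cut[OF fin] by blast
  ultimately show "mincut w V b \<le> mincut (merge s t w) (V - {t}) (min b ?d)"
    using fin mincut_le[OF fin] by (subst le_mincut_iff) auto
  let ?m = "mincut (merge s t w) (V - {t}) (min b ?d)"
  have m: "?m \<le> b" "?m \<le> ?d" using mincut_le[of "V - {t}"] fin by (metis finite_Diff min.boundedE)+
  \<comment> \<open>A cut that keeps \<open>s\<close> and \<open>t\<close> together reappears in the
    contraction; one that separates them costs at least \<open>?d\<close> by the ordering
    invariant.\<close>
  have "?m \<le> cut w V S" if S: "proper V S" for S
  proof (cases "(s \<in> S) = (t \<in> S)")
    case True
    have "proper (V - {t}) (S - {t})"
      using S True st by (auto simp: proper_def)
    then have "?m \<le> cut (merge s t w) (V - {t}) (S - {t})"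
      using fin by (intro mincut_le_cut) auto
    then show ?thesis
      using cut_merge[OF fin sym st _ True] S by (auto simp: proper_def)
  next
    case False
    have "?d \<le> cut w (insert t (V - {t})) (S \<inter> insert t (V - {t}))"
      using ma_prefix st False unfolding ma_prefix_def by blast
    then have "?d \<le> cut w V S"
      unfolding Vt using S by (simp add: proper_def Int_absorb2)
    with m show ?thesis by simp
  qed
  then show "?m \<le> mincut w V b" using m fin by (subst le_mincut_iff) auto
qed

section \<open>The bound and its soundness\<close>

text \<open>Forgets the orientation of tuples. A loop is counted twice, but only on the diagonal,
  where no cut sees it.\<close>

definition edge_weight :: "nat list multiset \<Rightarrow> nat \<Rightarrow> nat \<Rightarrow> nat" where
  "edge_weight G u v = count G [u, v] + count G [v, u]"

definition crosses :: "nat set \<Rightarrow> nat list \<Rightarrow> bool" where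
  "crosses S e \<longleftrightarrow> (e ! 0 \<in> S) \<noteq> (e ! 1 \<in> S)"

text \<open>Only finitely many digits of \<open>\<eta>\<close> can be read, so \<open>\<eta>\<close> is rounded up to a multiple of \<open>2^-n\<close>.\<close>
definition budget :: "nat \<Rightarrow> real \<Rightarrow> nat \<Rightarrow> nat" where
  "budget n \<eta> M = 2 * (M * (nat \<lfloor>\<eta> * 2 ^ n\<rfloor> + 1) div 2 ^ n)"

text \<open>Numerator and, below, denominator of \<open>karger_bound\<close> over the naturals, so
  that one division at the end suffices. Truncated subtraction is exact in the denominator, as
  \<open>2 * L < i * c\<close> in that branch.\<close>

definition karger_num :: "nat \<Rightarrow> nat \<Rightarrow> nat \<Rightarrow> nat" where
  "karger_num c L n = (\<Prod>i<n. if i * c \<le> 2 * L then 2 else Suc i * c)"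

definition karger_den :: "nat \<Rightarrow> nat \<Rightarrow> nat \<Rightarrow> nat" where
  "karger_den c L n = (\<Prod>i<n. if i * c \<le> 2 * L then 1 else Suc i * c - 2 * L)"

text \<open>No cut exceeds the number of edges, so the cap \<open>size G\<close> matters only when
  there is no proper cut. In the branch \<open>L < c\<close> the quotient could exceed the required
  value 2.\<close>

definition assignment_bound :: "nat \<Rightarrow> real \<Rightarrow> nat list multiset \<Rightarrow> nat" where
  "assignment_bound n \<eta> G =
     (let c = mincut (edge_weight G) {1..n} (size G); L = budget n \<eta> (size G)
      in if L < c then 2 else karger_num c L n div karger_den c L n)"

lemma symmetric_weights_edge_weight: "symmetric_weights (edge_weight G)"
  by (simp add: symmetric_weights_def edge_weight_def)

lemma edge_weight_add_mset:
  "edge_weight (add_mset [a, b] G) u v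
    = edge_weight G u v + (if u = a \<and> v = b then 1 else 0) + (if u = b \<and> v = a then 1 else 0)"
  by (cases "u = a"; cases "v = b"; cases "u = b"; cases "v = a") (simp_all add: edge_weight_def)

lemma tuples_2E:
  assumes "e \<in> tuples 2 n"
  obtains a b where "e = [a, b]" "a \<in> {1..n}" "b \<in> {1..n}"
  using assms by (auto simp: tuples_def numeral_2_eq_2 length_Suc_conv)

lemma sum_sum_indicator:
  assumes "finite A" "finite B"
  shows "(\<Sum>u\<in>A. \<Sum>v\<in>B. if u = a \<and> v = b then 1 else 0 :: nat) = (if a \<in> A \<and> b \<in> B then 1 else 0)"
proof -
  have "(\<Sum>u\<in>A. \<Sum>v\<in>B. if u = a \<and> v = b then 1 else 0 :: nat)
    = (\<Sum>u\<in>A. if u = a then (if b \<in> B then 1 else 0) else 0)"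
    using assms by (intro sum.cong refl) (auto simp: sum.delta)
  also have "\<dots> = (if a \<in> A \<and> b \<in> B then 1 else 0)"
    using assms by (simp add: sum.delta)
  finally show ?thesis .
qed

lemma cut_edge_weight_eq:
  assumes "hypergraph 2 n G" "S \<subseteq> {1..n}"
  shows "cut (edge_weight G) {1..n} S = size {#e \<in># G. crosses S e#}"
  using assms(1)
proof (induction G)
  case empty
  show ?case by (simp add: cut_def edge_weight_def)
next
  case (add e G)
  then have "hypergraph 2 n G" and "e \<in> tuples 2 n" by (auto simp: hypergraph_def)
  then obtain a b where e: "e = [a, b]" "a \<in> {1..n}" "b \<in> {1..n}" by (rule_tac tuples_2E)
  have "finite S" using assms(2) finite_subset by blast
  note edge_weight_add_mset[of a b G, folded e(1)]
  then have "cut (edge_weight (add_mset e G)) {1..n} S = cut (edge_weight G) {1..n} S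
    + (if a \<in> S \<and> b \<in> {1..n} - S then 1 else 0) + (if b \<in> S \<and> a \<in> {1..n} - S then 1 else 0)"
    using \<open>finite S\<close> by (simp add: cut_def sum.distrib sum_sum_indicator del: atLeastAtMost_iff DiffE)
  then show ?case
    using add.IH[OF \<open>hypergraph 2 n G\<close>] e by (auto simp: crosses_def)
qed

lemma unsatisfied_le:
  assumes "x \<in> satisfying_assignments n \<eta> I"
  shows "real (size {#C \<in># I. \<not> satisfies x C#}) \<le> \<eta> * real (size I)"
proof -
  have "size I = size {#C \<in># I. satisfies x C#} + size {#C \<in># I. \<not> satisfies x C#}"
    by (metis multiset_partition size_union)
  then have "real (size I) = real (size {#C \<in># I. satisfies x C#}) + real (size {#C \<in># I. \<not> satisfies x C#})"
    by simp
  with assms show ?thesis by (simp add: satisfying_assignments_def algebra_simps)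
qed

text \<open>On an edge that crosses the difference set exactly one endpoint changes sign, so the two
  products differ while the required sign is the same: \<open>x\<close> or \<open>y\<close> violates
  the constraint. The crossing edges are thus covered by the two sets of violated
  constraints.\<close>

lemma cut_difference_le_budget:
  assumes H: "hypergraph 2 n G" and I: "xor_instance I G" and "0 \<le> \<eta>"
    and x: "x \<in> satisfying_assignments n \<eta> I" and y: "y \<in> satisfying_assignments n \<eta> I"
  shows "cut (edge_weight G) {1..n} {u \<in> {1..n}. x u \<noteq> y u} \<le> budget n \<eta> (size G)"
proof -
  define S where "S = {u \<in> {1..n}. x u \<noteq> y u}"
  have G: "G = image_mset snd I" and sizeI: "size I = size G"
    using I by (auto simp: xor_instance_def)
  have "cut (edge_weight G) {1..n} S = size {#e \<in># G. crosses S e#}"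
    using H by (intro cut_edge_weight_eq) (auto simp: S_def)
  also have "\<dots> = size {#C \<in># I. crosses S (snd C)#}"
    unfolding G filter_mset_image_mset by simp
  also have "{#C \<in># I. crosses S (snd C)#} \<subseteq># {#C \<in># I. \<not> satisfies x C \<or> \<not> satisfies y C#}"
  proof -
    have unsat: "\<not> satisfies x C \<or> \<not> satisfies y C" if C: "C \<in># I" "crosses S (snd C)" for C
    proof -
      have "snd C \<in># G" using C G by auto
      then have "snd C \<in> tuples 2 n" using H by (auto simp: hypergraph_def)
      then obtain a b where ab: "snd C = [a, b]" "a \<in> {1..n}" "b \<in> {1..n}" by (rule tuples_2E)
      have "x a \<in> {1,-1}" "x b \<in> {1,-1}" "y a \<in> {1,-1}" "y b \<in> {1,-1}"
        using x y ab unfolding satisfying_assignments_def by (auto simp: PiE_iff)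
      with C(2) ab have "x a * x b \<noteq> y a * y b"
        by (auto simp: crosses_def S_def)
      then show ?thesis by (auto simp: satisfies_def ab)
    qed
    show ?thesis
      using unsat by (intro mset_subset_eqI) (auto simp flip: not_in_iff)
  qed
  then have "size {#C \<in># I. crosses S (snd C)#}
    \<le> size {#C \<in># I. \<not> satisfies x C \<or> \<not> satisfies y C#}" by (rule size_mset_mono)
  also have "\<dots> \<le> size {#C \<in># I. \<not> satisfies x C#} + size {#C \<in># I. \<not> satisfies y C#}"
  proof -
    have "{#C \<in># I. \<not> satisfies x C \<or> \<not> satisfies y C#}
      \<subseteq># {#C \<in># I. \<not> satisfies x C#} + {#C \<in># I. \<not> satisfies y C#}"
      by (rule mset_subset_eqI) auto
    from size_mset_mono[OF this] show ?thesis by simp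
  qed
  also have "\<dots> \<le> budget n \<eta> (size G)"
  proof -
    \<comment> \<open>The number of violated constraints is an integer, so the bound may be rounded
      down for each assignment before doubling.\<close>
    have "size {#C \<in># I. \<not> satisfies z C#} \<le> size G * (nat \<lfloor>\<eta> * 2 ^ n\<rfloor> + 1) div 2 ^ n"
      if z: "z \<in> satisfying_assignments n \<eta> I" for z
    proof -
      have "real (size {#C \<in># I. \<not> satisfies z C#}) * 2 ^ n \<le> (\<eta> * real (size G)) * 2 ^ n"
        using unsatisfied_le[OF z] sizeI by (intro mult_right_mono) auto
      also have "\<dots> = real (size G) * (\<eta> * 2 ^ n)" by simp
      also have "\<dots> \<le> real (size G) * real (nat \<lfloor>\<eta> * 2 ^ n\<rfloor> + 1)"
        using \<open>0 \<le> \<eta>\<close> by (intro mult_left_mono) (auto, linarith)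
      finally have "real (size {#C \<in># I. \<not> satisfies z C#} * 2 ^ n)
        \<le> real (size G * (nat \<lfloor>\<eta> * 2 ^ n\<rfloor> + 1))"
        unfolding of_nat_mult of_nat_power of_nat_numeral .
      then have "size {#C \<in># I. \<not> satisfies z C#} * 2 ^ n \<le> size G * (nat \<lfloor>\<eta> * 2 ^ n\<rfloor> + 1)"
        by (simp only: of_nat_le_iff)
      then show ?thesis by (simp add: less_eq_div_iff_mult_less_eq)
    qed
    from this[OF x] this[OF y] show ?thesis by (simp add: budget_def)
  qed
  finally show ?thesis by (simp add: S_def)
qed

text \<open>Relative to one fixed satisfying assignment \<open>y\<close>, an assignment with values
  \<plusminus>1 is determined by the set where it differs from \<open>y\<close>.\<close>

lemma card_satisfying_assignments_le_small_cuts: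
  assumes H: "hypergraph 2 n G" and I: "xor_instance I G" and "0 \<le> \<eta>"
  shows "card (satisfying_assignments n \<eta> I)
    \<le> card (small_cuts (edge_weight G) {1..n} (budget n \<eta> (size G)))"
proof (cases "satisfying_assignments n \<eta> I = {}")
  case False
  then obtain y where y: "y \<in> satisfying_assignments n \<eta> I" by blast
  show ?thesis
  proof (rule card_inj_on_le[where f = "\<lambda>x. {u \<in> {1..n}. x u \<noteq> y u}"])
    show "inj_on (\<lambda>x. {u \<in> {1..n}. x u \<noteq> y u}) (satisfying_assignments n \<eta> I)"
    proof (rule inj_onI)
      fix x z assume xz: "x \<in> satisfying_assignments n \<eta> I" "z \<in> satisfying_assignments n \<eta> I"
        and eq: "{u \<in> {1..n}. x u \<noteq> y u} = {u \<in> {1..n}. z u \<noteq> y u}"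
      have PiE: "x \<in> {1..n} \<rightarrow>\<^sub>E {1, -1}" "z \<in> {1..n} \<rightarrow>\<^sub>E {1, -1}" "y \<in> {1..n} \<rightarrow>\<^sub>E {1, -1}"
        using xz y by (auto simp: satisfying_assignments_def)
      show "x = z"
      proof (rule PiE_ext[OF PiE(1,2)])
        fix u assume u: "u \<in> {1..n}"
        have "x u \<in> {1, -1}" "z u \<in> {1, -1}" "y u \<in> {1, -1}"
          using PiE u by (auto simp: PiE_iff)
        moreover have "x u \<noteq> y u \<longleftrightarrow> z u \<noteq> y u" using eq u by blast
        ultimately show "x u = z u" by auto
      qed
    qed
    show "(\<lambda>x. {u \<in> {1..n}. x u \<noteq> y u}) ` satisfying_assignments n \<eta> I
      \<subseteq> small_cuts (edge_weight G) {1..n} (budget n \<eta> (size G))"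
    proof clarify
      fix x assume "x \<in> satisfying_assignments n \<eta> I"
      from cut_difference_le_budget[OF H I \<open>0 \<le> \<eta>\<close> this y]
      show "{u \<in> {1..n}. x u \<noteq> y u} \<in> small_cuts (edge_weight G) {1..n} (budget n \<eta> (size G))"
        unfolding small_cuts_def by blast
    qed
  qed (simp add: finite_small_cuts)
qed simp

lemma karger_den_pos: "0 < karger_den c L n"
  unfolding karger_den_def
proof (rule prod_pos)
  fix i show "0 < (if i * c \<le> 2 * L then 1 else Suc i * c - 2 * L)"
    by (cases "i * c \<le> 2 * L") (auto simp: not_le)
qed

lemma karger_bound_eq: "karger_bound c L n = real (karger_num c L n) / real (karger_den c L n)"
  unfolding karger_bound_def karger_num_def karger_den_def of_nat_prod prod_dividef[symmetric]
proof (rule prod.cong)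
  fix i
  have "real (Suc i * c - 2 * L) = real (Suc i * c) - 2 * real L" if "\<not> i * c \<le> 2 * L"
  proof -
    have "2 * L \<le> Suc i * c" using that by simp
    then show ?thesis by (simp add: of_nat_diff del: mult_Suc)
  qed
  then show "(if i * c \<le> 2 * L then 2 else real (Suc i * c) / (real (Suc i * c) - 2 * real L))
    = real (if i * c \<le> 2 * L then 2 else Suc i * c)
      / real (if i * c \<le> 2 * L then 1 else Suc i * c - 2 * L)"
    by (simp del: mult_Suc of_nat_mult)
qed simp

lemma card_satisfying_assignments_le:
  assumes H: "hypergraph 2 n G" and I: "xor_instance I G" and "0 \<le> \<eta>"
  shows "card (satisfying_assignments n \<eta> I) \<le> assignment_bound n \<eta> G"
proof -
  define c where "c = mincut (edge_weight G) {1..n} (size G)"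
  define L where "L = budget n \<eta> (size G)"
  have bound_eq: "assignment_bound n \<eta> G = (if L < c then 2 else karger_num c L n div karger_den c L n)"
    unfolding assignment_bound_def Let_def c_def L_def ..
  define X where "X = small_cuts (edge_weight G) {1..n} L"
  have c: "c \<le> cut (edge_weight G) {1..n} S" if "proper {1..n} S" for S
    unfolding c_def using that by (intro mincut_le_cut) auto
  have le: "card (satisfying_assignments n \<eta> I) \<le> card X"
    unfolding X_def L_def by (rule card_satisfying_assignments_le_small_cuts[OF assms])
  show ?thesis
  proof (cases "L < c")
    case True
    have "X \<subseteq> {{}, {1..n}}"
    proof
      fix S assume "S \<in> X"
      then have "S \<subseteq> {1..n}" "cut (edge_weight G) {1..n} S \<le> L" by (auto simp: X_def small_cuts_def)
      then show "S \<in> {{}, {1..n}}" using c[of S] True by (auto simp: proper_def)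
    qed
    then have "card X \<le> card {{}, {1..n}}" by (intro card_mono) auto
    also have "\<dots> \<le> 2" by (simp add: card_insert_if)
    finally show ?thesis using le True
      by (simp add: bound_eq)
  next
    case False
    have "real (card X) \<le> karger_bound c L n"
      using card_small_cuts_le[of "{1..n}" "edge_weight G" c L] c symmetric_weights_edge_weight by (simp add: X_def)
    \<comment> \<open>Clearing the denominator moves the estimate to the naturals, where rounding
      the quotient down loses nothing.\<close>
    then have "real (card X * karger_den c L n) \<le> real (karger_num c L n)"
      unfolding karger_bound_eq using karger_den_pos[of c L n] by (simp add: field_simps)
    then have "card X * karger_den c L n \<le> karger_num c L n" by (simp only: of_nat_le_iff)
    then have "card X \<le> karger_num c L n div karger_den c L n"
      using karger_den_pos by (simp add: less_eq_div_iff_mult_less_eq)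
    with le False show ?thesis
      by (simp add: bound_eq)
  qed
qed

section \<open>The size of the bound\<close>

text \<open>Makes the error from rounding \<eta> to a multiple of 2^-n, scaled by n, at most
  1/100.\<close>

lemma hundred_times_le_two_power: "10 \<le> n \<Longrightarrow> 100 * n \<le> 2 ^ n"
  by (induction n rule: dec_induct) auto

text \<open>The deterministic half of the size estimate. For \<open>100 \<le> n\<close> the cut
  hypotheses give c \<ge> (297/200) \<Delta>, while L \<le> (17/8) \<Delta> (n \<eta> + 1/100); the
  two branches compare these numbers.\<close>

lemma assignment_bound_le:
  fixes \<Delta> \<eta> :: real
  assumes n: "100 \<le> n" and "0 < \<Delta>" and \<eta>: "0 \<le> \<eta>"
    and size: "real (size G) \<le> 17 / 16 * \<Delta> * real n"
    and cuts: "\<And>S. proper {1..n} S \<Longrightarrow> 3 / 2 * (1 - 1 / real n) * \<Delta> \<le> real (cut (edge_weight G) {1..n} S)"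
    and size_ge: "3 / 2 * (1 - 1 / real n) * \<Delta> \<le> real (size G)"
  shows "real (assignment_bound n \<eta> G)
    \<le> (if \<eta> \<le> 1 / (3 * real n) then 2 else 2 * exp (3 * \<eta> * real n * ln (real n)))"
proof -
  define c where "c = mincut (edge_weight G) {1..n} (size G)"
  define L where "L = budget n \<eta> (size G)"
  have bound_eq: "assignment_bound n \<eta> G = (if L < c then 2 else karger_num c L n div karger_den c L n)"
    unfolding assignment_bound_def Let_def c_def L_def ..
  define \<epsilon> where "\<epsilon> = 1 / (2 ^ n :: real)"
  \<comment> \<open>The minimum is attained either by a proper cut or by the cap, which is why
    \<open>size_ge\<close> accompanies \<open>cuts\<close>.\<close>
  have "c \<in> insert (size G) (cut (edge_weight G) {1..n} ` {S. proper {1..n} S})"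
    unfolding c_def mincut_def by (intro Min_in) (auto intro: finite_proper)
  then have "3 / 2 * (1 - 1 / real n) * \<Delta> \<le> real c"
    using cuts size_ge by auto
  moreover have "1 / real n \<le> 1 / 100" using n by (intro divide_left_mono) auto
  then have "3 / 2 * (99 / 100) * \<Delta> \<le> 3 / 2 * (1 - 1 / real n) * \<Delta>"
    using \<open>0 < \<Delta>\<close> by (intro mult_right_mono) auto
  ultimately have c: "297 / 200 * \<Delta> \<le> real c" by simp
  have "0 < real c" by (rule less_le_trans[OF _ c]) (use \<open>0 < \<Delta>\<close> in simp)
  have "real (100 * n) \<le> real (2 ^ n)"
    using hundred_times_le_two_power[of n] n by (intro of_nat_mono) simp
  then have \<epsilon>: "real n * \<epsilon> \<le> 1 / 100" by (simp add: \<epsilon>_def field_simps)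
  have "real L \<le> 2 * (real (size G * (nat \<lfloor>\<eta> * 2 ^ n\<rfloor> + 1)) / 2 ^ n)"
    unfolding L_def budget_def of_nat_mult[of 2] of_nat_numeral
    using of_nat_div_le_of_nat[of "size G * (nat \<lfloor>\<eta> * 2 ^ n\<rfloor> + 1)" "2 ^ n", where ?'a = real]
    unfolding of_nat_power of_nat_numeral by (intro mult_left_mono) auto
  also have "\<dots> = 2 * (real (size G) * (real (nat \<lfloor>\<eta> * 2 ^ n\<rfloor> + 1) / 2 ^ n))"
    unfolding of_nat_mult by simp
  also have "\<dots> \<le> 2 * (real (size G) * ((\<eta> * 2 ^ n + 1) / 2 ^ n))"
    using \<eta> by (intro mult_left_mono divide_right_mono) auto
  also have "(\<eta> * 2 ^ n + 1) / 2 ^ n = \<eta> + \<epsilon>" by (simp add: \<epsilon>_def field_simps)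
  also have "2 * (real (size G) * (\<eta> + \<epsilon>)) \<le> 2 * ((17 / 16 * \<Delta> * real n) * (\<eta> + \<epsilon>))"
    using \<eta> by (intro mult_left_mono mult_right_mono size) (auto simp: \<epsilon>_def)
  also have "\<dots> = 17 / 8 * \<Delta> * (real n * \<eta> + real n * \<epsilon>)" by (simp add: algebra_simps)
  also have "\<dots> \<le> 17 / 8 * \<Delta> * (real n * \<eta> + 1 / 100)"
    using \<open>0 < \<Delta>\<close> \<epsilon> by (intro mult_left_mono add_mono) auto
  finally have L: "real L \<le> 17 / 8 * \<Delta> * (real n * \<eta> + 1 / 100)" .
  show ?thesis
  proof (cases "\<eta> \<le> 1 / (3 * real n)")
    case True
    then have "real n * \<eta> \<le> 1 / 3" using n by (simp add: field_simps)
    \<comment> \<open>The right side is about 0.73 \<Delta>, well below 1.485 \<Delta>.\<close>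
    then have "17 / 8 * \<Delta> * (real n * \<eta> + 1 / 100) \<le> 17 / 8 * \<Delta> * (1 / 3 + 1 / 100)"
      using \<open>0 < \<Delta>\<close> by (intro mult_left_mono add_right_mono) auto
    with L c \<open>0 < \<Delta>\<close> have "real L < real c" by argo
    then show ?thesis
      using True by (simp add: bound_eq)
  next
    case False
    then have n\<eta>: "1 / 3 < real n * \<eta>" using n by (simp add: field_simps)
    have "2 \<le> 2 * exp (3 * \<eta> * real n * ln (real n))"
      using \<eta> n by simp
    moreover have "real (karger_num c L n div karger_den c L n)
      \<le> 2 * exp (3 * \<eta> * real n * ln (real n))"
    proof -
      have "real (karger_num c L n div karger_den c L n) \<le> karger_bound c L n"
        unfolding karger_bound_eq by (rule of_nat_div_le_of_nat)
      also have "\<dots> \<le> 2 * real n powr (2 * real L / real c)"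
        using n \<open>0 < real c\<close> by (intro karger_bound_le) auto
      also have "2 * real L / real c \<le> 3 * \<eta> * real n"
      proof -
        have "2 * real L \<le> 17 / 4 * \<Delta> * (real n * \<eta> + 1 / 100)" using L by simp
        \<comment> \<open>Since n \<eta> > 1/3, the additive 1/100 is at most 3/100 of n \<eta>. The
          coefficient becomes 4.3775, still below 3 * 297/200 = 4.455.\<close>
        also have "\<dots> \<le> 17 / 4 * \<Delta> * (103 / 100 * (real n * \<eta>))"
          using \<open>0 < \<Delta>\<close> n\<eta> by (intro mult_left_mono) argo+
        also have "\<dots> \<le> 3 * (297 / 200 * \<Delta>) * (real n * \<eta>)"
          using \<open>0 < \<Delta>\<close> \<eta> by (simp add: mult_ac)
        also have "\<dots> \<le> 3 * real c * (real n * \<eta>)"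
          using c \<eta> by (intro mult_right_mono mult_left_mono) auto
        finally show ?thesis using \<open>0 < real c\<close> by (simp add: field_simps)
      qed
      then have "2 * real n powr (2 * real L / real c) \<le> 2 * real n powr (3 * \<eta> * real n)"
        using n by (intro mult_left_mono powr_mono) auto
      also have "\<dots> = 2 * exp (3 * \<eta> * real n * ln (real n))"
        using n by (simp add: powr_def)
      finally show ?thesis .
    qed
    ultimately show ?thesis
      using False by (simp add: bound_eq)
  qed
qed

section \<open>Concentration of cuts in the random graph\<close>

abbreviation bits_pmf :: "'a set \<Rightarrow> real \<Rightarrow> ('a \<Rightarrow> bool) pmf" where
  "bits_pmf \<Omega> p \<equiv> Pi_pmf \<Omega> False (\<lambda>_. bernoulli_pmf p)"

text \<open>Markov's inequality for exp(t * count): independence factorises the expectation, and 1 +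
  y \<le> exp y bounds each factor. The sign of \<open>t\<close> is free, so this serves both
  tails.\<close>

lemma prob_exp_count_ge:
  fixes t b p :: real
  assumes fin: "finite \<Omega>" and A: "A \<subseteq> \<Omega>" and p: "0 \<le> p" "p \<le> 1"
  shows "measure_pmf.prob (bits_pmf \<Omega> p) {f. b \<le> t * real (card {e \<in> A. f e})}
    \<le> exp (p * real (card A) * (exp t - 1) - b)"
proof -
  define g where "g e v = (if e \<in> A \<and> v then exp t else 1 :: real)" for e v
  have g_prod: "(\<Prod>e\<in>\<Omega>. g e (f e)) = exp (t * real (card {e \<in> A. f e}))" for f
  proof -
    have "(\<Prod>e\<in>\<Omega>. g e (f e)) = (\<Prod>e\<in>{e \<in> A. f e}. exp t)"
      unfolding g_def using fin A by (intro prod.mono_neutral_cong_right) auto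
    then show ?thesis by (simp flip: exp_of_nat_mult add: mult.commute)
  qed
  have int_g: "integrable (measure_pmf (bernoulli_pmf p)) (g e)" for e
    by (intro integrable_measure_pmf_finite) auto
  have int: "integrable (measure_pmf (bits_pmf \<Omega> p)) (\<lambda>f. \<Prod>e\<in>\<Omega>. g e (f e))"
    by (intro integrable_prod_Pi_pmf fin int_g)
  have "measure_pmf.expectation (bits_pmf \<Omega> p) (\<lambda>f. \<Prod>e\<in>\<Omega>. g e (f e))
    = (\<Prod>e\<in>\<Omega>. measure_pmf.expectation (bernoulli_pmf p) (g e))"
    by (rule expectation_prod_Pi_pmf[OF fin int_g]) (simp add: g_def)
  also have "\<dots> = (\<Prod>e\<in>\<Omega>. if e \<in> A then 1 + p * (exp t - 1) else 1)"
    using p by (intro prod.cong refl) (simp add: g_def algebra_simps)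
  also have "\<dots> = (\<Prod>e\<in>A. 1 + p * (exp t - 1))"
    using fin A by (intro prod.mono_neutral_cong_right) auto
  also have "\<dots> \<le> (\<Prod>e\<in>A. exp (p * (exp t - 1)))"
  proof (intro prod_mono conjI exp_ge_add_one_self)
    have "0 \<le> (1 - p) + p * exp t" using p by simp
    then show "0 \<le> 1 + p * (exp t - 1)" by (simp add: algebra_simps)
  qed
  also have "\<dots> = exp (p * real (card A) * (exp t - 1))"
    by (simp flip: exp_of_nat_mult add: mult_ac)
  finally have E: "measure_pmf.expectation (bits_pmf \<Omega> p) (\<lambda>f. \<Prod>e\<in>\<Omega>. g e (f e))
    \<le> exp (p * real (card A) * (exp t - 1))" .
  have "measure_pmf.prob (bits_pmf \<Omega> p) {f. b \<le> t * real (card {e \<in> A. f e})}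
    = measure_pmf.prob (bits_pmf \<Omega> p) {f \<in> space (measure_pmf (bits_pmf \<Omega> p)). exp b \<le> (\<Prod>e\<in>\<Omega>. g e (f e))}"
    by (simp add: g_prod)
  also have "\<dots> \<le> measure_pmf.expectation (bits_pmf \<Omega> p) (\<lambda>f. \<Prod>e\<in>\<Omega>. g e (f e)) / exp b"
    by (rule integral_Markov_inequality_measure[OF int, where A = "{}"]) (simp_all add: g_prod)
  also have "\<dots> \<le> exp (p * real (card A) * (exp t - 1)) / exp b"
    by (intro divide_right_mono E) simp
  finally show ?thesis by (simp add: exp_diff)
qed

text \<open>Taken at t = -1/4. With exp(-1/4) \<le> 25/32 the exponent per unit of mean is 25/32 - 1
  + 3/16 = -1/32.\<close>

lemma prob_count_small:
  assumes fin: "finite \<Omega>" and A: "A \<subseteq> \<Omega>" and p: "0 \<le> p" "p \<le> 1"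
  shows "measure_pmf.prob (bits_pmf \<Omega> p) {f. real (card {e \<in> A. f e}) \<le> 3 / 4 * (p * real (card A))}
    \<le> exp (- (p * real (card A)) / 32)"
proof -
  define \<mu> where "\<mu> = p * real (card A)"
  have "0 \<le> \<mu>" using p by (simp add: \<mu>_def)
  have e: "exp (- (1/4)) \<le> (25 / 32 :: real)"
  proof -
    have "32 / 25 \<le> (1 + 1/4 + (1/4)^2 / 2 :: real)" by (simp add: power2_eq_square)
    also have "\<dots> \<le> exp (1/4)" by (rule exp_lower_Taylor_quadratic) simp
    finally have "32 / 25 \<le> exp (1/4 :: real)" .
    then have "1 / exp (1/4 :: real) \<le> 1 / (32 / 25)" by (intro divide_left_mono) auto
    then show ?thesis by (simp add: exp_minus inverse_eq_divide)
  qed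
  have set_eq: "{f. real (card {e \<in> A. f e}) \<le> 3 / 4 * \<mu>}
    = {f. - (1/4) * (3 / 4 * \<mu>) \<le> - (1/4) * real (card {e \<in> A. f e})}" by auto
  have "measure_pmf.prob (bits_pmf \<Omega> p) {f. real (card {e \<in> A. f e}) \<le> 3 / 4 * \<mu>}
    \<le> exp (\<mu> * (exp (- (1/4)) - 1) - (- (1/4) * (3 / 4 * \<mu>)))"
    unfolding set_eq unfolding \<mu>_def by (rule prob_exp_count_ge[OF fin A p])
  also have "\<dots> \<le> exp (- \<mu> / 32)"
    using mult_left_mono[OF e \<open>0 \<le> \<mu>\<close>] by (simp add: algebra_simps)
  finally show ?thesis by (simp add: \<mu>_def)
qed

text \<open>Taken at t = 1/32. The exponent per unit of mean is at most 1/32 + 1/1024 - 17/512 =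
  -1/1024.\<close>

lemma prob_count_large:
  assumes fin: "finite \<Omega>" and A: "A \<subseteq> \<Omega>" and p: "0 \<le> p" "p \<le> 1"
  shows "measure_pmf.prob (bits_pmf \<Omega> p) {f. 17 / 16 * (p * real (card A)) \<le> real (card {e \<in> A. f e})}
    \<le> exp (- (p * real (card A)) / 1024)"
proof -
  define \<mu> where "\<mu> = p * real (card A)"
  have "0 \<le> \<mu>" using p by (simp add: \<mu>_def)
  have e: "exp (1/32) \<le> (1 + 1/32 + (1/32)^2 :: real)" by (rule exp_bound) auto
  have set_eq: "{f. 17 / 16 * \<mu> \<le> real (card {e \<in> A. f e})}
    = {f. 1/32 * (17 / 16 * \<mu>) \<le> 1/32 * real (card {e \<in> A. f e})}" by auto
  have "measure_pmf.prob (bits_pmf \<Omega> p) {f. 17 / 16 * \<mu> \<le> real (card {e \<in> A. f e})}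
    \<le> exp (\<mu> * (exp (1/32) - 1) - 1/32 * (17 / 16 * \<mu>))"
    unfolding set_eq unfolding \<mu>_def by (rule prob_exp_count_ge[OF fin A p])
  also have "\<dots> \<le> exp (- \<mu> / 1024)"
    using mult_left_mono[OF e \<open>0 \<le> \<mu>\<close>] by (simp add: algebra_simps power2_eq_square)
  finally show ?thesis by (simp add: \<mu>_def)
qed

section \<open>The random graph as a function of independent bits\<close>

definition signed_tuples :: "nat \<Rightarrow> (nat list \<times> int list) set" where
  "signed_tuples n = tuples 2 n \<times> sign_patterns 2"

definition graph_of :: "nat \<Rightarrow> (nat list \<times> int list \<Rightarrow> bool) \<Rightarrow> nat list multiset" where
  "graph_of n f = image_mset fst (mset_set {e \<in> signed_tuples n. f e})"

lemma tuples_2_eq: "tuples 2 n = (\<lambda>(a, b). [a, b]) ` ({1..n} \<times> {1..n})"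
  by (auto simp: tuples_def numeral_2_eq_2 length_Suc_conv)

lemma inj_pair_list: "inj_on (\<lambda>(a, b). [a, b]) X"
  by (auto simp: inj_on_def)

lemma sign_patterns_2: "sign_patterns 2 = {[1, 1], [1, -1], [-1, 1], [-1, -1]}"
  by (auto simp: sign_patterns_def numeral_2_eq_2 length_Suc_conv)

lemma card_sign_patterns_2: "card (sign_patterns 2) = 4"
  by (simp add: sign_patterns_2)

lemma finite_signed_tuples: "finite (signed_tuples n)"
  by (simp add: signed_tuples_def tuples_2_eq sign_patterns_2)

lemma card_signed_tuples: "card (signed_tuples n) = 4 * n ^ 2"
  by (simp add: signed_tuples_def card_cartesian_product card_sign_patterns_2 tuples_2_eq
      card_image inj_pair_list power2_eq_square)

text \<open>The 8 is two orientations of a pair times four sign patterns.\<close>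

lemma card_crossing_tuples:
  assumes S: "S \<subseteq> {1..n}"
  shows "card {e \<in> signed_tuples n. crosses S (fst e)} = 8 * (card S * (n - card S))"
proof -
  have finS: "finite S" using S finite_subset by blast
  have "{e \<in> signed_tuples n. crosses S (fst e)}
    = (\<lambda>(a, b). [a, b]) ` (S \<times> ({1..n} - S) \<union> ({1..n} - S) \<times> S) \<times> sign_patterns 2"
    using S unfolding signed_tuples_def tuples_2_eq by (auto simp: crosses_def)
  also have "card \<dots> = card (S \<times> ({1..n} - S) \<union> ({1..n} - S) \<times> S) * 4"
    by (simp add: card_cartesian_product card_image inj_pair_list card_sign_patterns_2)
  also have "card (S \<times> ({1..n} - S) \<union> ({1..n} - S) \<times> S)
    = card (S \<times> ({1..n} - S)) + card (({1..n} - S) \<times> S)"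
    using finS by (intro card_Un_disjoint) auto
  also have "\<dots> = 2 * (card S * (n - card S))"
    using S finS by (simp add: card_cartesian_product card_Diff_subset)
  finally show ?thesis by simp
qed

lemma hypergraph_graph_of: "hypergraph 2 n (graph_of n f)"
  using finite_signed_tuples by (auto simp: hypergraph_def graph_of_def signed_tuples_def)

lemma size_graph_of: "size (graph_of n f) = card {e \<in> signed_tuples n. f e}"
  by (simp add: graph_of_def)

lemma cut_graph_of:
  assumes "S \<subseteq> {1..n}"
  shows "cut (edge_weight (graph_of n f)) {1..n} S
    = card {e \<in> {e \<in> signed_tuples n. crosses S (fst e)}. f e}"
proof -
  have "cut (edge_weight (graph_of n f)) {1..n} S = size {#e \<in># graph_of n f. crosses S e#}"
    by (intro cut_edge_weight_eq hypergraph_graph_of assms)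
  also have "\<dots> = card {e \<in> {e \<in> signed_tuples n. f e}. crosses S (fst e)}"
    using finite_signed_tuples by (simp add: graph_of_def filter_mset_image_mset)
  also have "{e \<in> {e \<in> signed_tuples n. f e}. crosses S (fst e)}
    = {e \<in> {e \<in> signed_tuples n. crosses S (fst e)}. f e}" by auto
  finally show ?thesis .
qed

lemma sum_Pow_power_card:
  fixes x :: real
  assumes "finite A"
  shows "(\<Sum>S\<in>Pow A. x ^ card S) = (1 + x) ^ card A"
  using prod_add[OF assms, of "\<lambda>_. x" "\<lambda>_. 1"] assms by (simp add: add.commute)

text \<open>A set and its complement have the same cut, so concentration is needed only for sets of
  at most half the vertices.\<close>

lemma good_graph:
  fixes n f and \<Delta> :: real
  defines "G \<equiv> graph_of n f"
  assumes n: "2 \<le> n" and \<Delta>: "0 < \<Delta>"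
    and small: "\<And>S. S \<subseteq> {1..n} \<Longrightarrow> S \<noteq> {} \<Longrightarrow> 2 * card S \<le> n \<Longrightarrow>
      3 / 4 * (2 * real (card S * (n - card S)) * \<Delta> / real n) \<le> real (cut (edge_weight G) {1..n} S)"
    and S: "proper {1..n} S"
  shows "3 / 2 * (1 - 1 / real n) * \<Delta> \<le> real (cut (edge_weight G) {1..n} S)"
proof -
  have main: "3 / 2 * (1 - 1 / real n) * \<Delta> \<le> real (cut (edge_weight G) {1..n} S)"
    if S: "proper {1..n} S" and "2 * card S \<le> n" for S
  proof -
    have finS: "finite S" using S finite_subset by (auto simp: proper_def)
    have "card S \<noteq> 0" using S finS by (auto simp: proper_def)
    then obtain k where k: "card S = Suc k" by (cases "card S") auto
    have "n - 1 \<le> card S * (n - card S)"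
    proof -
      \<comment> \<open>The claim becomes k + d + 1 \<le> (k + 1)(d + 1).\<close>
      obtain d where d: "n = Suc k + Suc d"
        using k \<open>2 * card S \<le> n\<close> less_imp_Suc_add[of "Suc k" n] by auto
      show ?thesis by (simp add: k d)
    qed
    then have "real (n - 1) \<le> real (card S * (n - card S))" by (simp only: of_nat_le_iff)
    then have "3 / 4 * (2 * real (n - 1) * \<Delta> / real n)
      \<le> 3 / 4 * (2 * real (card S * (n - card S)) * \<Delta> / real n)"
      using \<Delta> by (intro mult_left_mono divide_right_mono mult_right_mono) auto
    also have "\<dots> \<le> real (cut (edge_weight G) {1..n} S)"
      using S that by (intro small) (auto simp: proper_def)
    also have "3 / 4 * (2 * real (n - 1) * \<Delta> / real n) = 3 / 2 * (1 - 1 / real n) * \<Delta>"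
      using n by (simp add: of_nat_diff field_simps)
    finally show ?thesis .
  qed
  show ?thesis
  proof (cases "2 * card S \<le> n")
    case False
    have "card ({1..n} - S) = n - card S"
      using S finite_subset[of S "{1..n}"] by (subst card_Diff_subset) (auto simp: proper_def)
    then have "2 * card ({1..n} - S) \<le> n" using False by simp
    moreover have "proper {1..n} ({1..n} - S)" using S by (auto simp: proper_def)
    ultimately show ?thesis
      using main cut_Diff[of "{1..n}" "edge_weight G" S] symmetric_weights_edge_weight S by (metis finite_atLeastAtMost proper_def)
  qed (use main S in blast)
qed

text \<open>The first exponential is the upper tail of the number of edges. The rest is the union
  bound over cuts: if S has at most n/2 vertices, its mean cut is at least |S| \<Delta>, so it fails
  with probability at most x^|S| for x = exp(-\<Delta> / 32). Summing over all nonempty subsets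
  gives (1 + x)^n - 1.\<close>

lemma prob_assignment_bound_le:
  fixes n :: nat and \<Delta> \<eta> :: real
  assumes n: "100 \<le> n" and \<Delta>: "0 < \<Delta>" and \<eta>: "0 \<le> \<eta>"
    and p_le: "\<Delta> * real n / (2 ^ 2 * real n ^ 2) \<le> 1"
  shows "1 - (exp (- (\<Delta> * real n) / 1024) + ((1 + exp (- \<Delta> / 32)) ^ n - 1))
    \<le> measure_pmf.prob (random_hypergraph 2 (\<Delta> * real n) n)
        {G. real (assignment_bound n \<eta> G) \<le>
          (if \<eta> \<le> 1 / (3 * real n) then 2 else 2 * exp (3 * \<eta> * real n * ln (real n)))}"
proof -
  define p where "p = \<Delta> * real n / (2 ^ 2 * real n ^ 2)"
  define \<mu> where "\<mu> S = 2 * real (card S * (n - card S)) * \<Delta> / real n" for S :: "nat set"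
  define M where "M = bits_pmf (signed_tuples n) p"
  define \<S> where "\<S> = {S. S \<subseteq> {1..n} \<and> S \<noteq> {} \<and> 2 * card S \<le> n}"
  define big where "big = {f. 17 / 16 * (\<Delta> * real n) \<le> real (size (graph_of n f))}"
  define low where "low S = {f. real (cut (edge_weight (graph_of n f)) {1..n} S) \<le> 3 / 4 * \<mu> S}" for S
  define good where "good = {G. real (assignment_bound n \<eta> G) \<le>
    (if \<eta> \<le> 1 / (3 * real n) then 2 else 2 * exp (3 * \<eta> * real n * ln (real n)))}"
  have p: "0 \<le> p" "p \<le> 1" using p_le \<Delta> by (auto simp: p_def)
  have RH: "random_hypergraph 2 (\<Delta> * real n) n = map_pmf (graph_of n) M"
    unfolding random_hypergraph_def M_def p_def graph_of_def signed_tuples_def ..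
  have "f \<in> big \<union> (\<Union>S\<in>\<S>. low S)" if "graph_of n f \<notin> good" for f
  proof (rule ccontr)
    assume neg: "f \<notin> big \<union> (\<Union>S\<in>\<S>. low S)"
    have cuts: "3 / 2 * (1 - 1 / real n) * \<Delta> \<le> real (cut (edge_weight (graph_of n f)) {1..n} S)"
      if "proper {1..n} S" for S
    proof (rule good_graph[OF _ \<Delta> _ that])
      fix S' :: "nat set" assume "S' \<subseteq> {1..n}" "S' \<noteq> {}" "2 * card S' \<le> n"
      then have "f \<notin> low S'" using neg by (auto simp: \<S>_def)
      then show "3 / 4 * (2 * real (card S' * (n - card S')) * \<Delta> / real n)
        \<le> real (cut (edge_weight (graph_of n f)) {1..n} S')"
        unfolding low_def \<mu>_def mem_Collect_eq by (rule less_imp_le[OF not_le_imp_less])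
    qed (use n in simp)
    have size: "real (size (graph_of n f)) \<le> 17 / 16 * \<Delta> * real n"
      using neg by (simp add: big_def)
    \<comment> \<open>Any proper cut bounds the number of edges from below; the one around vertex 1
      supplies the hypothesis needed for the cap.\<close>
    have "proper {1..n} {1}" using n by (auto simp: proper_def set_eq_iff intro!: exI[of _ 2])
    then have "3 / 2 * (1 - 1 / real n) * \<Delta> \<le> real (cut (edge_weight (graph_of n f)) {1..n} {1})"
      by (rule cuts)
    also have "\<dots> \<le> real (size (graph_of n f))"
      unfolding size_graph_of using n finite_signed_tuples
      by (subst cut_graph_of) (auto intro!: card_mono)
    finally have "graph_of n f \<in> good"
      unfolding good_def using assignment_bound_le[OF n \<Delta> \<eta> size cuts] by simp
    with that show False by simp
  qed
  then have "- (graph_of n -` good) \<subseteq> big \<union> (\<Union>S\<in>\<S>. low S)" by auto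
  then have "measure_pmf.prob M (- (graph_of n -` good)) \<le> measure_pmf.prob M (big \<union> (\<Union>S\<in>\<S>. low S))"
    by (intro measure_pmf.finite_measure_mono) auto
  also have "\<dots> \<le> measure_pmf.prob M big + measure_pmf.prob M (\<Union>S\<in>\<S>. low S)"
    by (intro measure_Un_le) auto
  also have "measure_pmf.prob M big \<le> exp (- (\<Delta> * real n) / 1024)"
  proof -
    have "p * real (card (signed_tuples n)) = \<Delta> * real n"
      using n by (simp add: p_def card_signed_tuples field_simps power2_eq_square)
    then show ?thesis
      using prob_count_large[OF finite_signed_tuples order_refl p, of n]
      unfolding big_def M_def size_graph_of by simp
  qed
  also have "measure_pmf.prob M (\<Union>S\<in>\<S>. low S) \<le> (\<Sum>S\<in>\<S>. measure_pmf.prob M (low S))"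
    by (intro measure_UNION_le) (auto simp: \<S>_def intro: finite_subset[of _ "Pow {1..n}"])
  also have "\<dots> \<le> (\<Sum>S\<in>\<S>. exp (- \<Delta> / 32) ^ card S)"
  proof (rule sum_mono)
    fix S assume S: "S \<in> \<S>"
    then have "S \<subseteq> {1..n}" by (auto simp: \<S>_def)
    define A where "A = {e \<in> signed_tuples n. crosses S (fst e)}"
    have "p * real (card A) = \<mu> S"
      unfolding A_def card_crossing_tuples[OF \<open>S \<subseteq> {1..n}\<close>]
      using n by (simp add: p_def \<mu>_def field_simps power2_eq_square)
    moreover have "A \<subseteq> signed_tuples n" by (auto simp: A_def)
    ultimately have "measure_pmf.prob M (low S) \<le> exp (- \<mu> S / 32)"
      using prob_count_small[OF finite_signed_tuples _ p, of A n]
      unfolding low_def M_def cut_graph_of[OF \<open>S \<subseteq> {1..n}\<close>] A_def[symmetric] by simp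
    also have "\<dots> \<le> exp (real (card S) * (- \<Delta> / 32))"
    proof -
      have "real (card S) * real n \<le> real (card S) * (2 * real (n - card S))"
        using S by (intro mult_left_mono) (auto simp: \<S>_def of_nat_diff)
      then have "real (card S) * real n * \<Delta> \<le> real (card S) * (2 * real (n - card S)) * \<Delta>"
        using \<Delta> by (intro mult_right_mono) auto
      then have "real (card S) * \<Delta> \<le> \<mu> S"
        using n by (simp add: \<mu>_def field_simps)
      then show ?thesis by simp
    qed
    also have "\<dots> = exp (- \<Delta> / 32) ^ card S" by (rule exp_of_nat_mult)
    finally show "measure_pmf.prob M (low S) \<le> exp (- \<Delta> / 32) ^ card S" .
  qed
  also have "\<dots> \<le> (\<Sum>S\<in>Pow {1..n} - {{}}. exp (- \<Delta> / 32) ^ card S)"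
    by (intro sum_mono2) (auto simp: \<S>_def)
  also have "\<dots> = (\<Sum>S\<in>Pow {1..n}. exp (- \<Delta> / 32) ^ card S) - 1"
    by (subst sum_diff1) auto
  also have "\<dots> = (1 + exp (- \<Delta> / 32)) ^ n - 1"
    by (subst sum_Pow_power_card) auto
  finally have "measure_pmf.prob M (- (graph_of n -` good))
    \<le> exp (- (\<Delta> * real n) / 1024) + ((1 + exp (- \<Delta> / 32)) ^ n - 1)" by simp
  moreover have "measure_pmf.prob M (- (graph_of n -` good)) = 1 - measure_pmf.prob M (graph_of n -` good)"
    using measure_pmf.prob_compl[of "graph_of n -` good" M] by (simp add: Compl_eq_Diff_UNIV)
  ultimately show ?thesis
    unfolding RH good_def[symmetric] by simp
qed

text \<open>The union bound over cuts contributes about n exp(-n^\<delta> / 32). Halving the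
  exponent \<delta> absorbs the factor n and the constants 1/32 and 1/1024.\<close>

lemma eventually_failure_prob_le:
  assumes "0 < (\<delta> :: real)"
  shows "\<exists>n0. \<forall>n\<ge>n0. exp (- (real n powr \<delta> * real n) / 1024) + ((1 + exp (- (real n powr \<delta>) / 32)) ^ n - 1)
    \<le> exp (- (real n powr (1 / 2 * \<delta>)))"
proof -
  have 1: "\<forall>\<^sub>F n in sequentially. real n * exp (- (real n powr \<delta>) / 32) \<le> 1"
    using assms by real_asymp
  have 2: "\<forall>\<^sub>F n in sequentially. exp (- (real n powr \<delta> * real n) / 1024)
      + 2 * (real n * exp (- (real n powr \<delta>) / 32)) \<le> exp (- (real n powr (1 / 2 * \<delta>)))"
    using assms by real_asymp
  have "\<forall>\<^sub>F n in sequentially. exp (- (real n powr \<delta> * real n) / 1024)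
      + ((1 + exp (- (real n powr \<delta>) / 32)) ^ n - 1) \<le> exp (- (real n powr (1 / 2 * \<delta>)))"
    using 1 2
  proof eventually_elim
    case (elim n)
    define x where "x = exp (- (real n powr \<delta>) / 32)"
    \<comment> \<open>Once nx \<le> 1, (1 + x)^n - 1 \<le> exp(nx) - 1 \<le> 2nx.\<close>
    have "(1 + x) ^ n \<le> exp x ^ n"
      by (intro power_mono exp_ge_add_one_self) (simp add: x_def)
    also have "\<dots> = exp (real n * x)" by (simp add: exp_of_nat_mult)
    also have "\<dots> \<le> 1 + real n * x + (real n * x)\<^sup>2"
      using elim(1) by (intro exp_bound) (auto simp: x_def)
    also have "(real n * x)\<^sup>2 \<le> real n * x"
      using elim(1) by (simp add: power2_eq_square mult_left_le x_def)
    finally have "(1 + x) ^ n - 1 \<le> 2 * (real n * x)" by linarith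
    with elim(2) show ?case by (simp add: x_def)
  qed
  then show ?thesis by (simp add: eventually_sequentially)
qed

section \<open>Reasoning about programs\<close>

definition bits_at_most :: "nat \<Rightarrow> mem \<Rightarrow> bool" where
  "bits_at_most B s \<longleftrightarrow> (\<forall>a i. s a i < 2 ^ B)"

text \<open>A static weight such that both the bit length and the cost of an expression are at most
  \<open>ksize e * Suc B\<close> when all cells have \<open>B\<close> bits. The doubling at binary
  nodes pays once for the operands and once for the bits of the result, which for products is the
  sum of the operand lengths.\<close>

fun ksize :: "aexp \<Rightarrow> nat" where
  "ksize (Num k) = Suc k"
| "ksize (Arr a e) = Suc (ksize e)"
| "ksize (Plus e f) = 2 * (ksize e + ksize f + 1)"
| "ksize (Minus e f) = 2 * (ksize e + ksize f + 1)"
| "ksize (Times e f) = 2 * (ksize e + ksize f + 1)"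
| "ksize (Quot e f) = 2 * (ksize e + ksize f + 1)"

lemma floorlog_le: "x < 2 ^ b \<Longrightarrow> floorlog 2 x \<le> b"
  using floorlog_leI[of x 2 b] by simp

lemma aval_less:
  assumes "bits_at_most B s"
  shows "aval e s < 2 ^ (ksize e * Suc B)"
proof (induction e)
  case (Num k)
  have "k < 2 ^ k" by (rule less_exp)
  also have "(2::nat) ^ k \<le> 2 ^ (Suc k * Suc B)" by (intro power_increasing) auto
  finally show ?case by simp
next
  case (Arr a e)
  have "s a (aval e s) < 2 ^ B" using assms by (simp add: bits_at_most_def)
  also have "(2::nat) ^ B \<le> 2 ^ (ksize (Arr a e) * Suc B)" by (intro power_increasing) auto
  finally show ?case by simp
next
  case (Plus e f)
  define p q where "p = ksize e * Suc B" and "q = ksize f * Suc B"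
  have "aval e s < 2 ^ (p + q)" "aval f s < 2 ^ (p + q)"
    using Plus.IH unfolding p_def[symmetric] q_def[symmetric]
    by (auto elim!: less_le_trans intro!: power_increasing)
  then have "aval (Plus e f) s < 2 ^ Suc (p + q)" by simp
  also have "(2::nat) ^ Suc (p + q) \<le> 2 ^ (ksize (Plus e f) * Suc B)"
    by (intro power_increasing) (auto simp: p_def q_def algebra_simps)
  finally show ?case .
next
  case (Minus e f)
  have "aval (Minus e f) s \<le> aval e s" by simp
  also note Minus.IH(1)
  also have "(2::nat) ^ (ksize e * Suc B) \<le> 2 ^ (ksize (Minus e f) * Suc B)"
    by (intro power_increasing mult_right_mono) auto
  finally show ?case .
next
  case (Times e f)
  have "aval (Times e f) s < 2 ^ (ksize e * Suc B) * 2 ^ (ksize f * Suc B)"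
    using Times.IH by (simp add: mult_strict_mono')
  also have "\<dots> = 2 ^ ((ksize e + ksize f) * Suc B)"
    by (simp only: power_add[symmetric] distrib_right)
  also have "\<dots> \<le> 2 ^ (ksize (Times e f) * Suc B)"
    by (intro power_increasing mult_right_mono) auto
  finally show ?case .
next
  case (Quot e f)
  have "aval (Quot e f) s \<le> aval e s" by simp
  also note Quot.IH(1)
  also have "(2::nat) ^ (ksize e * Suc B) \<le> 2 ^ (ksize (Quot e f) * Suc B)"
    by (intro power_increasing mult_right_mono) auto
  finally show ?case .
qed

lemma binary_cost_le:
  assumes "v < 2 ^ (p + q + 1)" "c \<le> p" "d \<le> q" "p = k * Suc B" "q = l * Suc B"
  shows "c + d + 1 + floorlog 2 v \<le> 2 * (k + l + 1) * Suc B"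
proof -
  have "floorlog 2 v \<le> p + q + 1" using assms(1) by (rule floorlog_le)
  then show ?thesis using assms by (simp add: algebra_simps)
qed

lemma acost_le:
  assumes "bits_at_most B s"
  shows "acost e s \<le> ksize e * Suc B"
proof (induction e)
  case (Num k)
  have "floorlog 2 k \<le> k" by (intro floorlog_le less_exp)
  then have "acost (Num k) s \<le> Suc k * 1" by simp
  also have "\<dots> \<le> Suc k * Suc B" by (intro mult_left_mono) auto
  finally show ?case by simp
next
  case (Arr a e)
  have "floorlog 2 (s a (aval e s)) \<le> B"
    using assms by (intro floorlog_le) (simp add: bits_at_most_def)
  with Arr show ?case by simp
next
  case (Plus e f)
  have "aval e s < 2 ^ (ksize e * Suc B + ksize f * Suc B)" "aval f s < 2 ^ (ksize e * Suc B + ksize f * Suc B)"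
    using aval_less[OF assms, of e] aval_less[OF assms, of f]
    by (auto elim!: less_le_trans intro!: power_increasing)
  then have "aval (Plus e f) s < 2 ^ (ksize e * Suc B + ksize f * Suc B + 1)" by simp
  from binary_cost_le[OF this Plus.IH refl refl] show ?case by simp
next
  case (Minus e f)
  have "aval e s < 2 ^ (ksize e * Suc B + ksize f * Suc B + 1)"
    using aval_less[OF assms, of e] by (rule less_le_trans) (intro power_increasing, auto)
  then have "aval (Minus e f) s < 2 ^ (ksize e * Suc B + ksize f * Suc B + 1)"
    by (simp add: less_imp_diff_less)
  from binary_cost_le[OF this Minus.IH refl refl] show ?case by simp
next
  case (Times e f)
  have "aval (Times e f) s < 2 ^ (ksize e * Suc B) * 2 ^ (ksize f * Suc B)"
    using aval_less[OF assms] by (simp add: mult_strict_mono')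
  also have "\<dots> \<le> 2 ^ (ksize e * Suc B + ksize f * Suc B + 1)"
    unfolding power_add[symmetric] by (intro power_increasing) auto
  finally show ?case using binary_cost_le[OF _ Times.IH refl refl] by simp
next
  case (Quot e f)
  have "aval e s < 2 ^ (ksize e * Suc B + ksize f * Suc B + 1)"
    using aval_less[OF assms, of e] by (rule less_le_trans) (intro power_increasing, auto)
  then have "aval (Quot e f) s < 2 ^ (ksize e * Suc B + ksize f * Suc B + 1)"
    using div_le_dividend le_less_trans by (metis aval.simps(6))
  from binary_cost_le[OF this Quot.IH refl refl] show ?case by simp
qed

fun writes :: "com \<Rightarrow> string set" where
  "writes Skip = {}"
| "writes (Assign a e f) = {a}"
| "writes (Seq c d) = writes c \<union> writes d"
| "writes (Cond e c d) = writes c \<union> writes d"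
| "writes (While e c) = writes c"

lemma exec_frame: "exec c s t s' \<Longrightarrow> a \<notin> writes c \<Longrightarrow> s' a = s a"
  by (induction rule: exec.induct) auto

definition unit_cost :: "nat \<Rightarrow> nat" where
  "unit_cost B = 1000 * Suc B"

text \<open>Total correctness from memory \<open>s\<close>, with \<open>T\<close> counting assignments and tests, in memories
  all of whose cells have at most \<open>B\<close> bits; 1000 dominates the size of every expression used.\<close>
definition tot :: "nat \<Rightarrow> com \<Rightarrow> mem \<Rightarrow> nat \<Rightarrow> (mem \<Rightarrow> bool) \<Rightarrow> bool" where
  "tot B c s T Q \<longleftrightarrow> (bits_at_most B s \<longrightarrow>
     (\<exists>t s'. exec c s t s' \<and> t \<le> T * unit_cost B \<and> bits_at_most B s' \<and> Q s'))"

lemma tot_bounded: "(bits_at_most B s \<Longrightarrow> tot B c s T Q) \<Longrightarrow> tot B c s T Q"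
  by (auto simp: tot_def)

lemma tot_weaken:
  assumes "tot B c s T Q" "\<And>s'. Q s' \<Longrightarrow> (\<And>a. a \<notin> writes c \<Longrightarrow> s' a = s a) \<Longrightarrow> Q' s'" "T \<le> T'"
  shows "tot B c s T' Q'"
  unfolding tot_def
proof
  assume "bits_at_most B s"
  then obtain t s' where ts: "exec c s t s'" "t \<le> T * unit_cost B" "bits_at_most B s'" "Q s'"
    using assms(1) unfolding tot_def by blast
  have "Q' s'" using assms(2) ts exec_frame by blast
  moreover have "T * unit_cost B \<le> T' * unit_cost B" using assms(3) by (rule mult_right_mono) simp
  ultimately show "\<exists>t s'. exec c s t s' \<and> t \<le> T' * unit_cost B \<and> bits_at_most B s' \<and> Q' s'"
    using ts le_trans by blast
qed

lemma tot_time: "tot B c s T Q \<Longrightarrow> T \<le> T' \<Longrightarrow> tot B c s T' Q"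
  by (rule tot_weaken)

lemma tot_Skip: "Q s \<Longrightarrow> tot B Skip s 1 Q"
  unfolding tot_def unit_cost_def by (intro impI exI[of _ 1] exI[of _ s]) (use Skip[of s] in auto)

lemma tot_Assign:
  assumes "ksize e + ksize f < 1000" "aval f s < 2 ^ B"
    "Q (s(a := (s a)(aval e s := aval f s)))"
  shows "tot B (Assign a e f) s 1 Q"
  unfolding tot_def
proof (intro impI exI conjI)
  assume B: "bits_at_most B s"
  show "exec (Assign a e f) s (acost e s + acost f s + 1) (s(a := (s a)(aval e s := aval f s)))"
    by (rule Assign)
  have "acost e s + acost f s + 1 \<le> ksize e * Suc B + ksize f * Suc B + Suc B"
    using acost_le[OF B] by (intro add_mono) auto
  also have "\<dots> = (ksize e + ksize f + 1) * Suc B" by (simp add: algebra_simps)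
  also have "\<dots> \<le> 1000 * Suc B" using assms(1) by (intro mult_right_mono) auto
  finally show "acost e s + acost f s + 1 \<le> 1 * unit_cost B" by (simp add: unit_cost_def)
  show "bits_at_most B (s(a := (s a)(aval e s := aval f s)))"
    using B assms(2) by (auto simp: bits_at_most_def)
qed (rule assms(3))

lemma tot_Seq:
  assumes "tot B c s T (\<lambda>s'. tot B d s' T' Q)"
  shows "tot B (Seq c d) s (T + T') Q"
  unfolding tot_def
proof
  assume "bits_at_most B s"
  then obtain t s' where 1: "exec c s t s'" "t \<le> T * unit_cost B" "bits_at_most B s'" "tot B d s' T' Q"
    using assms unfolding tot_def by blast
  then obtain t' s'' where 2: "exec d s' t' s''" "t' \<le> T' * unit_cost B" "bits_at_most B s''" "Q s''"
    unfolding tot_def by blast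
  have "t + t' \<le> (T + T') * unit_cost B" using 1(2) 2(2) by (simp add: distrib_right)
  then show "\<exists>t s'. exec (Seq c d) s t s' \<and> t \<le> (T + T') * unit_cost B \<and> bits_at_most B s' \<and> Q s'"
    using Seq[OF 1(1) 2(1)] 2 by blast
qed

lemma test_cost_le:
  assumes "bits_at_most B s" "ksize e < 1000"
  shows "acost e s + 1 \<le> unit_cost B"
proof -
  have "acost e s + 1 \<le> ksize e * Suc B + Suc B" using acost_le[OF assms(1)] by (intro add_mono) auto
  also have "\<dots> = Suc (ksize e) * Suc B" by simp
  also have "\<dots> \<le> 1000 * Suc B" using assms(2) by (intro mult_right_mono) auto
  finally show ?thesis by (simp add: unit_cost_def)
qed

lemma tot_Cond:
  assumes k: "ksize e < 1000"
    and "aval e s \<noteq> 0 \<Longrightarrow> tot B c s T Q" "aval e s = 0 \<Longrightarrow> tot B d s T' Q"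
  shows "tot B (Cond e c d) s (T + T' + 1) Q"
  unfolding tot_def
proof
  assume B: "bits_at_most B s"
  note test = test_cost_le[OF B k]
  show "\<exists>t s'. exec (Cond e c d) s t s' \<and> t \<le> (T + T' + 1) * unit_cost B \<and> bits_at_most B s' \<and> Q s'"
  proof (cases "aval e s = 0")
    case True
    then obtain t s' where 1: "exec d s t s'" "t \<le> T' * unit_cost B" "bits_at_most B s'" "Q s'"
      using assms(3) B unfolding tot_def by blast
    have "acost e s + t + 1 \<le> (T + T' + 1) * unit_cost B"
      using 1(2) test by (simp add: distrib_right)
    then show ?thesis using CondFalse[OF True 1(1)] 1 by blast
  next
    case False
    then obtain t s' where 1: "exec c s t s'" "t \<le> T * unit_cost B" "bits_at_most B s'" "Q s'"
      using assms(2) B unfolding tot_def by blast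
    have "acost e s + t + 1 \<le> (T + T' + 1) * unit_cost B"
      using 1(2) test by (simp add: distrib_right)
    then show ?thesis using CondTrue[OF False 1(1)] 1 by blast
  qed
qed

abbreviation Var :: "string \<Rightarrow> aexp" where
  "Var x \<equiv> Arr x (Num 0)"

abbreviation Set_var :: "string \<Rightarrow> aexp \<Rightarrow> com" where
  "Set_var x f \<equiv> Assign x (Num 0) f"

text \<open>Truncated subtraction makes \<open>h - i\<close> nonzero exactly while i < h, replacing
  the missing comparison. The bound \<open>h\<close> is evaluated afresh in every round.\<close>

definition For :: "string \<Rightarrow> aexp \<Rightarrow> com \<Rightarrow> com" where
  "For i h c = Seq (Set_var i (Num 0))
     (While (Minus h (Var i)) (Seq c (Set_var i (Plus (Var i) (Num 1)))))"

lemma writes_For: "writes (For i h c) = insert i (writes c)"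
  by (auto simp: For_def)

text \<open>The index of \<open>Inv\<close> is a ghost copy of the counter; \<open>indep\<close>
  carries the invariant across the increment, which happens outside the body. Each round pays for
  body, increment and test; the final 2 is the initialisation and the failing test.\<close>

lemma tot_For:
  assumes k: "ksize h < 400" and i: "i \<notin> writes c"
    and h: "\<And>s'. (\<And>a. a \<noteq> i \<Longrightarrow> a \<notin> writes c \<Longrightarrow> s' a = s a) \<Longrightarrow> aval h s' = H"
    and HB: "H < 2 ^ B"
    and init: "Inv 0 s"
    and indep: "\<And>j s' v. Inv j s' \<Longrightarrow> Inv j (s'(i := v))"
    and step: "\<And>j s'. j < H \<Longrightarrow> Inv j s' \<Longrightarrow> s' i 0 = j \<Longrightarrow>
      (\<And>a. a \<noteq> i \<Longrightarrow> a \<notin> writes c \<Longrightarrow> s' a = s a) \<Longrightarrow> tot B c s' T (Inv (Suc j))"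
    and final: "\<And>s'. Inv H s' \<Longrightarrow> (\<And>a. a \<noteq> i \<Longrightarrow> a \<notin> writes c \<Longrightarrow> s' a = s a) \<Longrightarrow> Q s'"
  shows "tot B (For i h c) s (H * (T + 2) + 2) Q"
proof -
  define body where "body = Seq c (Set_var i (Plus (Var i) (Num 1)))"
  define W where "W = While (Minus h (Var i)) body"
  \<comment> \<open>Induction on the number \<open>d\<close> of remaining rounds.\<close>
  have loop: "tot B W s' (d * (T + 2) + 1) Q"
    if "j + d = H" "Inv j s'" "s' i 0 = j" "\<And>a. a \<noteq> i \<Longrightarrow> a \<notin> writes c \<Longrightarrow> s' a = s a" for d j s'
    using that
  proof (induction d arbitrary: j s')
    case 0
    have "aval (Minus h (Var i)) s' = 0" using h[of s'] 0 by simp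
    show ?case unfolding tot_def
    proof
      assume B: "bits_at_most B s'"
      have "acost (Minus h (Var i)) s' + 1 \<le> unit_cost B"
        using k by (intro test_cost_le B) simp
      moreover have "exec W s' (acost (Minus h (Var i)) s' + 1) s'"
        unfolding W_def by (rule WhileFalse) fact
      moreover have "Q s'" using 0 by (intro final) auto
      ultimately show "\<exists>t s''. exec W s' t s'' \<and> t \<le> (0 * (T + 2) + 1) * unit_cost B \<and> bits_at_most B s'' \<and> Q s''"
        using B by (intro exI[of _ "acost (Minus h (Var i)) s' + 1"] exI[of _ s']) auto
    qed
  next
    case (Suc d)
    have nz: "aval (Minus h (Var i)) s' \<noteq> 0" using h[of s'] Suc.prems by simp
    have "tot B body s' (T + 1) (\<lambda>s2. Inv (Suc j) s2 \<and> s2 i 0 = Suc j \<and>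
      (\<forall>a. a \<noteq> i \<longrightarrow> a \<notin> writes c \<longrightarrow> s2 a = s a))"
      unfolding body_def
    proof (rule tot_Seq, rule tot_weaken)
      show "tot B c s' T (Inv (Suc j))" using Suc.prems by (intro step) auto
      fix s1 assume s1: "Inv (Suc j) s1" "\<And>a. a \<notin> writes c \<Longrightarrow> s1 a = s' a"
      show "tot B (Set_var i (Plus (Var i) (Num 1))) s1 1 (\<lambda>s2. Inv (Suc j) s2 \<and> s2 i 0 = Suc j \<and>
        (\<forall>a. a \<noteq> i \<longrightarrow> a \<notin> writes c \<longrightarrow> s2 a = s a))"
        using s1 i Suc.prems HB indep[OF s1(1)] by (intro tot_Assign) auto
    qed simp
    then have body: "tot B body s' (T + 1) (\<lambda>s2. tot B W s2 (d * (T + 2) + 1) Q)"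
    proof (rule tot_weaken)
      fix s2 assume "Inv (Suc j) s2 \<and> s2 i 0 = Suc j \<and>
        (\<forall>a. a \<noteq> i \<longrightarrow> a \<notin> writes c \<longrightarrow> s2 a = s a)"
      then show "tot B W s2 (d * (T + 2) + 1) Q"
        using Suc.prems(1) by (intro Suc.IH[of "Suc j"]) auto
    qed simp
    show ?case unfolding tot_def
    proof
      assume B: "bits_at_most B s'"
      obtain t s2 where 1: "exec body s' t s2" "t \<le> (T + 1) * unit_cost B" "bits_at_most B s2"
        "tot B W s2 (d * (T + 2) + 1) Q"
        using body B unfolding tot_def by blast
      then obtain t' s3 where 2: "exec W s2 t' s3" "t' \<le> (d * (T + 2) + 1) * unit_cost B" "bits_at_most B s3" "Q s3"
        unfolding tot_def by blast
      have "exec W s' (acost (Minus h (Var i)) s' + t + t' + 1) s3"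
        unfolding W_def using WhileTrue[OF nz 1(1)] 2(1) unfolding W_def by blast
      moreover have "acost (Minus h (Var i)) s' + 1 \<le> unit_cost B"
        using k by (intro test_cost_le B) simp
      then have "acost (Minus h (Var i)) s' + t + t' + 1
        \<le> unit_cost B + (T + 1) * unit_cost B + (d * (T + 2) + 1) * unit_cost B"
        using 1(2) 2(2) by linarith
      then have "acost (Minus h (Var i)) s' + t + t' + 1 \<le> (Suc d * (T + 2) + 1) * unit_cost B"
        by (simp add: algebra_simps)
      ultimately show "\<exists>t s''. exec W s' t s'' \<and> t \<le> (Suc d * (T + 2) + 1) * unit_cost B \<and> bits_at_most B s'' \<and> Q s''"
        using 2 by blast
    qed
  qed
  have "tot B (For i h c) s (1 + (H * (T + 2) + 1)) Q"
    unfolding For_def body_def[symmetric] W_def[symmetric]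
  proof (rule tot_Seq, rule tot_Assign)
    show "tot B W (s(i := (s i)(aval (Num 0) s := aval (Num 0) s))) (H * (T + 2) + 1) Q"
      by (rule loop[of 0 H]) (simp_all add: indep init)
  qed simp_all
  then show ?thesis by simp
qed

section \<open>The program\<close>

abbreviation mat :: "aexp \<Rightarrow> aexp \<Rightarrow> aexp" where
  "mat e f \<equiv> Plus (Times e (Var ''N'')) f"

text \<open>Row \<open>u\<close> of the weight matrix starts at cell \<open>u * N\<close> of \<open>w\<close>, where \<open>N = n + 1\<close>. Vertex 0 does not
  exist and is marked dead (\<open>d[0] = 1\<close>) from the start. Merged vertices are dead too; \<open>a\<close> marks the
  vertices that are dead or already in the ordering, \<open>k\<close> holds the weight between a vertex and the
  ordering, \<open>l\<close> the last vertex of the ordering, and \<open>b\<close> one more than the largest key seen, so that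
  0 means none.\<close>

definition pick_step :: com where
  "pick_step = Cond (Arr ''a'' (Var ''i'')) Skip
     (Cond (Minus (Plus (Arr ''k'' (Var ''i'')) (Num 1)) (Var ''b''))
       (Seq (Set_var ''u'' (Var ''i'')) (Set_var ''b'' (Plus (Arr ''k'' (Var ''i'')) (Num 1))))
       Skip)"

definition pick :: com where
  "pick = Seq (Set_var ''u'' (Num 0)) (Seq (Set_var ''b'' (Num 0)) (For ''i'' (Var ''N'') pick_step))"

definition absorb_step :: com where
  "absorb_step = Assign ''k'' (Var ''i'')
     (Plus (Arr ''k'' (Var ''i'')) (Arr ''w'' (mat (Var ''u'') (Var ''i''))))"

definition absorb :: com where
  "absorb = Seq (Assign ''a'' (Var ''u'') (Num 1)) (Seq (Set_var ''l'' (Var ''u''))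
     (For ''i'' (Var ''N'') absorb_step))"

text \<open>The inner guard \<open>(i - l) + (l - i)\<close> tests i \<noteq> l. The vertex
  \<open>u\<close> to be merged is already dead at this point and hence skipped. The second
  assignment copies the cell just written, which keeps the matrix symmetric there.\<close>

definition merge_step :: com where
  "merge_step = Cond (Arr ''d'' (Var ''i'')) Skip
     (Cond (Plus (Minus (Var ''i'') (Var ''l'')) (Minus (Var ''l'') (Var ''i'')))
       (Seq
         (Assign ''w'' (mat (Var ''l'') (Var ''i''))
           (Plus (Arr ''w'' (mat (Var ''l'') (Var ''i''))) (Arr ''w'' (mat (Var ''u'') (Var ''i'')))))
         (Assign ''w'' (mat (Var ''i'') (Var ''l'')) (Arr ''w'' (mat (Var ''l'') (Var ''i'')))))
       Skip)"

definition reset_step :: com where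
  "reset_step = Seq (Assign ''a'' (Var ''i'') (Arr ''d'' (Var ''i''))) (Assign ''k'' (Var ''i'') (Num 0))"

text \<open>Of the \<open>n - p\<close> live vertices all but one are picked and absorbed. The last
  one is picked only: \<open>k\<close> then holds its weight to all others, the cut to be recorded
  in \<open>c\<close>, and \<open>l\<close> still names its predecessor, into which it is
  merged.\<close>

definition phase :: com where
  "phase = Seq (For ''i'' (Var ''N'') reset_step)
     (Seq (Set_var ''l'' (Num 0))
     (Seq (For ''q'' (Minus (Minus (Var ''n'') (Num 1)) (Var ''p'')) (Seq pick absorb))
     (Seq pick
     (Seq (Cond (Minus (Var ''c'') (Arr ''k'' (Var ''u''))) (Set_var ''c'' (Arr ''k'' (Var ''u''))) Skip)
     (Seq (Assign ''d'' (Var ''u'') (Num 1))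
     (For ''i'' (Var ''N'') merge_step))))))"

lemma writes_steps [simp]:
  "writes pick_step = {''u'', ''b''}"
  "writes absorb_step = {''k''}"
  "writes merge_step = {''w''}"
  "writes reset_step = {''a'', ''k''}"
  by (auto simp: pick_step_def absorb_step_def merge_step_def reset_step_def)

lemma writes_pick [simp]: "writes pick = {''u'', ''b'', ''i''}"
  by (auto simp: pick_def writes_For)

lemma writes_absorb [simp]: "writes absorb = {''a'', ''l'', ''k'', ''i''}"
  by (auto simp: absorb_def writes_For)

section \<open>Correctness and running time of one Stoer-Wagner phase\<close>

lemma mat_index_eq_iff:
  fixes u v x y N :: nat
  assumes "v < N" "y < N"
  shows "u * N + v = x * N + y \<longleftrightarrow> u = x \<and> v = y"
proof
  assume eq: "u * N + v = x * N + y"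
  have "u = (u * N + v) div N" "x = (x * N + y) div N" using assms by auto
  with eq show "u = x \<and> v = y" by auto
qed simp

lemma tot_pick_loop:
  assumes N: "s ''N'' 0 = N" "N < 2 ^ B"
    and k: "\<And>i. i < N \<Longrightarrow> Suc (s ''k'' i) < 2 ^ B"
    and b: "s ''b'' 0 = 0"
  shows "tot B (For ''i'' (Var ''N'') pick_step) s (8 * N + 2)
    (\<lambda>s'. (\<forall>i<N. s ''a'' i = 0 \<longrightarrow> Suc (s ''k'' i) \<le> s' ''b'' 0) \<and>
    (s' ''b'' 0 \<noteq> 0 \<longrightarrow> s' ''u'' 0 < N \<and> s ''a'' (s' ''u'' 0) = 0 \<and>
      s' ''b'' 0 = Suc (s ''k'' (s' ''u'' 0))))"
proof -
  define Inv where "Inv j s' \<longleftrightarrow> (\<forall>i<j. s ''a'' i = 0 \<longrightarrow> Suc (s ''k'' i) \<le> s' ''b'' 0) \<and>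
    (s' ''b'' 0 \<noteq> 0 \<longrightarrow> s' ''u'' 0 < N \<and> s ''a'' (s' ''u'' 0) = 0 \<and>
      s' ''b'' 0 = Suc (s ''k'' (s' ''u'' 0)))" for j and s' :: mem
  have "tot B (For ''i'' (Var ''N'') pick_step) s (N * ((1 + (1 + 1 + 1 + 1) + 1) + 2) + 2) (Inv N)"
  proof (rule tot_For[where Inv = Inv])
    fix j and s' :: mem
    assume j: "j < N" "s' ''i'' 0 = j" and inv: "Inv j s'"
    assume "\<And>x. x \<noteq> ''i'' \<Longrightarrow> x \<notin> writes pick_step \<Longrightarrow> s' x = s x"
    then have fr: "s' ''a'' = s ''a''" "s' ''k'' = s ''k''" by simp_all
    show "tot B pick_step s' (1 + (1 + 1 + 1 + 1) + 1) (Inv (Suc j))"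
      unfolding pick_step_def using j inv fr k[of j] N
      by (intro tot_Cond tot_Skip tot_Seq tot_Assign) (auto simp: Inv_def less_Suc_eq)
  qed (use N b in \<open>auto simp: Inv_def\<close>)
  then show ?thesis by (rule tot_weaken) (auto simp: Inv_def)
qed

lemma tot_pick:
  assumes N: "s ''N'' 0 = N" "N < 2 ^ B"
    and k: "\<And>i. i < N \<Longrightarrow> Suc (s ''k'' i) < 2 ^ B"
    and ex: "\<exists>i<N. s ''a'' i = 0"
  shows "tot B pick s (8 * N + 4) (\<lambda>s'. s' ''u'' 0 < N \<and> s ''a'' (s' ''u'' 0) = 0 \<and>
    (\<forall>i<N. s ''a'' i = 0 \<longrightarrow> s ''k'' i \<le> s ''k'' (s' ''u'' 0)))" (is "tot _ _ _ _ ?Q")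
proof -
  have loop: "tot B (For ''i'' (Var ''N'') pick_step) s' (8 * N + 2) ?Q"
    if "s' ''b'' 0 = 0" "\<And>x. x \<noteq> ''u'' \<Longrightarrow> x \<noteq> ''b'' \<Longrightarrow> s' x = s x" for s'
    using tot_pick_loop[of s' N B] that N k ex by (force elim: tot_weaken)
  have "tot B pick s (1 + (1 + (8 * N + 2))) ?Q"
    unfolding pick_def
    by (intro tot_Seq tot_Assign loop) simp_all
  then show ?thesis by (rule tot_time) simp
qed

lemma tot_absorb:
  assumes N: "s ''N'' 0 = N" "N < 2 ^ B" and u: "s ''u'' 0 < N"
    and k: "\<And>i. i < N \<Longrightarrow> s ''k'' i + s ''w'' (s ''u'' 0 * N + i) < 2 ^ B"
  shows "tot B absorb s (3 * N + 4) (\<lambda>s'. s' ''a'' = (s ''a'')(s ''u'' 0 := 1) \<and>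
    s' ''l'' 0 = s ''u'' 0 \<and>
    (\<forall>i<N. s' ''k'' i = s ''k'' i + s ''w'' (s ''u'' 0 * N + i)))"
proof -
  define Inv where "Inv j s' \<longleftrightarrow> s' ''a'' = (s ''a'')(s ''u'' 0 := 1) \<and> s' ''l'' 0 = s ''u'' 0 \<and>
    (\<forall>i<N. s' ''k'' i = s ''k'' i + (if i < j then s ''w'' (s ''u'' 0 * N + i) else 0))"
    for j and s' :: mem
  have loop: "tot B (For ''i'' (Var ''N'') absorb_step) s' (N * (1 + 2) + 2) (Inv N)"
    if init: "Inv 0 s'" "\<And>x. x \<noteq> ''a'' \<Longrightarrow> x \<noteq> ''l'' \<Longrightarrow> s' x = s x" for s'
  proof (rule tot_For[where Inv = Inv])
    fix j and s2 :: mem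
    assume j: "j < N" "s2 ''i'' 0 = j" and inv: "Inv j s2"
    assume "\<And>x. x \<noteq> ''i'' \<Longrightarrow> x \<notin> writes absorb_step \<Longrightarrow> s2 x = s' x"
    then have fr: "s2 ''N'' = s ''N''" "s2 ''u'' = s ''u''" "s2 ''w'' = s ''w''"
      using init(2) by simp_all
    have kj: "s2 ''k'' j = s ''k'' j" using inv j by (simp add: Inv_def)
    show "tot B absorb_step s2 1 (Inv (Suc j))"
      unfolding absorb_step_def using j inv fr k[of j] N kj
      by (intro tot_Assign) (auto simp: Inv_def less_Suc_eq)
  qed (use N init in \<open>auto simp: Inv_def\<close>)
  have "tot B absorb s (1 + (1 + (N * (1 + 2) + 2))) (Inv N)"
    unfolding absorb_def using u N by (intro tot_Seq tot_Assign loop) (auto simp: Inv_def)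
  then show ?thesis by (rule tot_weaken) (auto simp: Inv_def)
qed

text \<open>A written entry is a sum of two old ones, so a contraction at most doubles the largest
  cell. This holds for junk cells too and controls the bit length over all phases.\<close>

lemma tot_merge_loop:
  assumes N: "s ''N'' 0 = N" "N < 2 ^ B" and ul: "s ''u'' 0 = u" "s ''l'' 0 = l" "u < N" "l < N" "u \<noteq> l"
    and w: "\<And>i. s ''w'' i \<le> X" "2 * X < 2 ^ B"
  shows "tot B (For ''i'' (Var ''N'') merge_step) s (8 * N + 2) (\<lambda>s'. (\<forall>i. s' ''w'' i \<le> 2 * X) \<and>
    (\<forall>x<N. \<forall>y<N. s' ''w'' (x * N + y) =
      (if x = l \<and> y \<noteq> l \<and> s ''d'' y = 0 then s ''w'' (l * N + y) + s ''w'' (u * N + y)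
       else if y = l \<and> x \<noteq> l \<and> s ''d'' x = 0 then s ''w'' (l * N + x) + s ''w'' (u * N + x)
       else s ''w'' (x * N + y))))"
proof -
  define Inv where "Inv j s' \<longleftrightarrow> (\<forall>i. s' ''w'' i \<le> 2 * X) \<and>
    (\<forall>x<N. \<forall>y<N. s' ''w'' (x * N + y) =
      (if x = l \<and> y \<noteq> l \<and> s ''d'' y = 0 \<and> y < j then s ''w'' (l * N + y) + s ''w'' (u * N + y)
       else if y = l \<and> x \<noteq> l \<and> s ''d'' x = 0 \<and> x < j then s ''w'' (l * N + x) + s ''w'' (u * N + x)
       else s ''w'' (x * N + y)))" for j and s' :: mem
  have w2: "s ''w'' i \<le> 2 * X" for i using w(1)[of i] by simp
  have "tot B (For ''i'' (Var ''N'') merge_step) s (N * ((1 + ((1 + 1) + 1 + 1) + 1) + 2) + 2) (Inv N)"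
  proof (rule tot_For[where Inv = Inv])
    fix j and s' :: mem
    assume j: "j < N" "s' ''i'' 0 = j" and inv: "Inv j s'"
    assume "\<And>x. x \<noteq> ''i'' \<Longrightarrow> x \<notin> writes merge_step \<Longrightarrow> s' x = s x"
    then have fr: "s' ''N'' = s ''N''" "s' ''u'' = s ''u''" "s' ''l'' = s ''l''" "s' ''d'' = s ''d''"
      by simp_all
    show "tot B merge_step s' (1 + ((1 + 1) + 1 + 1) + 1) (Inv (Suc j))"
    proof (cases "s ''d'' j = 0 \<and> j \<noteq> l")
      case False
      then have "Inv (Suc j) s'" using inv by (auto simp: Inv_def less_Suc_eq)
      then show ?thesis
        unfolding merge_step_def using False j fr ul
        by (intro tot_Cond tot_Skip tot_Seq tot_Assign) auto
    next
      case True
      \<comment> \<open>Earlier rounds wrote only in row and column \<open>l\<close>, at indices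
        below \<open>j\<close>, so both cells read now are still original.\<close>
      have lj: "s' ''w'' (l * N + j) = s ''w'' (l * N + j)" "s' ''w'' (u * N + j) = s ''w'' (u * N + j)"
        using inv j True ul by (auto simp: Inv_def)
      define z where "z = s ''w'' (l * N + j) + s ''w'' (u * N + j)"
      have z: "z \<le> 2 * X" "z < 2 ^ B"
        using w(1)[of "l * N + j"] w(1)[of "u * N + j"] w(2) by (auto simp: z_def)
      have post: "Inv (Suc j) (s'(''w'' := (s' ''w'')(l * N + j := z, j * N + l := z)))"
        unfolding Inv_def
      proof (intro conjI allI impI)
        fix i show "(s'(''w'' := (s' ''w'')(l * N + j := z, j * N + l := z))) ''w'' i \<le> 2 * X"
          using inv z by (simp add: Inv_def)
      next
        fix x y assume "x < N" "y < N"
        then show "(s'(''w'' := (s' ''w'')(l * N + j := z, j * N + l := z))) ''w'' (x * N + y) =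
          (if x = l \<and> y \<noteq> l \<and> s ''d'' y = 0 \<and> y < Suc j then s ''w'' (l * N + y) + s ''w'' (u * N + y)
           else if y = l \<and> x \<noteq> l \<and> s ''d'' x = 0 \<and> x < Suc j then s ''w'' (l * N + x) + s ''w'' (u * N + x)
           else s ''w'' (x * N + y))"
          using inv j True ul by (auto simp: Inv_def mat_index_eq_iff z_def less_Suc_eq)
      qed
      show ?thesis
        unfolding merge_step_def using True j fr ul lj z post N
        by (intro tot_Cond tot_Skip tot_Seq tot_Assign) (auto simp flip: z_def)
    qed
  qed (use N w2 in \<open>auto simp: Inv_def\<close>)
  then show ?thesis by (rule tot_weaken) (auto simp: Inv_def)
qed

lemma tot_reset_loop:
  assumes N: "s ''N'' 0 = N" "N < 2 ^ B"
  shows "tot B (For ''i'' (Var ''N'') reset_step) s (4 * N + 2)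
    (\<lambda>s'. \<forall>i<N. s' ''a'' i = s ''d'' i \<and> s' ''k'' i = 0)"
proof (rule tot_bounded)
  assume B: "bits_at_most B s"
  define Inv where "Inv j s' \<longleftrightarrow> (\<forall>i<j. s' ''a'' i = s ''d'' i \<and> s' ''k'' i = 0)" for j and s' :: mem
  have "tot B (For ''i'' (Var ''N'') reset_step) s (N * ((1 + 1) + 2) + 2) (Inv N)"
  proof (rule tot_For[where Inv = Inv])
    fix j and s' :: mem
    assume j: "j < N" "s' ''i'' 0 = j" and inv: "Inv j s'"
    assume "\<And>x. x \<noteq> ''i'' \<Longrightarrow> x \<notin> writes reset_step \<Longrightarrow> s' x = s x"
    then have fr: "s' ''d'' = s ''d''" by simp
    show "tot B reset_step s' (1 + 1) (Inv (Suc j))"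
      unfolding reset_step_def using j inv fr B
      by (intro tot_Seq tot_Assign) (auto simp: Inv_def less_Suc_eq bits_at_most_def)
  qed (use N in \<open>auto simp: Inv_def\<close>)
  then show ?thesis by (rule tot_weaken) (auto simp: Inv_def)
qed

text \<open>\<open>A\<close> is the ghost set of ordered vertices. The formula for \<open>k\<close>
  is stated in terms of matrix cells at all indices, because \<open>absorb\<close> adds a whole row;
  only at vertices of \<open>V - A\<close>, where no diagonal cell enters, is it the weight under
  \<open>W\<close> that the ordering compares.\<close>

lemma tot_order:
  assumes N: "s ''N'' 0 = N" "N < 2 ^ B" and H: "H = s ''n'' 0 - 1 - s ''p'' 0" "H < 2 ^ B"
    and V: "V \<subseteq> {..<N}" "card V = Suc H" and sym: "symmetric_weights W"
    and a: "\<And>i. i < N \<Longrightarrow> s ''a'' i = 0 \<longleftrightarrow> i \<in> V" and k: "\<And>i. i < N \<Longrightarrow> s ''k'' i = 0"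
    and W: "\<And>u v. u \<in> V \<Longrightarrow> v \<in> V \<Longrightarrow> u \<noteq> v \<Longrightarrow> s ''w'' (u * N + v) = W u v"
    and X: "\<And>i. s ''w'' i \<le> X" "N * X + 1 < 2 ^ B"
  shows "tot B (For ''q'' (Minus (Minus (Var ''n'') (Num 1)) (Var ''p'')) (Seq pick absorb)) s
    (H * (11 * N + 10) + 2)
    (\<lambda>s'. \<exists>A. A \<subseteq> V \<and> card A = H \<and> (\<forall>i<N. s' ''a'' i = 0 \<longleftrightarrow> i \<in> V - A) \<and>
      (\<forall>i<N. s' ''k'' i = (\<Sum>x\<in>A. s ''w'' (x * N + i))) \<and>
      ma_prefix W V A (s' ''l'' 0) \<and> (H > 0 \<longrightarrow> s' ''l'' 0 \<in> A))"
proof -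
  define Inv where "Inv q s' \<longleftrightarrow> (\<exists>A. A \<subseteq> V \<and> card A = q \<and>
      (\<forall>i<N. s' ''a'' i = 0 \<longleftrightarrow> i \<in> V - A) \<and>
      (\<forall>i<N. s' ''k'' i = (\<Sum>x\<in>A. s ''w'' (x * N + i))) \<and>
      ma_prefix W V A (s' ''l'' 0) \<and> (q > 0 \<longrightarrow> s' ''l'' 0 \<in> A))" for q and s' :: mem
  have finV: "finite V" using V(1) finite_subset by blast
  have key_le: "(\<Sum>x\<in>A. s ''w'' (x * N + i)) \<le> N * X" if "A \<subseteq> V" for A i
  proof -
    have "(\<Sum>x\<in>A. s ''w'' (x * N + i)) \<le> (\<Sum>x\<in>A. X)" by (intro sum_mono X)
    also have "\<dots> = card A * X" by simp
    also have "card A \<le> card {..<N}" using that V(1) by (intro card_mono) auto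
    then have "card A * X \<le> N * X" by simp
    finally show ?thesis .
  qed
  have "tot B (For ''q'' (Minus (Minus (Var ''n'') (Num 1)) (Var ''p'')) (Seq pick absorb)) s
    (H * (((8 * N + 4) + (3 * N + 4)) + 2) + 2) (Inv H)"
  proof (rule tot_For[where Inv = Inv])
    fix q and s1 :: mem
    assume q: "q < H" and inv: "Inv q s1"
    assume "\<And>x. x \<noteq> ''q'' \<Longrightarrow> x \<notin> writes (Seq pick absorb) \<Longrightarrow> s1 x = s x"
    then have fr: "s1 ''N'' = s ''N''" "s1 ''w'' = s ''w''" by simp_all
    obtain A where A: "A \<subseteq> V" "card A = q" "\<forall>i<N. s1 ''a'' i = 0 \<longleftrightarrow> i \<in> V - A"
      "\<forall>i<N. s1 ''k'' i = (\<Sum>x\<in>A. s ''w'' (x * N + i))" "ma_prefix W V A (s1 ''l'' 0)"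
      using inv unfolding Inv_def by blast
    have finA: "finite A" using A(1) finV finite_subset by blast
    have "A \<noteq> V" using A(2) V(2) q by auto
    then obtain v0 where "v0 \<in> V - A" using A(1) by blast
    then have ex: "\<exists>i<N. s1 ''a'' i = 0" using A(3) V(1) by blast
    have key_bound: "Suc (s1 ''k'' i) < 2 ^ B" if "i < N" for i
      using A(4) key_le[OF A(1), of i] X(2) that by simp
    show "tot B (Seq pick absorb) s1 ((8 * N + 4) + (3 * N + 4)) (Inv (Suc q))"
    proof (rule tot_Seq, rule tot_weaken[OF tot_pick[OF _ N(2) key_bound ex] _ order_refl])
      fix s2 :: mem assume s2: "s2 ''u'' 0 < N \<and> s1 ''a'' (s2 ''u'' 0) = 0 \<and>
        (\<forall>i<N. s1 ''a'' i = 0 \<longrightarrow> s1 ''k'' i \<le> s1 ''k'' (s2 ''u'' 0))"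
      assume "\<And>x. x \<notin> writes pick \<Longrightarrow> s2 x = s1 x"
      then have fr2: "s2 ''N'' = s ''N''" "s2 ''w'' = s ''w''" "s2 ''a'' = s1 ''a''"
        "s2 ''k'' = s1 ''k''" "s2 ''l'' = s1 ''l''" using fr by simp_all
      define u where "u = s2 ''u'' 0"
      have u: "u < N" "u \<in> V - A" using s2 A(3) by (auto simp: u_def)
      have key_W: "s1 ''k'' x = (\<Sum>a\<in>A. W a x)" if "x \<in> V - A" for x
      proof -
        have "x < N" using that V(1) by auto
        then have "s1 ''k'' x = (\<Sum>y\<in>A. s ''w'' (y * N + x))" using A(4) by blast
        also have "\<dots> = (\<Sum>a\<in>A. W a x)"
          using that A(1) by (intro sum.cong refl W) auto
        finally show ?thesis .
      qed
      have max: "(\<Sum>a\<in>A. W a x) \<le> (\<Sum>a\<in>A. W a u)" if x: "x \<in> V - A" for x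
      proof -
        have "x < N" "s1 ''a'' x = 0" using x V(1) A(3) by auto
        then have "s1 ''k'' x \<le> s1 ''k'' u" using s2 by (simp add: u_def)
        then show ?thesis using key_W x u(2) by simp
      qed
      have keys: "s2 ''k'' i + s2 ''w'' (s2 ''u'' 0 * N + i) = (\<Sum>x\<in>insert u A. s ''w'' (x * N + i))"
        if "i < N" for i
        using that A(4) u finA by (simp add: fr2 u_def)
      have keys_bound: "s2 ''k'' i + s2 ''w'' (s2 ''u'' 0 * N + i) < 2 ^ B" if "i < N" for i
        using keys[OF that] key_le[of "insert u A" i] A(1) u X(2) by simp
      show "tot B absorb s2 (3 * N + 4) (Inv (Suc q))"
      proof (rule tot_weaken[OF tot_absorb[OF _ N(2) _ keys_bound] _ order_refl])
        fix s3 :: mem assume "s3 ''a'' = (s2 ''a'')(s2 ''u'' 0 := 1) \<and> s3 ''l'' 0 = s2 ''u'' 0 \<and>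
          (\<forall>i<N. s3 ''k'' i = s2 ''k'' i + s2 ''w'' (s2 ''u'' 0 * N + i))"
        then have s3: "s3 ''a'' = (s1 ''a'')(u := 1)" "s3 ''l'' 0 = u"
          "\<forall>i<N. s3 ''k'' i = (\<Sum>x\<in>insert u A. s ''w'' (x * N + i))"
          using keys by (simp_all add: fr2 u_def)
        show "Inv (Suc q) s3"
          unfolding Inv_def
        proof (intro exI[of _ "insert u A"] conjI)
          show "ma_prefix W V (insert u A) (s3 ''l'' 0)"
            unfolding s3(2) by (rule ma_prefix_insert[OF finA sym u(2) max A(5)])
          show "\<forall>i<N. (s3 ''a'' i = 0) = (i \<in> V - insert u A)"
            using A(3) by (auto simp: s3(1))
        qed (use A u s3 finA in auto)
      qed (use N fr2 s2 in auto)
    qed (use N fr in auto)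
  next
    show "Inv 0 s"
      unfolding Inv_def using a k by (intro exI[of _ "{}"]) (auto simp: ma_prefix_empty)
  qed (use N H in \<open>auto simp: Inv_def\<close>)
  then show ?thesis by (rule tot_weaken) (auto simp: Inv_def)
qed

text \<open>\<open>W\<close> is the weight function of the contracted graph; the entries of the matrix on the diagonal
  and at dead vertices are junk and only bounded.\<close>
definition phase_inv :: "nat \<Rightarrow> nat \<Rightarrow> nat \<Rightarrow> nat \<Rightarrow> mem \<Rightarrow> bool" where
  "phase_inv n M C p s \<longleftrightarrow> (\<exists>V W. V \<subseteq> {1..n} \<and> card V = n - p \<and>
     (\<forall>i<Suc n. s ''d'' i = 0 \<longleftrightarrow> i \<in> V) \<and> symmetric_weights W \<and>
     (\<forall>u\<in>V. \<forall>v\<in>V. u \<noteq> v \<longrightarrow> s ''w'' (u * Suc n + v) = W u v) \<and>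
     mincut W V (s ''c'' 0) = C \<and> (\<forall>i. s ''w'' i \<le> 2 ^ p * (2 * M)) \<and> s ''c'' 0 \<le> M)"

text \<open>The variable \<open>c\<close> is the cap: recording the last vertex's degree and
  contracting that vertex leaves the capped minimum \<open>C\<close> unchanged by
  \<open>mincut_merge\<close>. As \<open>p < n - 1\<close>, at least one vertex is absorbed, so
  \<open>l\<close> is a genuine predecessor.\<close>

lemma tot_phase:
  assumes n: "s ''n'' 0 = n" "s ''N'' 0 = Suc n" "s ''p'' 0 = p" "p < n - 1"
    and B: "Suc n * (2 ^ n * (2 * M)) + n + M + 2 < 2 ^ B"
    and inv: "phase_inv n M C p s"
  shows "tot B phase s (61 * Suc n ^ 2) (phase_inv n M C (Suc p))"
proof -
  define N where "N = Suc n"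
  define H where "H = n - 1 - p"
  define X where "X = 2 ^ p * (2 * M)"
  obtain V W where V: "V \<subseteq> {1..n}" "card V = n - p"
    and d: "\<forall>i<N. s ''d'' i = 0 \<longleftrightarrow> i \<in> V" and sym: "symmetric_weights W"
    and W: "\<forall>u\<in>V. \<forall>v\<in>V. u \<noteq> v \<longrightarrow> s ''w'' (u * N + v) = W u v"
    and C: "mincut W V (s ''c'' 0) = C" and X: "\<forall>i. s ''w'' i \<le> X" and c: "s ''c'' 0 \<le> M"
    using inv unfolding phase_inv_def N_def X_def by blast
  have finV: "finite V" using V(1) finite_subset by blast
  have VN: "V \<subseteq> {..<N}" using V(1) by (auto simp: N_def)
  have cardV: "card V = Suc H" "H > 0" using V(2) n(4) by (auto simp: H_def)
  \<comment> \<open>There are at most n - 1 contractions, each doubling the entries, so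
    \<open>2 ^ n * (2 * M)\<close> bounds the matrix throughout.\<close>
  have "2 * X = 2 ^ Suc p * (2 * M)" by (simp add: X_def)
  also have "\<dots> \<le> 2 ^ n * (2 * M)" using n(4) by (intro mult_right_mono power_increasing) auto
  finally have X2: "2 * X \<le> 2 ^ n * (2 * M)" .
  also have "\<dots> \<le> Suc n * (2 ^ n * (2 * M))" by simp
  finally have XB: "2 * X < 2 ^ B" using B by simp
  have "N * X \<le> N * (2 ^ n * (2 * M))" using X2 by (intro mult_left_mono) auto
  then have NXB: "N * X + 1 < 2 ^ B" using B by (simp add: N_def)
  have NB: "N < 2 ^ B" "H < 2 ^ B" using B by (auto simp: N_def H_def)
  have main: "tot B phase s ((4 * N + 2) + (1 + ((H * (11 * N + 10) + 2) + ((8 * N + 4) +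
      ((1 + 1 + 1) + (1 + (8 * N + 2))))))) (phase_inv n M C (Suc p))"
    unfolding phase_def
  proof (rule tot_Seq, rule tot_weaken[OF tot_reset_loop[OF _ NB(1)] _ order_refl],
      simp add: n N_def, rule tot_Seq, rule tot_Assign, simp, simp, rule tot_Seq)
    fix s0 :: mem assume "\<forall>i<N. s0 ''a'' i = s ''d'' i \<and> s0 ''k'' i = 0"
      and "\<And>x. x \<notin> writes (For ''i'' (Var ''N'') reset_step) \<Longrightarrow> s0 x = s x"
    then have fr0: "\<And>i. i < N \<Longrightarrow> s0 ''a'' i = s ''d'' i" "\<And>i. i < N \<Longrightarrow> s0 ''k'' i = 0"
      "\<And>x. x \<notin> {''i'', ''a'', ''k''} \<Longrightarrow> s0 x = s x" by (auto simp: writes_For)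
    let ?s1 = "s0(''l'' := (s0 ''l'')(aval (Num 0) s0 := aval (Num 0) s0))"
    show "tot B (For ''q'' (Minus (Minus (Var ''n'') (Num 1)) (Var ''p'')) (Seq pick absorb)) ?s1
      (H * (11 * N + 10) + 2) (\<lambda>s'. tot B (Seq pick
        (Seq (Cond (Minus (Var ''c'') (Arr ''k'' (Var ''u''))) (Set_var ''c'' (Arr ''k'' (Var ''u''))) Skip)
        (Seq (Assign ''d'' (Var ''u'') (Num 1)) (For ''i'' (Var ''N'') merge_step)))) s'
        ((8 * N + 4) + ((1 + 1 + 1) + (1 + (8 * N + 2)))) (phase_inv n M C (Suc p)))"
    proof (rule tot_weaken[OF tot_order[where N = N and V = V and W = W and X = X] _ order_refl])
      fix s2 :: mem
      assume "\<exists>A. A \<subseteq> V \<and> card A = H \<and> (\<forall>i<N. s2 ''a'' i = 0 \<longleftrightarrow> i \<in> V - A) \<and>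
        (\<forall>i<N. s2 ''k'' i = (\<Sum>x\<in>A. ?s1 ''w'' (x * N + i))) \<and>
        ma_prefix W V A (s2 ''l'' 0) \<and> (H > 0 \<longrightarrow> s2 ''l'' 0 \<in> A)"
      then obtain A where A: "A \<subseteq> V" "card A = H" "\<forall>i<N. s2 ''a'' i = 0 \<longleftrightarrow> i \<in> V - A"
        "\<forall>i<N. s2 ''k'' i = (\<Sum>x\<in>A. s ''w'' (x * N + i))"
        "ma_prefix W V A (s2 ''l'' 0)" "s2 ''l'' 0 \<in> A"
        using cardV(2) by (auto simp: fr0)
      assume "\<And>x. x \<notin> writes (For ''q'' (Minus (Minus (Var ''n'') (Num 1)) (Var ''p'')) (Seq pick absorb)) \<Longrightarrow> s2 x = ?s1 x"
      then have "s2 x = s x" if "x \<notin> {''q'', ''u'', ''b'', ''i'', ''a'', ''l'', ''k''}" for x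
        using that fr0(3)[of x] by (simp add: writes_For)
      then have fr2: "s2 ''n'' = s ''n''" "s2 ''N'' = s ''N''" "s2 ''w'' = s ''w''"
        "s2 ''d'' = s ''d''" "s2 ''c'' = s ''c''" by simp_all
      have finA: "finite A" using A(1) finV finite_subset by blast
      \<comment> \<open>One candidate is left, so the final pick is forced whatever the keys
        are.\<close>
      have "card (V - A) = 1" using A(1,2) cardV finA by (simp add: card_Diff_subset)
      then obtain t where t: "V - A = {t}" by (auto simp: card_1_singleton_iff)
      then have At: "A = V - {t}" "t \<in> V" "t < N" using A(1) VN by auto
      define l where "l = s2 ''l'' 0"
      have l: "l \<in> V" "l \<noteq> t" "l < N" using A(6) At VN by (auto simp: l_def)
      define deg where "deg = (\<Sum>a\<in>V - {t}. W a t)"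
      have "s2 ''k'' t = (\<Sum>x\<in>A. s ''w'' (x * N + t))" using A(4) At by simp
      also have "\<dots> = deg"
        unfolding deg_def At(1) using W At(2) by (intro sum.cong refl) auto
      finally have kt: "s2 ''k'' t = deg" .
      have key_bound: "Suc (s2 ''k'' i) < 2 ^ B" if "i < N" for i
      proof -
        have "s2 ''k'' i = (\<Sum>x\<in>A. s ''w'' (x * N + i))" using A(4) that by simp
        also have "\<dots> \<le> (\<Sum>x\<in>A. X)" using X by (intro sum_mono) simp
        also have "\<dots> = H * X" using A(2) by simp
        also have "\<dots> \<le> N * X" by (intro mult_right_mono) (auto simp: H_def N_def)
        finally show ?thesis using NXB by simp
      qed
      have degB: "deg < 2 ^ B" using key_bound[OF At(3)] kt by simp
      show "tot B (Seq pick
        (Seq (Cond (Minus (Var ''c'') (Arr ''k'' (Var ''u''))) (Set_var ''c'' (Arr ''k'' (Var ''u''))) Skip)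
        (Seq (Assign ''d'' (Var ''u'') (Num 1)) (For ''i'' (Var ''N'') merge_step)))) s2
        ((8 * N + 4) + ((1 + 1 + 1) + (1 + (8 * N + 2)))) (phase_inv n M C (Suc p))"
      proof (rule tot_Seq, rule tot_weaken[OF tot_pick[where N = N] _ order_refl])
        fix s3 :: mem assume u3: "s3 ''u'' 0 < N \<and> s2 ''a'' (s3 ''u'' 0) = 0 \<and>
          (\<forall>i<N. s2 ''a'' i = 0 \<longrightarrow> s2 ''k'' i \<le> s2 ''k'' (s3 ''u'' 0))"
        assume fr3: "\<And>x. x \<notin> writes pick \<Longrightarrow> s3 x = s2 x"
        have u: "s3 ''u'' 0 = t" using u3 A(3) t by auto
        let ?c = "min (s ''c'' 0) deg"
        have final: "tot B (Seq (Assign ''d'' (Var ''u'') (Num 1)) (For ''i'' (Var ''N'') merge_step)) s4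
          (1 + (8 * N + 2)) (phase_inv n M C (Suc p))"
          if s4: "s4 ''c'' 0 = ?c" "\<And>x. x \<noteq> ''c'' \<Longrightarrow> s4 x = s3 x" for s4
        proof (rule tot_Seq, rule tot_Assign, simp, use B in simp)
          let ?s5 = "s4(''d'' := (s4 ''d'')(aval (Var ''u'') s4 := aval (Num 1) s4))"
          have ut: "s4 ''u'' 0 = t" using s4(2)[of "''u''"] u by simp
          have fr5: "?s5 ''N'' = s ''N''" "?s5 ''u'' 0 = t" "?s5 ''l'' 0 = l" "?s5 ''w'' = s ''w''"
            "?s5 ''d'' = (s ''d'')(t := 1)" "?s5 ''c'' 0 = ?c"
            using s4 fr3 fr2 u l_def ut by (simp_all)
          show "tot B (For ''i'' (Var ''N'') merge_step) ?s5 (8 * N + 2) (phase_inv n M C (Suc p))"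
          proof (rule tot_weaken[OF tot_merge_loop[where u = t and l = l and X = X] _ order_refl])
            fix s6 :: mem
            assume s6: "(\<forall>i. s6 ''w'' i \<le> 2 * X) \<and> (\<forall>x<N. \<forall>y<N. s6 ''w'' (x * N + y) =
              (if x = l \<and> y \<noteq> l \<and> ?s5 ''d'' y = 0 then ?s5 ''w'' (l * N + y) + ?s5 ''w'' (t * N + y)
               else if y = l \<and> x \<noteq> l \<and> ?s5 ''d'' x = 0 then ?s5 ''w'' (l * N + x) + ?s5 ''w'' (t * N + x)
               else ?s5 ''w'' (x * N + y)))"
            assume fr6: "\<And>x. x \<notin> writes (For ''i'' (Var ''N'') merge_step) \<Longrightarrow> s6 x = ?s5 x"
            have d6: "s6 ''d'' = (s ''d'')(t := 1)" and c6: "s6 ''c'' 0 = ?c"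
              using fr6[of "''d''"] fr6[of "''c''"] fr5 by (simp_all only: writes_For) auto
            have w6: "s6 ''w'' (x * N + y) = merge l t W x y"
              if xy: "x \<in> V - {t}" "y \<in> V - {t}" "x \<noteq> y" for x y
            proof -
              have xN: "x < N" "y < N" using xy VN by auto
              have dx: "s ''d'' x = 0" "s ''d'' y = 0" using d xN xy by auto
              have "s6 ''w'' (x * N + y) =
                (if x = l then s ''w'' (l * N + y) + s ''w'' (t * N + y)
                 else if y = l then s ''w'' (l * N + x) + s ''w'' (t * N + x)
                 else s ''w'' (x * N + y))"
                using s6 xN xy dx unfolding fr5 by auto
              also have "\<dots> = (if x = l then W l y + W t y else if y = l then W l x + W t x else W x y)"
                using W xy l At(2) by auto
              also have "\<dots> = merge l t W x y"
                using symmetric_weightsD[OF sym, of l x] symmetric_weightsD[OF sym, of t x] by (simp add: merge_def)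
              finally show ?thesis .
            qed
            show "phase_inv n M C (Suc p) s6"
              unfolding phase_inv_def N_def[symmetric]
            proof (intro exI[of _ "V - {t}"] exI[of _ "merge l t W"] conjI)
              show "mincut (merge l t W) (V - {t}) (s6 ''c'' 0) = C"
                unfolding c6 deg_def C[symmetric]
                using mincut_merge[OF finV sym l(1) At(2) l(2)] A(5) At(1) by (simp add: l_def)
              show "\<forall>i<N. (s6 ''d'' i = 0) = (i \<in> V - {t})" using d by (auto simp: d6)
              show "symmetric_weights (merge l t W)" by (rule symmetric_weights_merge[OF sym])
              show "\<forall>i. s6 ''w'' i \<le> 2 ^ Suc p * (2 * M)" using s6 by (simp add: X_def mult_ac)
              show "card (V - {t}) = n - Suc p" using V(2) At(2) finV by simp
              show "s6 ''c'' 0 \<le> M" using c by (simp add: c6)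
            qed (use V w6 in auto)
          qed (use fr5 NB XB X n l At in \<open>simp_all add: N_def\<close>)
        qed
        have s3: "s3 ''c'' 0 = s ''c'' 0" "s3 ''k'' t = deg" using fr3 fr2 kt by simp_all
        show "tot B (Seq (Cond (Minus (Var ''c'') (Arr ''k'' (Var ''u'')))
            (Set_var ''c'' (Arr ''k'' (Var ''u''))) Skip)
          (Seq (Assign ''d'' (Var ''u'') (Num 1)) (For ''i'' (Var ''N'') merge_step))) s3
          ((1 + 1 + 1) + (1 + (8 * N + 2))) (phase_inv n M C (Suc p))"
          using s3 u degB by (intro tot_Seq tot_Cond tot_Assign tot_Skip final) (auto simp: min_def)
      qed (use fr2 n NB key_bound A(3) At t in \<open>auto simp: N_def\<close>)
    qed (use fr0 n NB d W VN X NXB cardV sym in \<open>auto simp: N_def H_def\<close>)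
  qed
  have "H * (11 * N + 10) \<le> N * (11 * N + 10)" by (intro mult_right_mono) (auto simp: H_def N_def)
  then have "(4 * N + 2) + (1 + ((H * (11 * N + 10) + 2) + ((8 * N + 4) +
      ((1 + 1 + 1) + (1 + (8 * N + 2)))))) \<le> N * (11 * N + 10) + 20 * N + 15" by simp
  \<comment> \<open>The coefficients add up to 11 + 10 + 20 + 15 = 56 and N \<ge> 1, so 61 leaves
    room.\<close>
  also have "\<dots> \<le> 61 * N ^ 2" by (simp add: N_def power2_eq_square algebra_simps)
  finally show ?thesis using main tot_time unfolding N_def by blast
qed

section \<open>Reading the graph, computing the budget and the final quotient\<close>

text \<open>For a loop both increments hit the same diagonal cell, in agreement with the double
  count in \<open>edge_weight\<close>.\<close>

definition edge_step :: com where
  "edge_step = Seq (Set_var ''x'' (Arr ''edges'' (Plus (Var ''e'') (Var ''e''))))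
     (Seq (Set_var ''y'' (Arr ''edges'' (Plus (Plus (Var ''e'') (Var ''e'')) (Num 1))))
     (Seq (Assign ''w'' (mat (Var ''x'') (Var ''y'')) (Plus (Arr ''w'' (mat (Var ''x'') (Var ''y''))) (Num 1)))
     (Assign ''w'' (mat (Var ''y'') (Var ''x'')) (Plus (Arr ''w'' (mat (Var ''y'') (Var ''x''))) (Num 1)))))"

definition min_cut_prog :: com where
  "min_cut_prog = Seq (Set_var ''N'' (Plus (Var ''n'') (Num 1)))
     (Seq (For ''e'' (Var ''m'') edge_step)
     (Seq (Set_var ''d'' (Num 1))
     (Seq (Set_var ''c'' (Var ''m''))
     (For ''p'' (Minus (Var ''n'') (Num 1)) phase))))"

text \<open>Horner's scheme over the \<open>N = n + 1\<close> digits 0 to n, integer part included,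
  yields \<lfloor>\<eta> 2^n\<rfloor> in \<open>E\<close>; repeated doubling yields 2^n in
  \<open>D\<close>.\<close>

definition budget_prog :: com where
  "budget_prog = Seq (Set_var ''E'' (Num 0))
     (Seq (For ''i'' (Var ''N'') (Set_var ''E'' (Plus (Plus (Var ''E'') (Var ''E'')) (Arr ''eta'' (Var ''i'')))))
     (Seq (Set_var ''D'' (Num 1))
     (Seq (For ''i'' (Var ''n'') (Set_var ''D'' (Plus (Var ''D'') (Var ''D''))))
     (Set_var ''L'' (Times (Num 2)
       (Quot (Times (Var ''m'') (Plus (Var ''E'') (Num 1))) (Var ''D'')))))))"

text \<open>The guard \<open>(2 * L + 1) - i * c\<close> is nonzero exactly when
  \<open>i * c \<le> 2 * L\<close>.\<close>

definition product_step :: com where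
  "product_step = Cond (Minus (Plus (Plus (Var ''L'') (Var ''L'')) (Num 1)) (Times (Var ''i'') (Var ''c'')))
     (Set_var ''P'' (Plus (Var ''P'') (Var ''P'')))
     (Seq (Set_var ''P'' (Times (Var ''P'') (Times (Plus (Var ''i'') (Num 1)) (Var ''c''))))
       (Set_var ''Q'' (Times (Var ''Q'')
         (Minus (Times (Plus (Var ''i'') (Num 1)) (Var ''c'')) (Plus (Var ''L'') (Var ''L''))))))"

definition output_prog :: com where
  "output_prog = Cond (Minus (Var ''c'') (Var ''L'')) (Set_var ''out'' (Num 2))
     (Seq (Set_var ''P'' (Num 1)) (Seq (Set_var ''Q'' (Num 1))
     (Seq (For ''i'' (Var ''n'') product_step)
     (Set_var ''out'' (Quot (Var ''P'') (Var ''Q''))))))"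

definition algorithm :: com where
  "algorithm = Seq min_cut_prog (Seq budget_prog output_prog)"

lemma writes_more_steps [simp]:
  "writes edge_step = {''x'', ''y'', ''w''}"
  "writes product_step = {''P'', ''Q''}"
  "writes phase = {''i'', ''a'', ''k'', ''l'', ''q'', ''u'', ''b'', ''c'', ''d'', ''w''}"
  "writes min_cut_prog = {''N'', ''e'', ''x'', ''y'', ''p'', ''i'', ''a'', ''k'', ''l'', ''q'', ''u'', ''b'', ''c'', ''d'', ''w''}"
  "writes budget_prog = {''i'', ''E'', ''D'', ''L''}"
  by (auto simp: edge_step_def product_step_def phase_def writes_For min_cut_prog_def budget_prog_def)

lemma concat_nth_pairs:
  assumes "\<forall>e\<in>set es. length e = 2" "j < length es" "r < 2"
  shows "2 * j + r < length (concat es)" "concat es ! (2 * j + r) = es ! j ! r"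
proof -
  have "2 * j + r < length (concat es) \<and> concat es ! (2 * j + r) = es ! j ! r"
    using assms
  proof (induction es arbitrary: j)
    case (Cons a es)
    then show ?case by (cases j) (auto simp: nth_append)
  qed simp
  then show "2 * j + r < length (concat es)" "concat es ! (2 * j + r) = es ! j ! r" by auto
qed

definition edges_mem :: "nat list list \<Rightarrow> nat \<Rightarrow> nat" where
  "edges_mem es = (\<lambda>j. if j < length (concat es) then concat es ! j else 0)"

lemma tot_build:
  assumes es: "hypergraph 2 n (mset es)"
    and s: "s ''N'' 0 = Suc n" "s ''m'' 0 = length es" "s ''edges'' = edges_mem es" "s ''w'' = (\<lambda>_. 0)"
    and B: "n < 2 ^ B" "2 * length es < 2 ^ B"
  shows "tot B (For ''e'' (Var ''m'') edge_step) s (6 * length es + 2)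
    (\<lambda>s'. (\<forall>u<Suc n. \<forall>v<Suc n. s' ''w'' (u * Suc n + v) = edge_weight (mset es) u v) \<and>
      (\<forall>i. s' ''w'' i \<le> 2 * length es))"
proof -
  define N where "N = Suc n"
  define Inv where "Inv j s' \<longleftrightarrow>
    (\<forall>u<N. \<forall>v<N. s' ''w'' (u * N + v) = edge_weight (mset (take j es)) u v) \<and> (\<forall>i. s' ''w'' i \<le> 2 * j)"
    for j and s' :: mem
  have len: "\<forall>e\<in>set es. length e = 2" and tup: "\<forall>e\<in>set es. e \<in> tuples 2 n"
    using es by (auto simp: hypergraph_def tuples_def)
  have "tot B (For ''e'' (Var ''m'') edge_step) s (length es * ((1 + (1 + (1 + 1))) + 2) + 2) (Inv (length es))"
  proof (rule tot_For[where Inv = Inv])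
    fix j and s' :: mem
    assume j: "j < length es" "s' ''e'' 0 = j" and inv: "Inv j s'"
    assume "\<And>x. x \<noteq> ''e'' \<Longrightarrow> x \<notin> writes edge_step \<Longrightarrow> s' x = s x"
    then have fr: "s' ''N'' = s ''N''" "s' ''edges'' = s ''edges''" by simp_all
    have "es ! j \<in> tuples 2 n" using tup j by simp
    then obtain x y where xy: "es ! j = [x, y]" "x \<in> {1..n}" "y \<in> {1..n}" by (rule tuples_2E)
    have ex: "edges_mem es (j + j) = x" "edges_mem es (Suc (j + j)) = y"
      using concat_nth_pairs[OF len j(1), of 0] concat_nth_pairs[OF len j(1), of 1] xy
      by (auto simp: edges_mem_def mult_2)
    have xyN: "x < N" "y < N" using xy by (auto simp: N_def)
    define w1 where "w1 = (s' ''w'')(x * N + y := Suc (s' ''w'' (x * N + y)))"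
    define w2 where "w2 = w1(y * N + x := Suc (w1 (y * N + x)))"
    have w0: "s' ''w'' i \<le> 2 * j" for i using inv by (simp add: Inv_def)
    have w1: "w1 i \<le> Suc (2 * j)" for i using w0[of i] w0[of "x * N + y"] by (simp add: w1_def)
    have w2: "w2 i \<le> Suc (Suc (2 * j))" for i using w1[of i] w1[of "y * N + x"] by (simp add: w2_def)
    have small: "Suc (s' ''w'' (x * N + y)) < 2 ^ B" "Suc (w1 (y * N + x)) < 2 ^ B"
    proof -
      have "Suc (Suc (2 * j)) \<le> 2 * length es" using j by simp
      with w1[of "y * N + x"] w1[of "x * N + y"] B(2)
      show "Suc (s' ''w'' (x * N + y)) < 2 ^ B" "Suc (w1 (y * N + x)) < 2 ^ B"
        using w0[of "x * N + y"] by (auto simp: less_le_trans)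
    qed
    have sN: "s ''N'' 0 = N" using s(1) by (simp add: N_def)
    have post: "Inv (Suc j) s2" if "s2 ''w'' = w2" for s2
      unfolding Inv_def that
    proof (intro conjI allI impI)
      fix u v assume uv: "u < N" "v < N"
      have "w2 (u * N + v) = s' ''w'' (u * N + v)
        + (if u = x \<and> v = y then 1 else 0) + (if u = y \<and> v = x then 1 else 0)"
      proof -
        have "w1 i = s' ''w'' i + (if i = x * N + y then 1 else 0)"
          "w2 i = w1 i + (if i = y * N + x then 1 else 0)" for i
          by (simp_all add: w1_def w2_def)
        moreover have "u * N + v = x * N + y \<longleftrightarrow> u = x \<and> v = y" "u * N + v = y * N + x \<longleftrightarrow> u = y \<and> v = x"
          using uv xyN by (simp_all only: mat_index_eq_iff)
        ultimately show ?thesis by (simp only:)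
      qed
      also have "s' ''w'' (u * N + v) = edge_weight (mset (take j es)) u v" using inv uv by (simp add: Inv_def)
      also have "\<dots> + (if u = x \<and> v = y then 1 else 0) + (if u = y \<and> v = x then 1 else 0)
        = edge_weight (mset (take (Suc j) es)) u v"
        using j xy(1) by (simp only: take_Suc_conv_app_nth mset_append mset.simps edge_weight_add_mset add_mset_add_single[symmetric])
      finally show "w2 (u * N + v) = edge_weight (mset (take (Suc j) es)) u v" .
    next
      fix i show "w2 i \<le> 2 * Suc j" using w2[of i] by simp
    qed
    show "tot B edge_step s' (1 + (1 + (1 + 1))) (Inv (Suc j))"
      unfolding edge_step_def
      using j fr s(3) sN ex xy(2,3) B small
      by (intro tot_Seq tot_Assign post) (auto simp: w2_def w1_def)
  qed (use s B in \<open>auto simp: Inv_def edge_weight_def\<close>)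
  then show ?thesis by (rule tot_weaken) (auto simp: Inv_def N_def)
qed

text \<open>After n - 1 contractions at most one vertex is left (none for n = 0), so the cap itself
  is the minimum cut.\<close>

lemma phase_inv_final:
  assumes "phase_inv n M C (n - 1) s"
  shows "s ''c'' 0 = C \<and> C \<le> M"
proof -
  obtain V and W :: "nat \<Rightarrow> nat \<Rightarrow> nat" where V: "V \<subseteq> {1..n}" "card V = n - (n - 1)"
    and C: "mincut W V (s ''c'' 0) = C" "s ''c'' 0 \<le> M"
    using assms unfolding phase_inv_def by blast
  have "mincut W V (s ''c'' 0) = s ''c'' 0"
    using V finite_subset by (intro mincut_card_le_1) auto
  with C show ?thesis by simp
qed

lemma tot_min_cut_prog:
  assumes es: "hypergraph 2 n (mset es)" and M: "M = length es"
    and s: "s ''n'' 0 = n" "s ''m'' 0 = M" "s ''edges'' = edges_mem es" "s ''w'' = (\<lambda>_. 0)"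
      "s ''d'' = (\<lambda>_. 0)"
    and B: "Suc n * (2 ^ n * (2 * M)) + n + 2 * M + 2 < 2 ^ B"
  shows "tot B min_cut_prog s (6 * M + (n - 1) * (61 * Suc n ^ 2 + 2) + 7)
    (\<lambda>s'. s' ''c'' 0 = mincut (edge_weight (mset es)) {1..n} M \<and> s' ''c'' 0 \<le> M \<and> s' ''N'' 0 = Suc n)"
    (is "tot _ _ _ _ ?Q")
proof -
  define C where "C = mincut (edge_weight (mset es)) {1..n} M"
  have phases: "tot B (For ''p'' (Minus (Var ''n'') (Num 1)) phase) s'
      ((n - 1) * (61 * Suc n ^ 2 + 2) + 2) ?Q"
    if s': "s' ''n'' 0 = n" "s' ''N'' 0 = Suc n" and inv: "phase_inv n M C 0 s'" for s'
  proof (rule tot_For[where Inv = "phase_inv n M C"])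
    fix p and s2 :: mem
    assume p: "p < n - 1" "s2 ''p'' 0 = p" and inv: "phase_inv n M C p s2"
    assume "\<And>x. x \<noteq> ''p'' \<Longrightarrow> x \<notin> writes phase \<Longrightarrow> s2 x = s' x"
    then have "s2 ''n'' 0 = n" "s2 ''N'' 0 = Suc n" using s' by simp_all
    then show "tot B phase s2 (61 * Suc n ^ 2) (phase_inv n M C (Suc p))"
      using p inv B by (intro tot_phase) auto
  next
    fix s2 :: mem
    assume inv: "phase_inv n M C (n - 1) s2"
    assume "\<And>x. x \<noteq> ''p'' \<Longrightarrow> x \<notin> writes phase \<Longrightarrow> s2 x = s' x"
    then have "s2 ''N'' 0 = Suc n" using s' by simp
    then show "?Q s2" using phase_inv_final[OF inv] unfolding C_def by metis
  qed (use s' inv B in \<open>auto simp: phase_inv_def\<close>)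
  have init: "phase_inv n M C 0 s'"
    if w: "\<forall>u<Suc n. \<forall>v<Suc n. s' ''w'' (u * Suc n + v) = edge_weight (mset es) u v"
      "\<forall>i. s' ''w'' i \<le> 2 * M" and d: "s' ''d'' = (\<lambda>_. 0)(0 := 1)" and c: "s' ''c'' 0 = M" for s'
    unfolding phase_inv_def using w
    by (intro exI[of _ "{1..n}"] exI[of _ "edge_weight (mset es)"]) (auto simp: d c C_def symmetric_weights_edge_weight)
  have "tot B min_cut_prog s (1 + ((6 * M + 2) + (1 + (1 + ((n - 1) * (61 * Suc n ^ 2 + 2) + 2))))) ?Q"
    unfolding min_cut_prog_def
  proof (rule tot_Seq, rule tot_Assign, simp, use s B in simp, rule tot_Seq)
    let ?s1 = "s(''N'' := (s ''N'')(aval (Num 0) s := aval (Plus (Var ''n'') (Num 1)) s))"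
    show "tot B (For ''e'' (Var ''m'') edge_step) ?s1 (6 * M + 2)
      (\<lambda>s'. tot B (Seq (Set_var ''d'' (Num 1)) (Seq (Set_var ''c'' (Var ''m''))
        (For ''p'' (Minus (Var ''n'') (Num 1)) phase))) s'
        (1 + (1 + ((n - 1) * (61 * Suc n ^ 2 + 2) + 2))) ?Q)"
      unfolding M
    proof (rule tot_weaken[OF tot_build[OF es] _ order_refl])
      fix s2 :: mem
      assume w: "(\<forall>u<Suc n. \<forall>v<Suc n. s2 ''w'' (u * Suc n + v) = edge_weight (mset es) u v) \<and>
        (\<forall>i. s2 ''w'' i \<le> 2 * length es)"
      assume "\<And>x. x \<notin> writes (For ''e'' (Var ''m'') edge_step) \<Longrightarrow> s2 x = ?s1 x"
      then have fr: "s2 ''n'' 0 = n" "s2 ''N'' 0 = Suc n" "s2 ''m'' 0 = M" "s2 ''d'' = (\<lambda>_. 0)"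
        using s by (simp_all add: writes_For)
      show "tot B (Seq (Set_var ''d'' (Num 1)) (Seq (Set_var ''c'' (Var ''m''))
        (For ''p'' (Minus (Var ''n'') (Num 1)) phase))) s2
        (1 + (1 + ((n - 1) * (61 * Suc n ^ 2 + 2) + 2)))
        (\<lambda>s'. s' ''c'' 0 = mincut (edge_weight (mset es)) {1..n} (length es) \<and> s' ''c'' 0 \<le> length es \<and> s' ''N'' 0 = Suc n)"
        unfolding M[symmetric] using fr w B
        by (intro tot_Seq tot_Assign phases init) (simp_all add: M[symmetric])
    qed (use s B M in \<open>auto simp: field_simps\<close>)
  qed
  then show ?thesis by (rule tot_time) simp
qed

text \<open>One Horner step: the next binary digit is the parity of the floor.\<close>

lemma floor_half: "\<lfloor>y\<rfloor> = 2 * \<lfloor>y / 2\<rfloor> + \<lfloor>y\<rfloor> mod 2" for y :: real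
proof -
  have "\<lfloor>y / 2\<rfloor> = \<lfloor>y\<rfloor> div 2" using floor_divide_real_eq_div[of 2 y] by simp
  then show ?thesis by simp
qed

lemma tot_budget_prog:
  assumes \<eta>: "0 \<le> \<eta>" "\<eta> \<le> 1"
    and s: "s ''n'' 0 = n" "s ''N'' 0 = Suc n" "s ''m'' 0 = M"
      "s ''eta'' = (\<lambda>i. nat (\<lfloor>\<eta> * 2 ^ i\<rfloor> mod 2))"
    and B: "2 ^ n + n + 2 + 2 * (M * (2 ^ n + 1)) < 2 ^ B"
  shows "tot B budget_prog s (6 * n + 10) (\<lambda>s'. s' ''L'' 0 = budget n \<eta> M)"
proof -
  have num_le: "nat \<lfloor>\<eta> * 2 ^ j / 2\<rfloor> \<le> 2 ^ n" if "j \<le> Suc n" for j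
  proof -
    have "\<eta> * 2 ^ j \<le> 1 * 2 ^ Suc n" using \<eta> that by (intro mult_mono power_increasing) auto
    then have "\<lfloor>\<eta> * 2 ^ j / 2\<rfloor> \<le> \<lfloor>2 ^ n :: real\<rfloor>" by (intro floor_mono) simp
    also have "\<lfloor>2 ^ n :: real\<rfloor> = 2 ^ n" by (metis floor_of_int of_int_numeral of_int_power)
    finally show ?thesis by (simp add: nat_le_iff)
  qed
  have loop1: "tot B (For ''i'' (Var ''N'')
      (Set_var ''E'' (Plus (Plus (Var ''E'') (Var ''E'')) (Arr ''eta'' (Var ''i''))))) s1
      (Suc n * (1 + 2) + 2) Q"
    if s1: "s1 ''N'' 0 = Suc n" "s1 ''eta'' = s ''eta''" "s1 ''E'' 0 = 0"
      and Q: "\<And>s2. s2 ''E'' 0 = nat \<lfloor>\<eta> * 2 ^ n\<rfloor> \<Longrightarrow> (\<And>x. x \<notin> {''i'', ''E''} \<Longrightarrow> s2 x = s1 x) \<Longrightarrow> Q s2"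
    for s1 Q
  \<comment> \<open>After j digits the last one read has index j - 1. Writing 2^j / 2 makes this
    meaningful for j = 0, where the value is 0 even for \<eta> = 1.\<close>
  proof (rule tot_For[where Inv = "\<lambda>j s'. s' ''E'' 0 = nat \<lfloor>\<eta> * 2 ^ j / 2\<rfloor>"])
    fix j and s2 :: mem
    assume j: "j < Suc n" "s2 ''i'' 0 = j" and E: "s2 ''E'' 0 = nat \<lfloor>\<eta> * 2 ^ j / 2\<rfloor>"
    assume "\<And>x. x \<noteq> ''i'' \<Longrightarrow> x \<notin> writes (Set_var ''E'' (Plus (Plus (Var ''E'') (Var ''E'')) (Arr ''eta'' (Var ''i'')))) \<Longrightarrow> s2 x = s1 x"
    then have eta: "s2 ''eta'' = s ''eta''" using s1 by simp
    have "nat \<lfloor>\<eta> * 2 ^ j\<rfloor> = nat (2 * \<lfloor>\<eta> * 2 ^ j / 2\<rfloor> + \<lfloor>\<eta> * 2 ^ j\<rfloor> mod 2)"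
      using floor_half[of "\<eta> * 2 ^ j"] by simp
    also have "\<dots> = 2 * nat \<lfloor>\<eta> * 2 ^ j / 2\<rfloor> + nat (\<lfloor>\<eta> * 2 ^ j\<rfloor> mod 2)"
      using \<eta> by (simp add: nat_add_distrib nat_mult_distrib)
    finally have val: "s2 ''E'' 0 + s2 ''E'' 0 + s2 ''eta'' j = nat \<lfloor>\<eta> * 2 ^ Suc j / 2\<rfloor>"
      using E eta s(4) by simp
    moreover have "nat \<lfloor>\<eta> * 2 ^ Suc j / 2\<rfloor> < 2 ^ B"
      using num_le[of "Suc j"] j(1) B by linarith
    ultimately show "tot B (Set_var ''E'' (Plus (Plus (Var ''E'') (Var ''E'')) (Arr ''eta'' (Var ''i''))))
      s2 1 (\<lambda>s'. s' ''E'' 0 = nat \<lfloor>\<eta> * 2 ^ Suc j / 2\<rfloor>)"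
      using j(2) by (intro tot_Assign) auto
  next
    have "\<lfloor>\<eta> / 2\<rfloor> = 0" using \<eta> by (simp add: floor_eq_iff)
    then show "s1 ''E'' 0 = nat \<lfloor>\<eta> * 2 ^ 0 / 2\<rfloor>" using s1 by simp
  qed (use s1 B Q in auto)
  have loop2: "tot B (For ''i'' (Var ''n'') (Set_var ''D'' (Plus (Var ''D'') (Var ''D'')))) s1
      (n * (1 + 2) + 2) Q"
    if s1: "s1 ''n'' 0 = n" "s1 ''D'' 0 = 1"
      and Q: "\<And>s2. s2 ''D'' 0 = 2 ^ n \<Longrightarrow> (\<And>x. x \<notin> {''i'', ''D''} \<Longrightarrow> s2 x = s1 x) \<Longrightarrow> Q s2"
    for s1 Q
  proof (rule tot_For[where Inv = "\<lambda>j s'. s' ''D'' 0 = 2 ^ j"])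
    fix j and s2 :: mem
    assume j: "j < n" and D: "s2 ''D'' 0 = 2 ^ j"
    have "(2::nat) ^ Suc j \<le> 2 ^ n" using j by (intro power_increasing) auto
    then show "tot B (Set_var ''D'' (Plus (Var ''D'') (Var ''D''))) s2 1 (\<lambda>s'. s' ''D'' 0 = 2 ^ Suc j)"
      using B D by (intro tot_Assign) auto
  qed (use s1 B Q in auto)
  have L_less: "budget n \<eta> M < 2 ^ B"
  proof -
    have "nat \<lfloor>\<eta> * 2 ^ n\<rfloor> \<le> 2 ^ n" using num_le[of "Suc n"] by simp
    then have "M * (nat \<lfloor>\<eta> * 2 ^ n\<rfloor> + 1) \<le> M * (2 ^ n + 1)" by (intro mult_left_mono) auto
    moreover have "M * (nat \<lfloor>\<eta> * 2 ^ n\<rfloor> + 1) div 2 ^ n \<le> M * (nat \<lfloor>\<eta> * 2 ^ n\<rfloor> + 1)"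
      by (rule div_le_dividend)
    ultimately have "budget n \<eta> M \<le> 2 * (M * (2 ^ n + 1))"
      unfolding budget_def by linarith
    with B show ?thesis by linarith
  qed
  have last: "tot B (Set_var ''L'' (Times (Num 2)
       (Quot (Times (Var ''m'') (Plus (Var ''E'') (Num 1))) (Var ''D'')))) s1 1 (\<lambda>s'. s' ''L'' 0 = budget n \<eta> M)"
    if "s1 ''m'' 0 = M" "s1 ''E'' 0 = nat \<lfloor>\<eta> * 2 ^ n\<rfloor>" "s1 ''D'' 0 = 2 ^ n" for s1
    using L_less that unfolding budget_def by (intro tot_Assign) auto
  have "tot B budget_prog s (1 + ((Suc n * (1 + 2) + 2) + (1 + ((n * (1 + 2) + 2) + 1)))) (\<lambda>s'. s' ''L'' 0 = budget n \<eta> M)"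
    unfolding budget_prog_def using s B
    by (intro tot_Seq tot_Assign loop1 loop2 last) simp_all
  then show ?thesis by (rule tot_time) simp
qed

text \<open>Each factor is at most 2 or n M, hence below 2^(2 + n M). This is crude, but it keeps
  the bit length of every partial product polynomial in n and M.\<close>

lemma karger_num_den_le:
  assumes "c \<le> M" "j \<le> n"
  shows "karger_num c L j \<le> 2 ^ (n * (2 + n * M))" "karger_den c L j \<le> 2 ^ (n * (2 + n * M))"
proof -
  define q where "q = (2::nat) ^ (2 + n * M)"
  have factor: "Suc i * c < q" "2 < q" "1 < q" if "i < j" for i
  proof -
    have "Suc i * c \<le> n * M" using that assms by (intro mult_mono) auto
    also have "\<dots> < 2 ^ (n * M)" by (rule less_exp)
    also have "\<dots> \<le> q" unfolding q_def by (intro power_increasing) auto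
    finally show "Suc i * c < q" .
    have "(2::nat) ^ 2 \<le> q" unfolding q_def by (intro power_increasing) auto
    then show "2 < q" "1 < q" by auto
  qed
  have "karger_num c L j \<le> (\<Prod>i<j. q)"
    unfolding karger_num_def
  proof (intro prod_mono conjI)
    fix i assume "i \<in> {..<j}"
    then show "(if i * c \<le> 2 * L then 2 else Suc i * c) \<le> q"
      using factor[of i] by simp
  qed simp
  moreover have "karger_den c L j \<le> (\<Prod>i<j. q)"
    unfolding karger_den_def
  proof (intro prod_mono conjI)
    fix i assume "i \<in> {..<j}"
    then show "(if i * c \<le> 2 * L then 1 else Suc i * c - 2 * L) \<le> q"
      using factor[of i] by (simp add: le_diff_conv)
  qed simp
  moreover have "(\<Prod>i<j. q) \<le> 2 ^ (n * (2 + n * M))"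
  proof -
    have "(\<Prod>i<j. q) = q ^ j" by simp
    also have "\<dots> \<le> q ^ n" using assms by (intro power_increasing) (auto simp: q_def)
    also have "\<dots> = 2 ^ (n * (2 + n * M))" unfolding q_def power_mult[symmetric] by (simp only: mult.commute)
    finally show ?thesis .
  qed
  ultimately show "karger_num c L j \<le> 2 ^ (n * (2 + n * M))" "karger_den c L j \<le> 2 ^ (n * (2 + n * M))"
    by auto
qed

lemma tot_output_prog:
  assumes s: "s ''n'' 0 = n" "s ''c'' 0 = c" "s ''L'' 0 = L" and c: "c \<le> M"
    and B: "2 ^ (n * (2 + n * M)) + n + 2 < 2 ^ B"
  shows "tot B output_prog s (6 * n + 7)
    (\<lambda>s'. s' ''out'' 0 = (if L < c then 2 else karger_num c L n div karger_den c L n))"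
    (is "tot _ _ _ _ ?Q")
proof -
  define Inv where "Inv j s' \<longleftrightarrow> s' ''P'' 0 = karger_num c L j \<and> s' ''Q'' 0 = karger_den c L j"
    for j and s' :: mem
  have less: "karger_num c L j < 2 ^ B" "karger_den c L j < 2 ^ B" if "j \<le> n" for j
    using karger_num_den_le[OF c that, of L] B by auto
  have loop: "tot B (For ''i'' (Var ''n'') product_step) s1 (n * ((1 + (1 + 1) + 1) + 2) + 2)
      (\<lambda>s'. tot B (Set_var ''out'' (Quot (Var ''P'') (Var ''Q''))) s' 1 ?Q)"
    if s1: "s1 ''n'' 0 = n" "s1 ''c'' 0 = c" "s1 ''L'' 0 = L" and init: "Inv 0 s1" and "\<not> L < c" for s1
  proof (rule tot_For[where Inv = Inv])
    fix j and s2 :: mem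
    assume j: "j < n" "s2 ''i'' 0 = j" and inv: "Inv j s2"
    assume "\<And>x. x \<noteq> ''i'' \<Longrightarrow> x \<notin> writes product_step \<Longrightarrow> s2 x = s1 x"
    then have fr: "s2 ''c'' 0 = c" "s2 ''L'' 0 = L" using s1 by simp_all
    have num: "karger_num c L (Suc j) = karger_num c L j * (if j * c \<le> 2 * L then 2 else Suc j * c)"
      and den: "karger_den c L (Suc j) = karger_den c L j * (if j * c \<le> 2 * L then 1 else Suc j * c - 2 * L)"
      by (simp_all add: karger_num_def karger_den_def)
    show "tot B product_step s2 (1 + (1 + 1) + 1) (Inv (Suc j))"
      unfolding product_step_def using j fr inv less[of "Suc j"]
      by (intro tot_Cond tot_Seq tot_Assign) (auto simp: Inv_def num den mult_2 mult_2_right)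
  next
    fix s2 :: mem
    assume "Inv n s2"
    moreover have "karger_num c L n div karger_den c L n < 2 ^ B"
      using less[of n] div_le_dividend le_less_trans by blast
    ultimately show "tot B (Set_var ''out'' (Quot (Var ''P'') (Var ''Q''))) s2 1 ?Q"
      using \<open>\<not> L < c\<close> by (intro tot_Assign) (auto simp: Inv_def)
  qed (use s1 B init in \<open>auto simp: Inv_def\<close>)
  have "tot B output_prog s (1 + (1 + (1 + ((n * ((1 + (1 + 1) + 1) + 2) + 2) + 1))) + 1) ?Q"
    unfolding output_prog_def using s B
    by (intro tot_Cond tot_Seq tot_Assign loop)
      (auto simp: Inv_def karger_num_def karger_den_def)
  then show ?thesis by (rule tot_time) simp
qed

section \<open>Polynomial bounds on bit length and running time\<close>

text \<open>The first summand pays for the partial products of Karger's quotient,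
  \<open>2 * n + M\<close> for the budget and for matrix entries and keys that grow with each
  contraction; 5 is slack.\<close>

definition bit_bound :: "nat \<Rightarrow> nat \<Rightarrow> nat" where
  "bit_bound n M = n * (2 + n * M) + 2 * n + M + 5"

lemma bit_bound_suffices:
  "Suc n * (2 ^ n * (2 * M)) + n + 2 * M + 2 < 2 ^ bit_bound n M"
  "2 ^ n + n + 2 + 2 * (M * (2 ^ n + 1)) < 2 ^ bit_bound n M"
  "2 ^ (n * (2 + n * M)) + n + 2 < (2 :: nat) ^ bit_bound n M"
proof -
  \<comment> \<open>Three bits are held back: each left side is a sum of at most four terms that are
    at most \<open>z = 2 ^ K\<close>, hence below \<open>8 * z\<close>.\<close>
  define K where "K = n * (2 + n * M) + 2 * n + M + 2"
  define z where "z = (2 :: nat) ^ K"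
  have B: "(2 :: nat) ^ bit_bound n M = 8 * z"
  proof -
    have "bit_bound n M = 3 + K" by (simp add: bit_bound_def K_def)
    then show ?thesis by (simp add: z_def power_add)
  qed
  have pow: "(2 :: nat) ^ k \<le> z" if "k \<le> K" for k
    unfolding z_def using that by (intro power_increasing) auto
  have n: "Suc n \<le> 2 ^ n" by (simp add: Suc_le_eq less_exp)
  have M: "M \<le> 2 ^ M" by (simp add: less_imp_le less_exp)
  have "Suc n * (2 ^ n * (2 * M)) \<le> 2 ^ n * (2 ^ n * (2 * 2 ^ M))"
    using n M by (intro mult_mono) auto
  also have "\<dots> = 2 ^ (n + n + M + 1)" by (simp add: power_add)
  also have "\<dots> \<le> z" by (rule pow) (simp add: K_def)
  finally have 1: "Suc n * (2 ^ n * (2 * M)) \<le> z" .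
  have "2 * (M * (2 ^ n + 1)) \<le> 2 * (2 ^ M * (2 ^ n + 2 ^ n))"
    using M by (intro mult_mono add_mono) auto
  also have "\<dots> = 2 ^ (M + n + 2)" by (simp add: power_add)
  also have "\<dots> \<le> z" by (rule pow) (simp add: K_def)
  finally have 2: "2 * (M * (2 ^ n + 1)) \<le> z" .
  have "2 * M \<le> 2 ^ (M + 1)" using M by simp
  also have "\<dots> \<le> z" by (rule pow) (simp add: K_def)
  finally have 3: "2 * M \<le> z" .
  have 4: "2 ^ n \<le> z" "2 ^ (n * (2 + n * M)) \<le> z" by (rule pow, simp add: K_def)+
  have 5: "n \<le> z" using n 4(1) by linarith
  have 6: "2 \<le> z" using pow[of 1] by (simp add: K_def)
  show "Suc n * (2 ^ n * (2 * M)) + n + 2 * M + 2 < 2 ^ bit_bound n M"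
    unfolding B using 1 3 5 6 by linarith
  show "2 ^ n + n + 2 + 2 * (M * (2 ^ n + 1)) < 2 ^ bit_bound n M"
    unfolding B using 2 4 5 6 by linarith
  show "2 ^ (n * (2 + n * M)) + n + 2 < (2 :: nat) ^ bit_bound n M"
    unfolding B using 4 5 6 by linarith
qed

definition step_bound :: "nat \<Rightarrow> nat \<Rightarrow> nat" where
  "step_bound n M = 6 * M + (n - 1) * (61 * Suc n ^ 2 + 2) + 12 * n + 24"

lemma tot_algorithm:
  assumes es: "hypergraph 2 n (mset es)" and \<eta>: "0 \<le> \<eta>" "\<eta> \<le> 1"
  shows "tot (bit_bound n (length es)) algorithm (input_mem n es \<eta>) (step_bound n (length es))
    (\<lambda>s. s ''out'' 0 = assignment_bound n \<eta> (mset es))" (is "tot ?B _ ?s _ ?Q")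
proof -
  define M where "M = length es"
  note B = bit_bound_suffices[where n = n and M = M]
  have s: "?s ''n'' 0 = n" "?s ''m'' 0 = M" "?s ''edges'' = edges_mem es" "?s ''w'' = (\<lambda>_. 0)"
    "?s ''d'' = (\<lambda>_. 0)" "?s ''eta'' = (\<lambda>i. nat (\<lfloor>\<eta> * 2 ^ i\<rfloor> mod 2))"
    by (simp_all add: input_mem_def edges_mem_def M_def)
  have "tot (bit_bound n M) algorithm ?s
    ((6 * M + (n - 1) * (61 * Suc n ^ 2 + 2) + 7) + ((6 * n + 10) + (6 * n + 7))) ?Q"
    unfolding algorithm_def
  proof (rule tot_Seq, rule tot_weaken[OF tot_min_cut_prog[OF es M_def s(1-5) B(1)] _ order_refl])
    fix s1 :: mem
    assume c: "s1 ''c'' 0 = mincut (edge_weight (mset es)) {1..n} M \<and> s1 ''c'' 0 \<le> M \<and> s1 ''N'' 0 = Suc n"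
    assume "\<And>x. x \<notin> writes min_cut_prog \<Longrightarrow> s1 x = ?s x"
    then have fr: "s1 ''n'' = ?s ''n''" "s1 ''m'' = ?s ''m''" "s1 ''eta'' = ?s ''eta''" by simp_all
    show "tot (bit_bound n M) (Seq budget_prog output_prog) s1 ((6 * n + 10) + (6 * n + 7)) ?Q"
    proof (rule tot_Seq, rule tot_weaken[OF tot_budget_prog[OF \<eta> _ _ _ _ B(2)] _ order_refl])
      fix s2 :: mem
      assume L: "s2 ''L'' 0 = budget n \<eta> M"
      assume "\<And>x. x \<notin> writes budget_prog \<Longrightarrow> s2 x = s1 x"
      then have fr2: "s2 ''n'' = s1 ''n''" "s2 ''c'' = s1 ''c''" by simp_all
      show "tot (bit_bound n M) output_prog s2 (6 * n + 7) ?Q"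
      proof (rule tot_weaken[OF tot_output_prog[where s = s2 and c = "s1 ''c'' 0", OF _ _ L _ B(3)] _ order_refl])
        show "s2 ''n'' 0 = n" "s2 ''c'' 0 = s1 ''c'' 0" "s1 ''c'' 0 \<le> M" using s fr fr2 c by simp_all
        fix s3 :: mem
        assume "s3 ''out'' 0 = (if budget n \<eta> M < s1 ''c'' 0 then 2
          else karger_num (s1 ''c'' 0) (budget n \<eta> M) n div karger_den (s1 ''c'' 0) (budget n \<eta> M) n)"
        then show "?Q s3"
          using c unfolding assignment_bound_def Let_def size_mset M_def[symmetric] by metis
      qed
    qed (use s fr c in simp_all)
  qed
  then show ?thesis unfolding M_def by (rule tot_time) (simp add: step_bound_def)
qed

lemma bits_at_most_input_mem:
  assumes es: "hypergraph 2 n (mset es)"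
  shows "bits_at_most (bit_bound n (length es)) (input_mem n es \<eta>)"
proof -
  have B: "n < 2 ^ bit_bound n (length es)" "length es < 2 ^ bit_bound n (length es)"
      "2 < (2::nat) ^ bit_bound n (length es)"
    using bit_bound_suffices(1)[of n "length es"] by linarith+
  have edges: "concat es ! j \<le> n" if "j < length (concat es)" for j
  proof -
    have "concat es ! j \<in> set (concat es)" using that by (rule nth_mem)
    then obtain e where e: "e \<in> set es" "concat es ! j \<in> set e" by auto
    have "set e \<subseteq> {1..n}"
      using es e(1) unfolding hypergraph_def tuples_def set_mset_mset by blast
    then show ?thesis using e(2) by auto
  qed
  have eta: "nat (\<lfloor>\<eta> * 2 ^ i\<rfloor> mod 2) < 2" for i by (simp add: nat_less_iff)
  show ?thesis
    unfolding bits_at_most_def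
  proof (intro allI)
    fix a i
    have "input_mem n es \<eta> a i \<le> n \<or> input_mem n es \<eta> a i \<le> length es \<or> input_mem n es \<eta> a i < 2"
      using edges[of i] eta[of i] by (simp add: input_mem_def)
    then show "input_mem n es \<eta> a i < 2 ^ bit_bound n (length es)" using B by linarith
  qed
qed

text \<open>Since x = n + M + 1 is at least 1, lower powers are absorbed into x^3. This gives 105
  x^3 steps at 12000 x^3 each, and 105 * 12000 = 1260000.\<close>

lemma total_time_le: "step_bound n M * unit_cost (bit_bound n M) \<le> 1260000 * Suc (n + M) ^ 6"
proof -
  define x where "x = Suc (n + M)"
  have x3: "1 \<le> x ^ 3" "x \<le> x ^ 3"
    using power_increasing[of 0 3 x] power_increasing[of 1 3 x] by (auto simp: x_def)
  have nx: "n \<le> x" "M \<le> x" by (auto simp: x_def)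
  have "(n - 1) * (61 * Suc n ^ 2 + 2) \<le> x * (61 * x ^ 2 + 2)"
    by (intro mult_mono add_mono power_mono) (auto simp: x_def)
  also have "\<dots> = 61 * x ^ 3 + 2 * x" by (simp add: algebra_simps power3_eq_cube power2_eq_square)
  finally have "step_bound n M \<le> 105 * x ^ 3"
    using x3 nx unfolding step_bound_def by linarith
  moreover have "n * (2 + n * M) \<le> x * (2 + x * x)" using nx by (intro mult_mono add_mono) auto
  then have "n * (2 + n * M) \<le> x ^ 3 + 2 * x" by (simp add: algebra_simps power3_eq_cube)
  then have "bit_bound n M \<le> 11 * x ^ 3"
    using x3 nx unfolding bit_bound_def by linarith
  then have "unit_cost (bit_bound n M) \<le> 12000 * x ^ 3"
    using x3(1) unfolding unit_cost_def by simp
  ultimately have "step_bound n M * unit_cost (bit_bound n M) \<le> (105 * x ^ 3) * (12000 * x ^ 3)"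
    by (rule mult_mono) auto
  also have "\<dots> = 1260000 * x ^ 6" by (simp add: power_add[symmetric])
  finally show ?thesis by (simp only: x_def)
qed

lemma poly_time_assignment_bound: "poly_time 2 assignment_bound"
  unfolding poly_time_def
proof (rule exI[of _ algorithm], rule exI[of _ "smult 1260000 ([:1, 1:] ^ 6)"], intro allI ballI impI)
  fix n es and \<eta> :: real
  assume \<eta>: "\<eta> \<in> {0..1}" and es: "hypergraph 2 n (mset es)"
  obtain t s where ts: "exec algorithm (input_mem n es \<eta>) t s"
      "t \<le> step_bound n (length es) * unit_cost (bit_bound n (length es))"
      "s ''out'' 0 = assignment_bound n \<eta> (mset es)"
    using tot_algorithm[OF es] bits_at_most_input_mem[OF es] \<eta> unfolding tot_def by fastforce
  have "t \<le> poly (smult 1260000 ([:1, 1:] ^ 6)) (n + length es)"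
    using ts(2) total_time_le[of n "length es"] by simp
  with ts show "\<exists>t s. exec algorithm (input_mem n es \<eta>) t s \<and>
      t \<le> poly (smult 1260000 ([:1, 1:] ^ 6)) (n + length es) \<and>
      s ''out'' 0 = assignment_bound n \<eta> (mset es)"
    by blast
qed

theorem theorem4p1:
  shows "\<exists>c>0. \<forall>\<delta>>0. \<exists>n\<^sub>0 :: nat. \<exists>N :: nat \<Rightarrow> real \<Rightarrow> nat list multiset \<Rightarrow> nat.
    poly_time 2 N \<and>
    (\<forall>\<eta> :: real. 0 \<le> \<eta> \<and> \<eta> \<le> 1 \<longrightarrow>
      (\<forall>n G I. hypergraph 2 n G \<and> xor_instance I G \<longrightarrow>
         card (satisfying_assignments n \<eta> I) \<le> N n \<eta> G) \<and>
      (\<forall>n\<ge>n\<^sub>0. \<forall>\<Delta> m :: real.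
         \<Delta> = real n powr \<delta> \<and> m = \<Delta> * real n \<and> m / (2 ^ 2 * real n ^ 2) \<le> 1 \<longrightarrow>
         measure_pmf.prob (random_hypergraph 2 m n)
           {G. real (N n \<eta> G) \<le>
                 (if \<eta> \<le> 1 / (3 * real n) then 2
                  else 2 * exp (3 * \<eta> * real n * ln (real n)))}
         \<ge> 1 - exp (- (real n powr (c * \<delta>)))))"
\<comment> \<open>Halving \<delta> is what absorbed the polynomial factor of the union
  bound.\<close>
proof (intro exI[of _ "1 / 2 :: real"] conjI allI impI)
  fix \<delta> :: real assume "0 < \<delta>"
  from eventually_failure_prob_le[OF this] obtain n1 where n1:
    "\<And>n. n \<ge> n1 \<Longrightarrow> exp (- (real n powr \<delta> * real n) / 1024)
      + ((1 + exp (- (real n powr \<delta>) / 32)) ^ n - 1) \<le> exp (- (real n powr (1 / 2 * \<delta>)))"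
    by blast
  show "\<exists>n\<^sub>0 :: nat. \<exists>N :: nat \<Rightarrow> real \<Rightarrow> nat list multiset \<Rightarrow> nat.
    poly_time 2 N \<and>
    (\<forall>\<eta> :: real. 0 \<le> \<eta> \<and> \<eta> \<le> 1 \<longrightarrow>
      (\<forall>n G I. hypergraph 2 n G \<and> xor_instance I G \<longrightarrow>
         card (satisfying_assignments n \<eta> I) \<le> N n \<eta> G) \<and>
      (\<forall>n\<ge>n\<^sub>0. \<forall>\<Delta> m :: real.
         \<Delta> = real n powr \<delta> \<and> m = \<Delta> * real n \<and> m / (2 ^ 2 * real n ^ 2) \<le> 1 \<longrightarrow>
         measure_pmf.prob (random_hypergraph 2 m n)
           {G. real (N n \<eta> G) \<le>
                 (if \<eta> \<le> 1 / (3 * real n) then 2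
                  else 2 * exp (3 * \<eta> * real n * ln (real n)))}
         \<ge> 1 - exp (- (real n powr (1 / 2 * \<delta>)))))"
  \<comment> \<open>The deterministic estimate needs 100 and the asymptotic one \<open>n1\<close>;
    both are fixed before \<eta>, and the algorithm does not depend on \<delta>.\<close>
  proof (intro exI[of _ "max 100 n1"] exI[of _ assignment_bound] conjI allI impI)
    show "poly_time 2 assignment_bound" by (rule poly_time_assignment_bound)
  next
    fix \<eta> :: real and n G I
    assume "0 \<le> \<eta> \<and> \<eta> \<le> 1" "hypergraph 2 n G \<and> xor_instance I G"
    then show "card (satisfying_assignments n \<eta> I) \<le> assignment_bound n \<eta> G"
      by (intro card_satisfying_assignments_le) auto
  next
    fix \<eta> \<Delta> m :: real and n :: nat
    assume \<eta>: "0 \<le> \<eta> \<and> \<eta> \<le> 1" and n: "max 100 n1 \<le> n"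
      and \<Delta>: "\<Delta> = real n powr \<delta> \<and> m = \<Delta> * real n \<and> m / (2 ^ 2 * real n ^ 2) \<le> 1"
    have "0 < \<Delta>" "100 \<le> n" using \<Delta> n by simp_all
    then show "1 - exp (- (real n powr (1 / 2 * \<delta>))) \<le> measure_pmf.prob (random_hypergraph 2 m n)
        {G. real (assignment_bound n \<eta> G) \<le>
          (if \<eta> \<le> 1 / (3 * real n) then 2 else 2 * exp (3 * \<eta> * real n * ln (real n)))}"
      using prob_assignment_bound_le[of n \<Delta> \<eta>] n1[of n] n \<eta> \<Delta> by fastforce
  qed
qed simp

end
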